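(* Let $k$ be a field with $\operatorname{char}k\ne2$, let $\lambda\in k$, let $T(2)$ be the Sweedler Hopf algebra, and let $A=k[u,v]$ with the $T(2)$-action and braiding $\mathsf c=\mathsf c_\lambda$ given in the context. The algebra $A\otimes^{\mathsf c}A^{\mathrm{op}_{\mathsf c}}$ is generated by $u,v,u',v'$ subject to the relations $$r_1:=uv-vu,\quad r_2:=u'v'-v'u',\quad r_3:=uv'-v'u,$$ $$r_4:=vv'+v'v-\lambda uu',\quad r_5:=uu'-u'u,\quad r_6:=vu'-u'v.$$ There is a 1-parameter PBW deformation of $(A\otimes^{\mathsf c}A^{\mathrm{op}_{\mathsf c}})\# T(2)$, $$\mathcal{D}_{A\otimes^{\mathsf c}A^{\mathrm{op}_{\mathsf c}},\kappa}=\frac{k\langle u,v,u',v'\rangle\# T(2)}{(r_i-\kappa(r_i)\mid 1\le i\le 6)},$$ given by $\kappa(r_4)=\alpha\in k$ and $\kappa(r_i)=0$ for $i\ne4$. Moreover, all PBW deformations $\mathcal{D}_{A\otimes^{\mathsf c}A^{\mathrm{op}_{\mathsf c}},\kappa}$ with $\kappa$ a $k$-linear map from $I=\operatorname{span}_k(r_1,\dots,r_6)$ to $T(2)$ are of this form.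
   Context: $T(2)$ is generated by $g,x$ with $g^2=1$, $x^2=0$, $gx+xg=0$, $\Delta(g)=g\otimes g$, $\Delta(x)=x\otimes1+g\otimes x$, $\epsilon(g)=1$, $\epsilon(x)=0$, $S(g)=g$, $S(x)=-gx$. It is quasitriangular with R-matrix $$\mathrm R_\lambda=\tfrac12(1\otimes1+1\otimes g+g\otimes1-g\otimes g)+\tfrac\lambda2(x\otimes x+x\otimes gx+gx\otimes gx-gx\otimes x),$$ and the braiding on $T(2)$-modules is $\mathsf c_\lambda=\mathrm R_\lambda\circ\sigma$, $\sigma$ the flip. The action on $A=k[u,v]$ is $g\cdot u=u$, $g\cdot v=-v$, $x\cdot u=0$, $x\cdot v=u$. For module algebras $A,B$ the braided product $A\otimes^{\mathsf c}B$ is $A\otimes B$ with multiplication $(m_A\otimes m_B)\circ(1\otimes\mathsf c_{B,A}\otimes1)$, and the braided opposite $A^{\mathrm{op}_{\mathsf c}}$ is $A$ with multiplication $m_A\circ\mathsf c_{A,A}$ and the same Hopf action; both are module algebras. $u',v'$ denote the copies of $u,v$ in $A^{\mathrm{op}_{\mathsf c}}$ (with the same $T(2)$-action). For a Hopf algebra $H$ and an $H$-module algebra $R$, $R\# H$ is $R\otimes H$ with product $(a\otimes h)(a'\otimes h')=\sum a(h_1\cdot a')\otimes h_2h'$. The algebra $\mathcal{D}_{R,\kappa}$ is filtered by giving $H$ degree $0$ and the generators $u,v,u',v'$ degree $1$; it is a PBW deformation of $R\# H$ if its associated graded algebra is isomorphic to $R\# H$ as an $\mathbb{N}$-graded algebra.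 *)

theory Defs
  imports
    Complex_Main
    "HOL-Library.Poly_Mapping"
    "HOL-Library.Product_Plus"
    "HOL-Algebra.QuotRing"
    "HOL-Algebra.Module"
begin

section \<open>Vector spaces with a chosen basis\<close>

text \<open>
  All spaces before taking quotients come with a basis: the \<open>k\<close>-vector space with basis \<open>'b\<close> is
  \<open>'b \<Rightarrow>\<^sub>0 'k\<close>, and \<open>M \<otimes> N\<close> is the space on the product of the two bases.  Linear and bilinear
  maps, in particular multiplications and Hopf actions, are given by their values on basis elements
  and extended by \<open>lin_ext\<close> and \<open>bilin_ext\<close>.
\<close>

abbreviation bas :: "'b \<Rightarrow> ('b \<Rightarrow>\<^sub>0 'k::field)" where
  "bas b \<equiv> Poly_Mapping.single b 1"

definition scl :: "'k::field \<Rightarrow> ('b \<Rightarrow>\<^sub>0 'k) \<Rightarrow> ('b \<Rightarrow>\<^sub>0 'k)" where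
  "scl c p = Poly_Mapping.map ((*) c) p"

definition lin_ext :: "('a \<Rightarrow> ('b \<Rightarrow>\<^sub>0 'k)) \<Rightarrow> ('a \<Rightarrow>\<^sub>0 'k) \<Rightarrow> ('b \<Rightarrow>\<^sub>0 'k::field)" where
  "lin_ext f p = (\<Sum>a\<in>Poly_Mapping.keys p. scl (Poly_Mapping.lookup p a) (f a))"

definition tens :: "('a \<Rightarrow>\<^sub>0 'k) \<Rightarrow> ('b \<Rightarrow>\<^sub>0 'k) \<Rightarrow> ('a \<times> 'b \<Rightarrow>\<^sub>0 'k::field)" where
  "tens p q = lin_ext (\<lambda>a. lin_ext (\<lambda>b. bas (a, b)) q) p"

definition bilin_ext ::
    "('a \<Rightarrow> 'b \<Rightarrow> ('c \<Rightarrow>\<^sub>0 'k)) \<Rightarrow> ('a \<Rightarrow>\<^sub>0 'k) \<Rightarrow> ('b \<Rightarrow>\<^sub>0 'k) \<Rightarrow> ('c \<Rightarrow>\<^sub>0 'k::field)" where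
  "bilin_ext f p q = lin_ext (\<lambda>(a, b). f a b) (tens p q)"

text \<open>
  Algebras are HOL-Algebra \<open>module\<close> records (ring operations and \<open>smult\<close>); the scalars are the
  elements of the type \<open>'k\<close>.  \<open>alg_of m e\<close> is the algebra with structure constants \<open>m\<close> whose
  unit is the basis element \<open>e\<close>.
\<close>

definition alg_of :: "('b \<Rightarrow> 'b \<Rightarrow> ('b \<Rightarrow>\<^sub>0 'k::field)) \<Rightarrow> 'b \<Rightarrow> ('k, 'b \<Rightarrow>\<^sub>0 'k) module" where
  "alg_of m e = \<lparr>carrier = UNIV, mult = bilin_ext m, one = bas e, zero = 0, add = (+), smult = scl\<rparr>"

definition alg_hom :: "('k, 'a) module \<Rightarrow> ('k, 'b) module \<Rightarrow> ('a \<Rightarrow> 'b) set" where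
  "alg_hom A B = {f \<in> ring_hom A B. \<forall>c. \<forall>x\<in>carrier A. f (c \<odot>\<^bsub>A\<^esub> x) = c \<odot>\<^bsub>B\<^esub> f x}"


section \<open>The Sweedler Hopf algebra, its R-matrices and braidings\<close>

text \<open>\<open>T(2)\<close> has the basis \<open>1, g, x, gx\<close>; the antipode plays no role in what follows.\<close>

datatype t2 = T1 | Tg | Tx | Tgx

fun t2_mul :: "t2 \<Rightarrow> t2 \<Rightarrow> (t2 \<Rightarrow>\<^sub>0 'k::field)" where
  "t2_mul T1 h = bas h"
| "t2_mul h T1 = bas h"
| "t2_mul Tg Tg = bas T1"
| "t2_mul Tg Tx = bas Tgx"
| "t2_mul Tg Tgx = bas Tx"
| "t2_mul Tx Tg = - bas Tgx"
| "t2_mul Tx Tx = 0"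
| "t2_mul Tx Tgx = 0"
| "t2_mul Tgx Tg = - bas Tx"
| "t2_mul Tgx Tx = 0"
| "t2_mul Tgx Tgx = 0"

fun t2_comul :: "t2 \<Rightarrow> (t2 \<times> t2 \<Rightarrow>\<^sub>0 'k::field)" where
  "t2_comul T1 = bas (T1, T1)"
| "t2_comul Tg = bas (Tg, Tg)"
| "t2_comul Tx = bas (Tx, T1) + bas (Tg, Tx)"
| "t2_comul Tgx = bas (Tgx, Tg) + bas (T1, Tgx)"

fun t2_counit :: "t2 \<Rightarrow> 'k::field" where
  "t2_counit T1 = 1"
| "t2_counit Tg = 1"
| "t2_counit Tx = 0"
| "t2_counit Tgx = 0"

definition Rmat :: "'k::field \<Rightarrow> (t2 \<times> t2 \<Rightarrow>\<^sub>0 'k)" where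
  "Rmat l = scl (1/2) (bas (T1, T1) + bas (T1, Tg) + bas (Tg, T1) - bas (Tg, Tg))
          + scl (l/2) (bas (Tx, Tx) + bas (Tx, Tgx) + bas (Tgx, Tgx) - bas (Tgx, Tx))"

text \<open>A Hopf action on a space with basis \<open>'m\<close>, on basis elements.\<close>

type_synonym ('k, 'm) action = "t2 \<Rightarrow> 'm \<Rightarrow> ('m \<Rightarrow>\<^sub>0 'k)"

text \<open>The action of \<open>r \<in> T(2) \<otimes> T(2)\<close> on \<open>M \<otimes> N\<close>.\<close>

definition act2 ::
    "('k, 'm) action \<Rightarrow> ('k, 'n) action \<Rightarrow> (t2 \<times> t2 \<Rightarrow>\<^sub>0 'k) \<Rightarrow> 'm \<times> 'n
      \<Rightarrow> ('m \<times> 'n \<Rightarrow>\<^sub>0 'k::field)" where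
  "act2 actM actN r = (\<lambda>(m, n). lin_ext (\<lambda>(h, h'). tens (actM h m) (actN h' n)) r)"

definition tens_act :: "('k, 'm) action \<Rightarrow> ('k, 'n) action \<Rightarrow> ('k::field, 'm \<times> 'n) action" where
  "tens_act actM actN h = act2 actM actN (t2_comul h)"

definition braiding ::
    "'k::field \<Rightarrow> ('k, 'm) action \<Rightarrow> ('k, 'n) action \<Rightarrow> 'm \<times> 'n \<Rightarrow> ('n \<times> 'm \<Rightarrow>\<^sub>0 'k)" where
  "braiding l actM actN = (\<lambda>(m, n). act2 actN actM (Rmat l) (n, m))"

text \<open>
  \<open>(m\<^sub>A \<otimes> m\<^sub>B) \<circ> (1 \<otimes> c\<^sub>B\<^sub>,\<^sub>A \<otimes> 1)\<close> evaluated at \<open>(a \<otimes> b) \<otimes> (a' \<otimes> b')\<close>.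
\<close>

definition braided_mul ::
    "'k::field \<Rightarrow> ('a \<Rightarrow> 'a \<Rightarrow> ('a \<Rightarrow>\<^sub>0 'k)) \<Rightarrow> ('k, 'a) action
      \<Rightarrow> ('b \<Rightarrow> 'b \<Rightarrow> ('b \<Rightarrow>\<^sub>0 'k)) \<Rightarrow> ('k, 'b) action
      \<Rightarrow> 'a \<times> 'b \<Rightarrow> 'a \<times> 'b \<Rightarrow> ('a \<times> 'b \<Rightarrow>\<^sub>0 'k)" where
  "braided_mul l mA actA mB actB = (\<lambda>(a, b) (a', b').
     lin_ext (\<lambda>(a'', b''). tens (mA a a'') (mB b'' b')) (braiding l actB actA (b, a')))"

definition braided_op ::
    "'k::field \<Rightarrow> ('a \<Rightarrow> 'a \<Rightarrow> ('a \<Rightarrow>\<^sub>0 'k)) \<Rightarrow> ('k, 'a) action \<Rightarrow> 'a \<Rightarrow> 'a \<Rightarrow> ('a \<Rightarrow>\<^sub>0 'k)" where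
  "braided_op l mA actA a b = lin_ext (\<lambda>(b', a'). mA b' a') (braiding l actA actA (a, b))"

definition smash_mul ::
    "('r \<Rightarrow> 'r \<Rightarrow> ('r \<Rightarrow>\<^sub>0 'k)) \<Rightarrow> ('k::field, 'r) action
      \<Rightarrow> 'r \<times> t2 \<Rightarrow> 'r \<times> t2 \<Rightarrow> ('r \<times> t2 \<Rightarrow>\<^sub>0 'k)" where
  "smash_mul m act = (\<lambda>(a, h) (a', h').
     lin_ext (\<lambda>(h1, h2). tens (bilin_ext m (bas a) (act h1 a')) (t2_mul h2 h')) (t2_comul h))"

text \<open>
  If the algebra with structure constants \<open>m\<close> and unit \<open>e\<close> contains generators on which \<open>T(2)\<close> acts
  by \<open>gact\<close>, then the module algebra axioms \<open>h \<cdot> 1 = \<epsilon>(h) 1\<close> and \<open>h \<cdot> (ab) = (h\<^sub>1 \<cdot> a)(h\<^sub>2 \<cdot> b)\<close>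
  determine the action on products of generators.
\<close>

primrec word_act ::
    "('b \<Rightarrow> 'b \<Rightarrow> ('b \<Rightarrow>\<^sub>0 'k)) \<Rightarrow> 'b \<Rightarrow> (t2 \<Rightarrow> 'y \<Rightarrow> ('b \<Rightarrow>\<^sub>0 'k::field))
      \<Rightarrow> 'y list \<Rightarrow> t2 \<Rightarrow> ('b \<Rightarrow>\<^sub>0 'k)" where
  "word_act m e gact [] = (\<lambda>h. scl (t2_counit h) (bas e))"
| "word_act m e gact (y # ys) = (\<lambda>h.
     lin_ext (\<lambda>(h1, h2). bilin_ext m (gact h1 y) (word_act m e gact ys h2)) (t2_comul h))"

primrec word_eval ::
    "('b \<Rightarrow> 'b \<Rightarrow> ('b \<Rightarrow>\<^sub>0 'k)) \<Rightarrow> 'b \<Rightarrow> ('y \<Rightarrow> ('b \<Rightarrow>\<^sub>0 'k::field)) \<Rightarrow> 'y list \<Rightarrow> ('b \<Rightarrow>\<^sub>0 'k)" where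
  "word_eval m e f [] = bas e"
| "word_eval m e f (y # ys) = bilin_ext m (f y) (word_eval m e f ys)"


section \<open>The polynomial algebra in two variables and its braided enveloping algebra\<close>

datatype var = U | V

fun var_act :: "('k::field, var) action" where
  "var_act T1 y = bas y"
| "var_act Tg U = bas U"
| "var_act Tg V = - bas V"
| "var_act Tx U = 0"
| "var_act Tx V = bas U"
| "var_act Tgx U = 0"
| "var_act Tgx V = bas U"

text \<open>
  \<open>A = k[u,v]\<close>, with the pair \<open>(i, j)\<close> standing for the monomial \<open>u\<^sup>i v\<^sup>j\<close>; its product is the one
  of \<^theory>\<open>HOL-Library.Poly_Mapping\<close>.
\<close>

type_synonym mono = "nat \<times> nat"

fun var_mono :: "var \<Rightarrow> mono" where
  "var_mono U = (1, 0)"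
| "var_mono V = (0, 1)"

definition A_mul :: "mono \<Rightarrow> mono \<Rightarrow> (mono \<Rightarrow>\<^sub>0 'k::field)" where
  "A_mul a b = bas a * bas b"

definition A_act :: "('k::field, mono) action" where
  "A_act h = (\<lambda>(i, j). word_act A_mul 0 (\<lambda>h y. lin_ext (\<lambda>z. bas (var_mono z)) (var_act h y))
     (replicate i U @ replicate j V) h)"

definition Ae_mul :: "'k::field \<Rightarrow> mono \<times> mono \<Rightarrow> mono \<times> mono \<Rightarrow> (mono \<times> mono \<Rightarrow>\<^sub>0 'k)" where
  "Ae_mul l = braided_mul l A_mul A_act (braided_op l A_mul A_act) A_act"

definition Ae :: "'k::field \<Rightarrow> ('k, mono \<times> mono \<Rightarrow>\<^sub>0 'k) module" where
  "Ae l = alg_of (Ae_mul l) 0"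

definition Ae_act :: "('k::field, mono \<times> mono) action" where
  "Ae_act = tens_act A_act A_act"

definition Ae_smash :: "'k::field \<Rightarrow> ('k, (mono \<times> mono) \<times> t2 \<Rightarrow>\<^sub>0 'k) module" where
  "Ae_smash l = alg_of (smash_mul (Ae_mul l) Ae_act) (0, T1)"

definition Ae_smash_comp :: "nat \<Rightarrow> ((mono \<times> mono) \<times> t2 \<Rightarrow>\<^sub>0 'k::field) set" where
  "Ae_smash_comp n = {p. \<forall>(((i, j), (i', j')), h) \<in> Poly_Mapping.keys p. i + j + i' + j' = n}"


section \<open>The free algebra, the relations, and the smash product\<close>

text \<open>\<open>Inl U, Inl V, Inr U, Inr V\<close> are the generators \<open>u, v, u', v'\<close>.\<close>

type_synonym gen = "var + var"

fun gen_act :: "t2 \<Rightarrow> gen \<Rightarrow> (gen list \<Rightarrow>\<^sub>0 'k::field)" where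
  "gen_act h (Inl y) = lin_ext (\<lambda>z. bas [Inl z]) (var_act h y)"
| "gen_act h (Inr y) = lin_ext (\<lambda>z. bas [Inr z]) (var_act h y)"

definition free_mul :: "gen list \<Rightarrow> gen list \<Rightarrow> (gen list \<Rightarrow>\<^sub>0 'k::field)" where
  "free_mul w w' = bas (w @ w')"

definition free_alg :: "('k::field, gen list \<Rightarrow>\<^sub>0 'k) module" where
  "free_alg = alg_of free_mul []"

definition free_act :: "('k::field, gen list) action" where
  "free_act h w = word_act free_mul [] gen_act w h"

fun Ae_gen :: "gen \<Rightarrow> (mono \<times> mono \<Rightarrow>\<^sub>0 'k::field)" where
  "Ae_gen (Inl y) = bas (var_mono y, 0)"
| "Ae_gen (Inr y) = bas (0, var_mono y)"

text \<open>The homomorphism from the free algebra that sends \<open>u, v, u', v'\<close> to their namesakes.\<close>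

definition Ae_eval :: "'k::field \<Rightarrow> (gen list \<Rightarrow>\<^sub>0 'k) \<Rightarrow> (mono \<times> mono \<Rightarrow>\<^sub>0 'k)" where
  "Ae_eval l = lin_ext (word_eval (Ae_mul l) 0 Ae_gen)"

definition rel :: "'k::field \<Rightarrow> nat \<Rightarrow> (gen list \<Rightarrow>\<^sub>0 'k)" where
  "rel l i = (let u = Inl U; v = Inl V; u' = Inr U; v' = Inr V in
     [bas [u, v] - bas [v, u],
      bas [u', v'] - bas [v', u'],
      bas [u, v'] - bas [v', u],
      bas [v, v'] + bas [v', v] - scl l (bas [u, u']),
      bas [u, u'] - bas [u', u],
      bas [v, u'] - bas [u', v]] ! (i - 1))"

definition rels :: "'k::field \<Rightarrow> (gen list \<Rightarrow>\<^sub>0 'k) set" where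
  "rels l = rel l ` {1..6}"

text \<open>The linear maps from \<open>I = span(r\<^sub>1, \<dots>, r\<^sub>6)\<close> to \<open>T(2)\<close>; their values outside \<open>I\<close> are irrelevant.\<close>

definition rel_maps :: "'k::field \<Rightarrow> ((gen list \<Rightarrow>\<^sub>0 'k) \<Rightarrow> (t2 \<Rightarrow>\<^sub>0 'k)) set" where
  "rel_maps l = (let I = Modules.module.span scl (rels l) in
     {\<kappa>. (\<forall>p\<in>I. \<forall>q\<in>I. \<kappa> (p + q) = \<kappa> p + \<kappa> q) \<and> (\<forall>c. \<forall>p\<in>I. \<kappa> (scl c p) = scl c (\<kappa> p))})"

definition free_smash :: "('k::field, gen list \<times> t2 \<Rightarrow>\<^sub>0 'k) module" where
  "free_smash = alg_of (smash_mul free_mul free_act) ([], T1)"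

definition free_smash_filt :: "nat \<Rightarrow> (gen list \<times> t2 \<Rightarrow>\<^sub>0 'k::field) set" where
  "free_smash_filt n = {p. \<forall>(w, h) \<in> Poly_Mapping.keys p. length w \<le> n}"


section \<open>Quotient algebras and associated graded algebras\<close>

text \<open>\<open>A Quot J\<close> together with its scalar multiplication.\<close>

definition alg_quot :: "('k, 'a) module \<Rightarrow> 'a set \<Rightarrow> ('k, 'a set) module" where
  "alg_quot A J = ring.extend (A Quot J)
     (module.fields (\<lambda>c X. \<Union>x\<in>X. J +>\<^bsub>A\<^esub> (c \<odot>\<^bsub>A\<^esub> x)))"

definition filt_prev :: "('k, 'a) module \<Rightarrow> (nat \<Rightarrow> 'a set) \<Rightarrow> nat \<Rightarrow> 'a set" where
  "filt_prev D F n = (case n of 0 \<Rightarrow> {\<zero>\<^bsub>D\<^esub>} | Suc m \<Rightarrow> F m)"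

text \<open>
  The associated graded algebra \<open>\<Oplus>\<^sub>n F\<^sub>n / F\<^sub>n\<^sub>-\<^sub>1\<close> of an algebra \<open>D\<close> with an increasing filtration \<open>F\<close>,
  where \<open>F\<^sub>-\<^sub>1 = 0\<close>.  An element is a finitely supported family of cosets.  The \<open>n\<close>-th component of
  a product is the coset of the sum of the products of representatives of the components of degrees
  \<open>i\<close> and \<open>n - i\<close>.
\<close>

definition gr_comp :: "('k, 'a) module \<Rightarrow> (nat \<Rightarrow> 'a set) \<Rightarrow> nat \<Rightarrow> 'a set set" where
  "gr_comp D F n = (\<lambda>x. filt_prev D F n +>\<^bsub>D\<^esub> x) ` F n"

definition gr_alg :: "('k, 'a) module \<Rightarrow> (nat \<Rightarrow> 'a set) \<Rightarrow> ('k, nat \<Rightarrow> 'a set) module" where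
  "gr_alg D F =
    \<lparr>carrier = {c. (\<forall>n. c n \<in> gr_comp D F n) \<and> finite {n. c n \<noteq> filt_prev D F n}},
     mult = (\<lambda>c d n. \<Union>x\<in>Pi UNIV c. \<Union>y\<in>Pi UNIV d.
               filt_prev D F n +>\<^bsub>D\<^esub> (\<Oplus>\<^bsub>D\<^esub>i\<in>{..n}. x i \<otimes>\<^bsub>D\<^esub> y (n - i))),
     one = (\<lambda>n. if n = 0 then filt_prev D F 0 +>\<^bsub>D\<^esub> \<one>\<^bsub>D\<^esub> else filt_prev D F n),
     zero = filt_prev D F,
     add = (\<lambda>c d n. c n <+>\<^bsub>D\<^esub> d n),
     smult = (\<lambda>a c n. \<Union>x\<in>c n. filt_prev D F n +>\<^bsub>D\<^esub> (a \<odot>\<^bsub>D\<^esub> x))\<rparr>"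

definition gr_alg_comp :: "('k, 'a) module \<Rightarrow> (nat \<Rightarrow> 'a set) \<Rightarrow> nat \<Rightarrow> (nat \<Rightarrow> 'a set) set" where
  "gr_alg_comp D F n = {c \<in> carrier (gr_alg D F). \<forall>m. m \<noteq> n \<longrightarrow> c m = filt_prev D F m}"

definition graded_iso ::
    "('k, 'a) module \<Rightarrow> (nat \<Rightarrow> 'a set) \<Rightarrow> ('k, 'b) module \<Rightarrow> (nat \<Rightarrow> 'b set) \<Rightarrow> bool" where
  "graded_iso S S_comp T T_comp \<longleftrightarrow>
     (\<exists>\<phi> \<in> alg_hom S T. bij_betw \<phi> (carrier S) (carrier T) \<and> (\<forall>n. \<phi> ` S_comp n = T_comp n))"


section \<open>The deformations\<close>

definition def_ideal ::
    "'k::field \<Rightarrow> ((gen list \<Rightarrow>\<^sub>0 'k) \<Rightarrow> (t2 \<Rightarrow>\<^sub>0 'k)) \<Rightarrow> (gen list \<times> t2 \<Rightarrow>\<^sub>0 'k) set" where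
  "def_ideal l \<kappa> = Idl\<^bsub>free_smash\<^esub> ((\<lambda>r. tens r (bas T1) - tens (bas []) (\<kappa> r)) ` rels l)"

definition def_alg ::
    "'k::field \<Rightarrow> ((gen list \<Rightarrow>\<^sub>0 'k) \<Rightarrow> (t2 \<Rightarrow>\<^sub>0 'k)) \<Rightarrow> ('k, (gen list \<times> t2 \<Rightarrow>\<^sub>0 'k) set) module" where
  "def_alg l \<kappa> = alg_quot free_smash (def_ideal l \<kappa>)"

definition def_filt ::
    "'k::field \<Rightarrow> ((gen list \<Rightarrow>\<^sub>0 'k) \<Rightarrow> (t2 \<Rightarrow>\<^sub>0 'k)) \<Rightarrow> nat \<Rightarrow> (gen list \<times> t2 \<Rightarrow>\<^sub>0 'k) set set" where
  "def_filt l \<kappa> n = (\<lambda>p. def_ideal l \<kappa> +>\<^bsub>free_smash\<^esub> p) ` free_smash_filt n"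

definition PBW_deformation :: "'k::field \<Rightarrow> ((gen list \<Rightarrow>\<^sub>0 'k) \<Rightarrow> (t2 \<Rightarrow>\<^sub>0 'k)) \<Rightarrow> bool" where
  "PBW_deformation l \<kappa> \<longleftrightarrow>
     graded_iso (gr_alg (def_alg l \<kappa>) (def_filt l \<kappa>)) (gr_alg_comp (def_alg l \<kappa>) (def_filt l \<kappa>))
                (Ae_smash l) Ae_smash_comp"

definition scalar_at_4 :: "'k::field \<Rightarrow> 'k \<Rightarrow> ((gen list \<Rightarrow>\<^sub>0 'k) \<Rightarrow> (t2 \<Rightarrow>\<^sub>0 'k)) \<Rightarrow> bool" where
  "scalar_at_4 l \<alpha> \<kappa> \<longleftrightarrow>
     \<kappa> (rel l 4) = scl \<alpha> (bas T1) \<and> (\<forall>i\<in>{1..6}. i \<noteq> 4 \<longrightarrow> \<kappa> (rel l i) = 0)"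

end

theory Submission
  imports Defs
begin

text \<open>
  Working out the braiding shows that multiplication in \<open>A \<otimes>\<^sup>c A\<^sup>o\<^sup>p\<close> has an explicit formula on
  monomials, and that replacing \<open>\<lambda> u u'\<close> by \<open>\<lambda> u u' + \<alpha>\<close> in it (on the same basis) gives an
  associative \<open>T(2)\<close>-module algebra for every \<open>\<alpha>\<close>, whose smash product with \<open>T(2)\<close> is filtered with
  associated graded algebra the one for \<open>\<alpha> = 0\<close>.  Every word reduces, modulo the relations, to a
  combination of normal words that evaluate to the monomials; hence the deformed smash product is the
  quotient \<open>D\<^sub>\<kappa>\<close>, which yields the presentation and the PBW property.

  Conversely, if \<open>D\<^sub>\<kappa>\<close> is a PBW deformation, then comparing dimensions in degrees 0 and 1 shows that
  the ideal contains no nonzero element of degree at most 1.  Commuting the relations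
  \<open>r\<^sub>i - \<kappa>(r\<^sub>i)\<close> with \<open>g\<close> and \<open>x\<close>, and resolving the overlaps of \<open>u, v, v'\<close> and of \<open>u', v, v'\<close>,
  produces such elements; that they vanish leaves only the scalar at \<open>r\<^sub>4\<close>.
\<close>

section \<open>Linear maps between spaces with a basis\<close>

text \<open>Rewriting alone only shows that normal words span; their linear independence is the
  obstacle. It comes from a concrete model instead of resolving overlaps: the product is written
  down on the fixed monomial basis, associativity is a finite check on parities of exponents, and
  the normal words are a section of the evaluation map \<open>ev\<close>. Rewriting gives the other
  composite modulo the ideal, so the ideal is the whole kernel. A constant can be added to r4
  because g fixes r4 and x sends it to r3 - r6, which is zero in the quotient, while x kills
  constants. The relations r1, r2, r3, r6 change sign under g and r5 is the image of r3 under x,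
  which excludes constants there. Only dimensions are transferred: 4 in degree 0 and 16 in degree 1
  are finite, so a surjection between the pieces is injective. Characteristic other than 2 enters
  through the factor 1/2 in the R-matrix and through constraints that arise as twice a coefficient
  of \<kappa>.\<close>

lemma lookup_scl [simp]: "Poly_Mapping.lookup (scl c p) b = c * Poly_Mapping.lookup p b"
  by (simp add: scl_def Poly_Mapping.map.rep_eq when_def)

lemma scl_single [simp]: "scl c (Poly_Mapping.single b d) = Poly_Mapping.single b (c * d)"
  by (simp add: scl_def)

global_interpretation scl: vector_space_pair
  "scl :: 'k \<Rightarrow> ('a \<Rightarrow>\<^sub>0 'k) \<Rightarrow> ('a \<Rightarrow>\<^sub>0 'k::field)" "scl :: 'k \<Rightarrow> ('b \<Rightarrow>\<^sub>0 'k) \<Rightarrow> ('b \<Rightarrow>\<^sub>0 'k)"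
  by unfold_locales (auto intro!: poly_mapping_eqI simp: lookup_add algebra_simps)

abbreviation klin :: "(('a \<Rightarrow>\<^sub>0 'k::field) \<Rightarrow> ('b \<Rightarrow>\<^sub>0 'k)) \<Rightarrow> bool" where
  "klin \<equiv> module_hom scl scl"

lemma klin_iff: "klin f \<longleftrightarrow> (\<forall>p q. f (p + q) = f p + f q) \<and> (\<forall>c p. f (scl c p) = scl c (f p))"
  by (simp add: module_hom_iff scl.vs1.module_axioms)

lemmas klin_add = module_hom.add
lemmas klin_scale = module_hom.scale
lemmas klin_0 = module_hom.zero
lemmas klin_diff = module_hom.diff
lemmas klin_neg = module_hom.neg
lemmas klin_sum = module_hom.sum

lemma klin_ident: "klin (\<lambda>p. p)"
  by (simp add: klin_iff)

lemma klin_zero_fun: "klin (\<lambda>p. 0)"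
  by (simp add: klin_iff)

lemma klin_add_fun: "klin f \<Longrightarrow> klin g \<Longrightarrow> klin (\<lambda>p. f p + g p)"
  by (simp add: klin_iff scl.vs1.scale_right_distrib add_ac)

lemma klin_diff_fun: "klin f \<Longrightarrow> klin g \<Longrightarrow> klin (\<lambda>p. f p - g p)"
  by (simp add: klin_iff scl.vs1.scale_right_diff_distrib)

lemma klin_neg_fun: "klin f \<Longrightarrow> klin (\<lambda>p. - f p)"
  by (simp add: klin_iff)

lemma klin_scl_fun: "klin f \<Longrightarrow> klin (\<lambda>p. scl c (f p))"
  by (simp add: klin_iff scl.vs1.scale_right_distrib mult.commute)

lemma klin_comp: "klin f \<Longrightarrow> klin g \<Longrightarrow> klin (\<lambda>p. f (g p))"
  by (simp add: klin_iff)

text \<open>The support of a sum need not be the union of the supports. Summing over a common finite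
  superset makes additivity a termwise statement.\<close>

lemma lin_ext_superset:
  assumes "finite A" "Poly_Mapping.keys p \<subseteq> A"
  shows "lin_ext f p = (\<Sum>a\<in>A. scl (Poly_Mapping.lookup p a) (f a))"
  unfolding lin_ext_def using assms
  by (intro sum.mono_neutral_left) (auto simp: in_keys_iff)

lemma klin_lin_ext: "klin (lin_ext f)"
proof -
  have "lin_ext f (p + q) = lin_ext f p + lin_ext f q" for p q
  proof -
    let ?A = "Poly_Mapping.keys p \<union> Poly_Mapping.keys q"
    show ?thesis
      using keys_add[of p q] lin_ext_superset[of ?A "p + q" f]
        lin_ext_superset[of ?A p f] lin_ext_superset[of ?A q f]
      by (simp add: lookup_add scl.vs1.scale_left_distrib sum.distrib)
  qed
  moreover have "lin_ext f (scl c p) = scl c (lin_ext f p)" for c p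
    by (subst lin_ext_superset[of "Poly_Mapping.keys p"])
      (auto simp: in_keys_iff lin_ext_def scl.vs1.scale_sum_right)
  ultimately show ?thesis
    by (simp add: klin_iff)
qed

lemma lin_ext_single [simp]: "lin_ext f (Poly_Mapping.single b c) = scl c (f b)"
  by (simp add: lin_ext_def)

lemmas lin_ext_add [simp] = klin_add [OF klin_lin_ext]
lemmas lin_ext_scl [simp] = klin_scale [OF klin_lin_ext]
lemmas lin_ext_0 [simp] = klin_0 [OF klin_lin_ext]
lemmas lin_ext_diff [simp] = klin_diff [OF klin_lin_ext]
lemmas lin_ext_neg [simp] = klin_neg [OF klin_lin_ext]

lemma lin_ext_bas: "lin_ext bas p = p"
  by (rule poly_mapping_eqI)
    (simp add: lin_ext_def lookup_sum lookup_single when_def in_keys_iff sum.delta')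

text \<open>Identities that are linear in several arguments are reduced to basis elements by using
  this once per argument, the other arguments being either already general or still basis
  elements.\<close>

lemma klin_eqI:
  fixes f g :: "('a \<Rightarrow>\<^sub>0 'k::field) \<Rightarrow> ('b \<Rightarrow>\<^sub>0 'k)"
  assumes "klin f" "klin g" "\<And>b. f (bas b) = g (bas b)"
  shows "f p = g p"
proof -
  have "h p = (\<Sum>b\<in>Poly_Mapping.keys p. scl (Poly_Mapping.lookup p b) (h (bas b)))"
    if "klin h" for h :: "('a \<Rightarrow>\<^sub>0 'k) \<Rightarrow> ('b \<Rightarrow>\<^sub>0 'k)"
  proof -
    have "h p = h (\<Sum>b\<in>Poly_Mapping.keys p. scl (Poly_Mapping.lookup p b) (bas b))"
      using lin_ext_bas[of p] by (simp only: lin_ext_def)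
    then show ?thesis
      by (simp only: klin_sum[OF that] klin_scale[OF that])
  qed
  from this[OF assms(1)] this[OF assms(2)] show ?thesis
    by (simp only: assms(3))
qed

lemma klin_lin_ext_param:
  assumes "\<And>a. klin (F a)"
  shows "klin (\<lambda>q. lin_ext (\<lambda>a. F a q) p)"
  using assms
  by (simp add: klin_iff lin_ext_def scl.vs1.scale_right_distrib sum.distrib
      scl.vs1.scale_sum_right mult.commute)

lemma tens_bas:
  "tens (Poly_Mapping.single a c) (Poly_Mapping.single b d) = Poly_Mapping.single (a, b) (c * d)"
  by (simp add: tens_def)

lemma klin_tens_left: "klin (\<lambda>p. tens p q)"
  unfolding tens_def by (rule klin_lin_ext)

lemma klin_tens_right: "klin (\<lambda>q. tens p q)"
  unfolding tens_def by (intro klin_lin_ext_param klin_lin_ext)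

lemma klin_bilin_left: "klin (\<lambda>p. bilin_ext m p q)"
  unfolding bilin_ext_def by (intro klin_comp[OF klin_lin_ext] klin_tens_left)

lemma klin_bilin_right: "klin (\<lambda>q. bilin_ext m p q)"
  unfolding bilin_ext_def by (intro klin_comp[OF klin_lin_ext] klin_tens_right)

lemmas tens_simps =
  klin_add [OF klin_tens_left] klin_scale [OF klin_tens_left] klin_0 [OF klin_tens_left]
  klin_diff [OF klin_tens_left] klin_neg [OF klin_tens_left]
  klin_add [OF klin_tens_right] klin_scale [OF klin_tens_right] klin_0 [OF klin_tens_right]
  klin_diff [OF klin_tens_right] klin_neg [OF klin_tens_right]

lemmas bilin_ext_simps =
  klin_add [OF klin_bilin_left] klin_scale [OF klin_bilin_left] klin_0 [OF klin_bilin_left]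
  klin_diff [OF klin_bilin_left] klin_neg [OF klin_bilin_left]
  klin_add [OF klin_bilin_right] klin_scale [OF klin_bilin_right] klin_0 [OF klin_bilin_right]
  klin_diff [OF klin_bilin_right] klin_neg [OF klin_bilin_right]

lemma bilin_ext_bas [simp]:
  "bilin_ext m (Poly_Mapping.single a c) (Poly_Mapping.single b d) = scl (c * d) (m a b)"
  by (simp add: bilin_ext_def tens_bas)

lemmas scl_simps = scl.vs1.scale_right_distrib scl.vs1.scale_left_distrib scl.vs1.scale_left_diff_distrib
  scl.vs1.scale_right_diff_distrib

lemmas klin_intros = klin_lin_ext klin_comp[OF klin_lin_ext] klin_tens_left klin_tens_right
  klin_bilin_left klin_bilin_right klin_add_fun klin_neg_fun klin_diff_fun
  klin_zero_fun klin_ident klin_scl_fun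
  klin_comp[OF klin_tens_left] klin_comp[OF klin_tens_right]
  klin_comp[OF klin_bilin_left] klin_comp[OF klin_bilin_right]

section \<open>Algebras given by structure constants\<close>

locale sc_algebra =
  fixes m :: "'b \<Rightarrow> 'b \<Rightarrow> ('b \<Rightarrow>\<^sub>0 'k::field)" and e :: 'b
  assumes assoc_bas: "bilin_ext m (m a b) (bas c) = bilin_ext m (bas a) (m b c)"
    and unit_left_bas: "m e a = bas a"
    and unit_right_bas: "m a e = bas a"
begin

abbreviation prod_sc (infixl "\<star>" 70) where "p \<star> q \<equiv> bilin_ext m p q"

lemma unit_left [simp]: "bas e \<star> p = p"
  by (rule klin_eqI[of "\<lambda>p. bas e \<star> p" "\<lambda>p. p"]) (simp_all add: klin_intros unit_left_bas)

lemma unit_right [simp]: "p \<star> bas e = p"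
  by (rule klin_eqI[of "\<lambda>p. p \<star> bas e" "\<lambda>p. p"]) (simp_all add: klin_intros unit_right_bas)

lemma mult_assoc: "p \<star> q \<star> r = p \<star> (q \<star> r)"
proof -
  have 1: "bas a \<star> bas b \<star> r = bas a \<star> (bas b \<star> r)" for a b
    by (rule klin_eqI[where p = r]) (simp_all add: klin_intros assoc_bas)
  have 2: "bas a \<star> q \<star> r = bas a \<star> (q \<star> r)" for a
    by (rule klin_eqI[where p = q]) (simp_all only: klin_intros 1)
  show ?thesis
    by (rule klin_eqI[where p = p]) (simp_all only: klin_intros 2)
qed

lemma ring_alg_of: "ring (alg_of m e)"
proof (rule ringI)
  show "abelian_group (alg_of m e)"
    by (rule abelian_groupI)
      (auto simp: alg_of_def algebra_simps intro!: exI[of _ "- x" for x])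
qed (auto simp: alg_of_def bilin_ext_simps mult_assoc intro!: monoidI)

lemma word_eval_append:
  "word_eval m e f (xs @ ys) = word_eval m e f xs \<star> word_eval m e f ys"
  by (induction xs) (simp_all add: mult_assoc)

end

section \<open>Smash products with \<open>T(2)\<close>\<close>

text \<open>Since g and x generate T(2), it is enough to ask for the relations between their
  actions, for gx to act as the composite, and for the product and unit rules given by the
  coproducts and counits of g and x.\<close>

locale t2_module_algebra = sc_algebra m e
  for m :: "'b \<Rightarrow> 'b \<Rightarrow> ('b \<Rightarrow>\<^sub>0 'k::field)" and e :: 'b +
  fixes act :: "('k, 'b) action"
  assumes act_1_bas: "act T1 a = bas a"
    and act_gx_bas: "act Tgx a = lin_ext (act Tg) (act Tx a)"
    and act_gg_bas: "lin_ext (act Tg) (act Tg a) = bas a"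
    and act_xx_bas: "lin_ext (act Tx) (act Tx a) = 0"
    and act_xg_bas: "lin_ext (act Tx) (act Tg a) = - lin_ext (act Tg) (act Tx a)"
    and act_g_mult_bas: "lin_ext (act Tg) (m a b) = act Tg a \<star> act Tg b"
    and act_x_mult_bas: "lin_ext (act Tx) (m a b) = act Tx a \<star> bas b + act Tg a \<star> act Tx b"
    and act_g_unit: "act Tg e = bas e"
    and act_x_unit: "act Tx e = 0"
begin

abbreviation act_ext (infixr "\<rhd>" 75) where "h \<rhd> p \<equiv> lin_ext (act h) p"

lemma act_1 [simp]: "T1 \<rhd> p = p"
  by (rule klin_eqI[where p = p]) (simp_all add: klin_intros klin_ident act_1_bas)

lemma act_gx [simp]: "Tgx \<rhd> p = Tg \<rhd> Tx \<rhd> p"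
  by (rule klin_eqI[where p = p]) (simp_all add: klin_intros act_gx_bas)

lemma act_gg [simp]: "Tg \<rhd> Tg \<rhd> p = p"
  by (rule klin_eqI[where p = p]) (simp_all add: klin_intros klin_ident act_gg_bas)

lemma act_xx [simp]: "Tx \<rhd> Tx \<rhd> p = 0"
  by (rule klin_eqI[where p = p]) (simp_all add: klin_intros klin_ident act_xx_bas)

lemma act_xg [simp]: "Tx \<rhd> Tg \<rhd> p = - (Tg \<rhd> Tx \<rhd> p)"
  by (rule klin_eqI[where p = p]) (simp_all add: klin_intros klin_ident act_xg_bas)

lemma act_g_mult [simp]: "Tg \<rhd> (p \<star> q) = (Tg \<rhd> p) \<star> (Tg \<rhd> q)"
proof -
  have 1: "Tg \<rhd> (bas a \<star> q) = (Tg \<rhd> bas a) \<star> (Tg \<rhd> q)" for a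
    by (rule klin_eqI[where p = q]) (simp_all add: klin_intros act_g_mult_bas)
  show ?thesis
    by (rule klin_eqI[where p = p]) (simp_all only: klin_intros 1)
qed

lemma act_x_mult [simp]: "Tx \<rhd> (p \<star> q) = (Tx \<rhd> p) \<star> q + (Tg \<rhd> p) \<star> (Tx \<rhd> q)"
proof -
  have 1: "Tx \<rhd> (bas a \<star> q) = (Tx \<rhd> bas a) \<star> q + (Tg \<rhd> bas a) \<star> (Tx \<rhd> q)" for a
    by (rule klin_eqI[where p = q]) (simp_all add: klin_intros act_x_mult_bas)
  show ?thesis
    by (rule klin_eqI[where p = p]) (simp_all only: klin_intros 1)
qed

abbreviation smash_prod (infixl "\<diamondop>" 70) where "p \<diamondop> q \<equiv> bilin_ext (smash_mul m act) p q"

text \<open>Only the T(2) factors stay basis elements here. Associativity of the smash product then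
  becomes a case distinction over triples of basis elements of T(2), with arbitrary elements in the
  other factor.\<close>

lemma smash_tens:
  "tens p (bas h) \<diamondop> tens q (bas h') =
    lin_ext (\<lambda>(h1, h2). tens (p \<star> (h1 \<rhd> q)) (t2_mul h2 h')) (t2_comul h)"
proof -
  have 1: "tens (bas a) (bas h) \<diamondop> tens q (bas h') =
    lin_ext (\<lambda>(h1, h2). tens (bas a \<star> (h1 \<rhd> q)) (t2_mul h2 h')) (t2_comul h)" for a
  proof (rule klin_eqI[where p = q])
    show "klin (\<lambda>q. lin_ext (\<lambda>(h1, h2). tens (bas a \<star> (h1 \<rhd> q)) (t2_mul h2 h')) (t2_comul h))"
      by (rule klin_lin_ext_param) (simp add: split_beta klin_intros)
  qed (simp_all add: klin_intros tens_bas smash_mul_def)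
  show ?thesis
  proof (rule klin_eqI[where p = p])
    show "klin (\<lambda>p. lin_ext (\<lambda>(h1, h2). tens (p \<star> (h1 \<rhd> q)) (t2_mul h2 h')) (t2_comul h))"
      by (rule klin_lin_ext_param) (simp add: split_beta klin_intros)
  qed (simp_all only: klin_intros 1)
qed

sublocale smash: sc_algebra "smash_mul m act" "(e, T1)"
proof
  fix a b c :: "'b \<times> t2"
  have "bilin_ext (smash_mul m act) (tens p (bas h) \<diamondop> tens q (bas h')) (tens r (bas h'')) =
    tens p (bas h) \<diamondop> (tens q (bas h') \<diamondop> tens r (bas h''))" for p q r h h' h''
    by (cases h; cases h'; cases h'')
      (simp_all add: smash_tens tens_simps bilin_ext_simps mult_assoc)
  from this[of "bas (fst a)" "snd a" "bas (fst b)" "snd b" "bas (fst c)" "snd c"]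
  show "smash_mul m act a b \<diamondop> bas c = bas a \<diamondop> smash_mul m act b c"
    by (simp add: tens_bas)
next
  fix a :: "'b \<times> t2"
  show "smash_mul m act (e, T1) a = bas a"
    by (cases a) (simp add: smash_mul_def tens_bas tens_simps act_1_bas unit_left_bas)
  show "smash_mul m act a (e, T1) = bas a"
    by (cases a; cases "snd a")
      (simp_all add: smash_mul_def tens_bas tens_simps act_1_bas unit_right_bas act_gx_bas
        act_g_unit act_x_unit bilin_ext_simps tens_simps)
qed

end

section \<open>The braided enveloping algebra and its deformation\<close>

abbreviation A_gact :: "t2 \<Rightarrow> var \<Rightarrow> (mono \<Rightarrow>\<^sub>0 'k::field)" where
  "A_gact h y \<equiv> lin_ext (\<lambda>z. bas (var_mono z)) (var_act h y)"

lemma A_mul_simp [simp]: "A_mul (i, j) (k, n) = bas (i + k, j + n)"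
  by (simp add: A_mul_def mult_single)

text \<open>x acts as a skew derivation, so x.v^j is u v^(j-1) times an alternating sum of j signs,
  which is 1 for odd j and 0 for even j. The same happens for gx with the signs in reverse
  order.\<close>

lemma word_act_replicate_V:
  "word_act A_mul 0 A_gact (replicate j V) T1 = (bas (0, j) :: mono \<Rightarrow>\<^sub>0 'k::field)"
  "word_act A_mul 0 A_gact (replicate j V) Tg = (Poly_Mapping.single (0, j) ((-1) ^ j) :: mono \<Rightarrow>\<^sub>0 'k)"
  "word_act A_mul 0 A_gact (replicate j V) Tx = (if odd j then bas (1, j - 1) else (0 :: mono \<Rightarrow>\<^sub>0 'k))"
  "word_act A_mul 0 A_gact (replicate j V) Tgx = (if odd j then bas (1, j - 1) else (0 :: mono \<Rightarrow>\<^sub>0 'k))"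
proof (induction j)
  case 0
  {
    case 1 show ?case by (simp add: zero_prod_def)
  next
    case 2 show ?case by (simp add: zero_prod_def)
  next
    case 3 show ?case by simp
  next
    case 4 show ?case by simp
  }
next
  case (Suc j)
  {
    case 1 show ?case by (simp add: Suc)
  next
    case 2 show ?case by (simp add: Suc bilin_ext_simps single_uminus)
  next
    case 3 show ?case
      by (cases "even j") (auto simp: Suc bilin_ext_simps single_uminus elim: oddE)
  next
    case 4 show ?case
      by (cases "even j") (auto simp: Suc bilin_ext_simps single_uminus elim: oddE)
  }
qed

text \<open>u is fixed by g and killed by x and gx, so every element of T(2) acts linearly over
  k[u].\<close>

lemma word_act_replicate_U:
  "word_act A_mul 0 A_gact (replicate i U @ ys) h =
    (bas (i, 0) * word_act A_mul 0 A_gact ys h :: mono \<Rightarrow>\<^sub>0 'k::field)"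
proof -
  have *: "bilin_ext A_mul (bas a) p = bas a * p" for a and p :: "mono \<Rightarrow>\<^sub>0 'k"
  proof (rule klin_eqI[where p = p])
    show "klin (\<lambda>p. bas a * (p :: mono \<Rightarrow>\<^sub>0 'k))"
      by (simp add: klin_iff distrib_left scl_def mult_map_scale_conv_mult mult.left_commute)
  qed (simp_all add: klin_intros A_mul_def)
  show ?thesis
  proof (induction i arbitrary: h)
    case 0
    show ?case by (simp flip: zero_prod_def)
  next
    case (Suc i)
    have "word_act A_mul 0 A_gact (replicate (Suc i) U @ ys) h =
        (bas (1, 0) * (bas (i, 0) * word_act A_mul 0 A_gact ys h) :: mono \<Rightarrow>\<^sub>0 'k)"
      by (cases h) (simp_all add: Suc * bilin_ext_simps)
    also have "bas (1, 0) * (bas (i, 0) * p) = bas (Suc i, 0) * p" for p :: "mono \<Rightarrow>\<^sub>0 'k"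
      by (simp add: mult.assoc[symmetric] mult_single)
    finally show ?case .
  qed
qed

lemma A_act_simps:
  "A_act T1 (i, j) = bas (i, j)"
  "A_act Tg (i, j) = Poly_Mapping.single (i, j) ((-1) ^ j)"
  "A_act Tx (i, j) = (if odd j then bas (Suc i, j - 1) else 0)"
  "A_act Tgx (i, j) = (if odd j then bas (Suc i, j - 1) else 0)"
  by (simp_all add: A_act_def word_act_replicate_U word_act_replicate_V mult_single)

lemma two_neq_0:
  assumes "CHAR('k::field) \<noteq> 2"
  shows "(2 :: 'k) \<noteq> 0"
proof
  assume "(2 :: 'k) = 0"
  then have "of_nat 2 = (0 :: 'k)"
    by simp
  then have "CHAR('k) dvd 2"
    by (simp only: of_nat_eq_0_iff_char_dvd)
  moreover have "CHAR('k) \<noteq> 1"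
    by simp
  ultimately show False
    using assms dvd_imp_le[of "CHAR('k)" 2] dvd_pos_nat[of 2 "CHAR('k)"] by linarith
qed

text \<open>The first half of the R-matrix is the sign for the parities in v. In the second half all
  four terms vanish unless both exponents of v are odd; then x and gx act alike, and 1 + 1 + 1 - 1 =
  2 turns \<lambda>/2 into \<lambda>.\<close>

lemma act2_A_act_Rmat:
  assumes "CHAR('k::field) \<noteq> 2"
  shows "act2 A_act A_act (Rmat (l::'k)) ((i, j), (k, n)) =
    Poly_Mapping.single ((i, j), (k, n)) ((-1) ^ (j * n)) +
    (if odd j \<and> odd n then Poly_Mapping.single ((Suc i, j - 1), (Suc k, n - 1)) l else 0)"
proof -
  have [simp]: "(2::'k) \<noteq> 0" using two_neq_0[OF assms] .
  have double: "2 * Poly_Mapping.single q c = Poly_Mapping.single q (2 * c)"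
    for q :: "mono \<times> mono" and c :: 'k
    by (simp only: mult_2 single_add)
  show ?thesis
    by (simp add: act2_def Rmat_def A_act_simps tens_bas minus_one_power_iff tens_simps double
        single_uminus flip: single_add single_diff)
qed

text \<open>
  For \<open>\<alpha> = 0\<close> this is the multiplication of \<open>A \<otimes>\<^sup>c A\<^sup>o\<^sup>p\<close>.  The second summand comes from
  \<open>v' * v' = \<lambda> u\<^sup>2 - v\<^sup>2\<close> in the braided opposite, the third from \<open>v' v = - v v' + \<lambda> u u' + \<alpha>\<close>.
  The subtractions do not truncate, since the guards make the subtracted exponents odd.
\<close>

definition deformed_mul :: "'k::field \<Rightarrow> 'k \<Rightarrow> mono \<times> mono \<Rightarrow> mono \<times> mono \<Rightarrow> (mono \<times> mono \<Rightarrow>\<^sub>0 'k)" where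
  "deformed_mul l \<alpha> = (\<lambda>((i, j), (k, n)) ((i', j'), (k', n')).
     Poly_Mapping.single ((i + i', j + j'), (k + k', n + n')) ((-1) ^ (n * (j' + n')))
     + (if odd n \<and> odd n'
        then Poly_Mapping.single ((i + i', j + j'), (Suc (Suc (k + k')), n + n' - 2)) (l * (-1) ^ j') else 0)
     + (if odd n \<and> odd j'
        then Poly_Mapping.single ((Suc (i + i'), j + j' - 1), (Suc (k + k'), n + n' - 1)) l
           + Poly_Mapping.single ((i + i', j + j' - 1), (k + k', n + n' - 1)) \<alpha> else 0))"

text \<open>Substituting one of the two forms lets the simplifier decide all parity guards and
  evaluate the guarded subtractions.\<close>

lemma even_or_odd: "\<exists>m. n = 2 * m \<or> n = Suc (2 * m)" for n :: nat
  by presburger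

lemma braided_op_A:
  assumes "CHAR('k::field) \<noteq> 2"
  shows "braided_op (l::'k) A_mul A_act (k, n) (k', n') =
    Poly_Mapping.single (k + k', n + n') ((-1) ^ (n * n')) +
    (if odd n \<and> odd n' then Poly_Mapping.single (Suc (Suc (k + k')), n + n' - 2) l else 0)"
proof -
  obtain N N' where "n = 2 * N \<or> n = Suc (2 * N)" "n' = 2 * N' \<or> n' = Suc (2 * N')"
    using even_or_odd by metis
  then show ?thesis
    by (elim disjE)
      (simp_all add: braided_op_def braiding_def act2_A_act_Rmat[OF assms] minus_one_power_iff add_ac)
qed

lemma Ae_mul_eq:
  assumes "CHAR('k::field) \<noteq> 2"
  shows "Ae_mul (l::'k) = deformed_mul l 0"
proof (intro ext)
  fix a b :: "mono \<times> mono"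
  obtain i j k n i' j' k' n' where [simp]: "a = ((i, j), (k, n))" "b = ((i', j'), (k', n'))"
    by (metis surj_pair)
  obtain N N' J' where "n = 2 * N \<or> n = Suc (2 * N)" "n' = 2 * N' \<or> n' = Suc (2 * N')"
      "j' = 2 * J' \<or> j' = Suc (2 * J')"
    using even_or_odd by metis
  then show "Ae_mul l a b = deformed_mul l 0 a b"
    by (elim disjE)
      (simp_all add: Ae_mul_def braided_mul_def braiding_def braided_op_A[OF assms]
        act2_A_act_Rmat[OF assms] deformed_mul_def tens_simps tens_bas
        minus_one_power_iff single_uminus scl_simps add_ac)
qed

text \<open>Correction terms depend only on the parities of n, j' and n'. There are none for even n:
  the basis element with n = 2 and all other exponents 0 is central, also for nonzero
  \<alpha>.\<close>

lemma deformed_mul_simps: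
  "even n \<Longrightarrow> deformed_mul l \<alpha> ((i, j), (k, n)) ((i', j'), (k', n')) =
     bas ((i + i', j + j'), (k + k', n + n'))"
  "odd n \<Longrightarrow> even j' \<Longrightarrow> even n' \<Longrightarrow> deformed_mul l \<alpha> ((i, j), (k, n)) ((i', j'), (k', n')) =
     bas ((i + i', j + j'), (k + k', n + n'))"
  "odd n \<Longrightarrow> even j' \<Longrightarrow> odd n' \<Longrightarrow> deformed_mul l \<alpha> ((i, j), (k, n)) ((i', j'), (k', n')) =
     - bas ((i + i', j + j'), (k + k', n + n'))
     + Poly_Mapping.single ((i + i', j + j'), (Suc (Suc (k + k')), n + n' - 2)) l"
  "odd n \<Longrightarrow> odd j' \<Longrightarrow> even n' \<Longrightarrow> deformed_mul l \<alpha> ((i, j), (k, n)) ((i', j'), (k', n')) =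
     - bas ((i + i', j + j'), (k + k', n + n'))
     + Poly_Mapping.single ((Suc (i + i'), j + j' - 1), (Suc (k + k'), n + n' - 1)) l
     + Poly_Mapping.single ((i + i', j + j' - 1), (k + k', n + n' - 1)) \<alpha>"
  "odd n \<Longrightarrow> odd j' \<Longrightarrow> odd n' \<Longrightarrow> deformed_mul l \<alpha> ((i, j), (k, n)) ((i', j'), (k', n')) =
     bas ((i + i', j + j'), (k + k', n + n'))
     - Poly_Mapping.single ((i + i', j + j'), (Suc (Suc (k + k')), n + n' - 2)) l
     + Poly_Mapping.single ((Suc (i + i'), j + j' - 1), (Suc (k + k'), n + n' - 1)) l
     + Poly_Mapping.single ((i + i', j + j' - 1), (k + k', n + n' - 1)) \<alpha>"
  by (simp_all add: deformed_mul_def minus_one_power_iff single_uminus)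

text \<open>The leftmost power of v is never crossed, so the parity of j is irrelevant and five
  parities remain. In each of the 32 cases both sides are explicit combinations of
  monomials.\<close>

lemma sc_algebra_deformed: "sc_algebra (deformed_mul l \<alpha>) 0"
proof
  fix a b c :: "mono \<times> mono"
  obtain i j k n i' j' k' n' i'' j'' k'' n''
    where [simp]: "a = ((i, j), (k, n))" "b = ((i', j'), (k', n'))" "c = ((i'', j''), (k'', n''))"
    by (metis surj_pair)
  show "bilin_ext (deformed_mul l \<alpha>) (deformed_mul l \<alpha> a b) (bas c) =
      bilin_ext (deformed_mul l \<alpha>) (bas a) (deformed_mul l \<alpha> b c)"
    using even_or_odd[of n] even_or_odd[of n'] even_or_odd[of n''] even_or_odd[of j'] even_or_odd[of j'']
    by (elim exE disjE)
      (simp_all add: deformed_mul_simps bilin_ext_simps scl_simps single_uminus add_ac mult_ac)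
qed (auto simp: deformed_mul_def zero_prod_def)

lemma Ae_act_simps:
  "Ae_act T1 ((i, j), (k, n)) = bas ((i, j), (k, n))"
  "Ae_act Tg ((i, j), (k, n)) = Poly_Mapping.single ((i, j), (k, n)) ((-1) ^ (j + n))"
  "Ae_act Tx ((i, j), (k, n)) = (if odd j then bas ((Suc i, j - 1), (k, n)) else 0) +
     (if odd n then Poly_Mapping.single ((i, j), (Suc k, n - 1)) ((-1) ^ j) else 0)"
  "Ae_act Tgx ((i, j), (k, n)) = (if odd j then Poly_Mapping.single ((Suc i, j - 1), (k, n)) ((-1) ^ n) else 0) +
     (if odd n then bas ((i, j), (Suc k, n - 1)) else 0)"
  by (simp_all add: Ae_act_def tens_act_def act2_def A_act_simps tens_bas tens_simps power_add)

lemma t2_module_algebra_deformed: "t2_module_algebra (deformed_mul l \<alpha>) 0 Ae_act"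
proof -
  interpret sc_algebra "deformed_mul l \<alpha>" 0
    by (rule sc_algebra_deformed)
  note Ae_act_simps[simp] minus_one_power_iff[simp]
  show ?thesis
  proof
    fix a b :: "mono \<times> mono"
    obtain i j k n i' j' k' n' where [simp]: "a = ((i, j), (k, n))" "b = ((i', j'), (k', n'))"
      by (metis surj_pair)
    show "Ae_act T1 a = bas a" by simp
    show "Ae_act Tgx a = lin_ext (Ae_act Tg) (Ae_act Tx a)"
      using even_or_odd[of j] even_or_odd[of n] by (elim exE disjE) (simp_all add: single_uminus)
    show "lin_ext (Ae_act Tg) (Ae_act Tg a) = bas a"
      by (simp add: single_uminus)
    show "lin_ext (Ae_act Tx) (Ae_act Tx a) = 0"
      using even_or_odd[of j] even_or_odd[of n] by (elim exE disjE) (simp_all add: single_uminus)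
    show "lin_ext (Ae_act Tx) (Ae_act Tg a) = - lin_ext (Ae_act Tg) (Ae_act Tx a)"
      using even_or_odd[of j] even_or_odd[of n] by (elim exE disjE) (simp_all add: single_uminus)
    show "lin_ext (Ae_act Tg) (deformed_mul l \<alpha> a b) =
        bilin_ext (deformed_mul l \<alpha>) (Ae_act Tg a) (Ae_act Tg b)"
      using even_or_odd[of j] even_or_odd[of n] even_or_odd[of j'] even_or_odd[of n']
      by (elim exE disjE) (simp_all add: deformed_mul_simps bilin_ext_simps single_uminus scl_simps)
    show "lin_ext (Ae_act Tx) (deformed_mul l \<alpha> a b) =
        bilin_ext (deformed_mul l \<alpha>) (Ae_act Tx a) (bas b) +
        bilin_ext (deformed_mul l \<alpha>) (Ae_act Tg a) (Ae_act Tx b)"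
      using even_or_odd[of j] even_or_odd[of n] even_or_odd[of j'] even_or_odd[of n']
      by (elim exE disjE) (simp_all add: deformed_mul_simps bilin_ext_simps single_uminus scl_simps add_ac)
    show "Ae_act Tg 0 = bas 0" "Ae_act Tx 0 = 0"
      by (simp_all add: zero_prod_def)
  qed
qed

section \<open>The free algebra as a module algebra\<close>

abbreviation free_prod :: "(gen list \<Rightarrow>\<^sub>0 'k::field) \<Rightarrow> (gen list \<Rightarrow>\<^sub>0 'k) \<Rightarrow> (gen list \<Rightarrow>\<^sub>0 'k)" (infixr "\<odot>" 70)
  where "p \<odot> q \<equiv> bilin_ext free_mul p q"

lemma free_prod_single [simp]:
  "Poly_Mapping.single xs c \<odot> Poly_Mapping.single ys d = Poly_Mapping.single (xs @ ys) (c * d)"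
  by (simp add: bilin_ext_bas free_mul_def)

text \<open>Otherwise products of words would be rewritten to \<open>free_mul\<close> before \<open>free_prod_single\<close> applies.\<close>

declare bilin_ext_bas [simp del]

global_interpretation free: sc_algebra free_mul "[]"
  by unfold_locales (simp_all only: free_mul_def free_prod_single append_assoc append_Nil append_Nil2 mult_1)

lemma gen_act_1: "gen_act T1 y = bas [y]"
  by (cases y) simp_all

lemma gen_act_g: "gen_act Tg y = (if y = Inl V \<or> y = Inr V then - bas [y] else bas [y])"
  by (cases y rule: sum.exhaust; cases "projl y"; cases "projr y") auto

lemma gen_act_x: "gen_act Tx y = (if y = Inl V then bas [Inl U] else if y = Inr V then bas [Inr U] else 0)"
  by (cases y rule: sum.exhaust; cases "projl y"; cases "projr y") auto

lemma gen_act_gx: "gen_act Tgx y = gen_act Tx y"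
  by (cases y rule: sum.exhaust; cases "projl y"; cases "projr y") auto

lemma free_act_Nil:
  "free_act T1 [] = bas []" "free_act Tg [] = bas []" "free_act Tx [] = 0" "free_act Tgx [] = 0"
  by (simp_all add: free_act_def)

lemma free_act_Cons:
  "free_act T1 (y # ys) = bas [y] \<odot> free_act T1 ys"
  "free_act Tg (y # ys) = gen_act Tg y \<odot> free_act Tg ys"
  "free_act Tx (y # ys) = gen_act Tx y \<odot> free_act T1 ys + gen_act Tg y \<odot> free_act Tx ys"
  "free_act Tgx (y # ys) = gen_act Tx y \<odot> free_act Tg ys + bas [y] \<odot> free_act Tgx ys"
  by (simp_all add: free_act_def gen_act_1 gen_act_gx)

lemma free_act_1: "free_act T1 w = bas w"
  by (induction w) (simp_all add: free_act_Nil free_act_Cons)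

lemma free_act_g_append: "free_act Tg (xs @ ys) = free_act Tg xs \<odot> free_act Tg ys"
  by (induction xs) (simp_all add: free_act_Nil free_act_Cons free.mult_assoc)

lemma free_act_x_append:
  "free_act Tx (xs @ ys) = free_act Tx xs \<odot> bas ys + free_act Tg xs \<odot> free_act Tx ys"
  by (induction xs)
    (simp_all add: free_act_Nil free_act_Cons free.mult_assoc free_act_1 bilin_ext_simps)

lemma free_act_g_mult:
  "lin_ext (free_act Tg) (p \<odot> q) = lin_ext (free_act Tg) p \<odot> lin_ext (free_act Tg) q"
proof -
  have 1: "lin_ext (free_act Tg) (bas a \<odot> q) = lin_ext (free_act Tg) (bas a) \<odot> lin_ext (free_act Tg) q" for a
    by (rule klin_eqI[where p = q]) (simp_all add: klin_intros free_act_g_append)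
  show ?thesis
    by (rule klin_eqI[where p = p]) (simp_all only: klin_intros 1)
qed

lemma free_act_x_mult:
  "lin_ext (free_act Tx) (p \<odot> q) =
    lin_ext (free_act Tx) p \<odot> q + lin_ext (free_act Tg) p \<odot> lin_ext (free_act Tx) q"
proof -
  have 1: "lin_ext (free_act Tx) (bas a \<odot> q) =
    lin_ext (free_act Tx) (bas a) \<odot> q + lin_ext (free_act Tg) (bas a) \<odot> lin_ext (free_act Tx) q" for a
    by (rule klin_eqI[where p = q]) (simp_all add: klin_intros free_act_x_append)
  show ?thesis
    by (rule klin_eqI[where p = p]) (simp_all only: klin_intros 1)
qed

lemma free_act_gen:
  "lin_ext (free_act Tg) (gen_act Tg y) = bas [y]"
  "lin_ext (free_act Tx) (gen_act Tx y) = 0"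
  "lin_ext (free_act Tx) (gen_act Tg y) = - gen_act Tx y"
  "lin_ext (free_act Tg) (gen_act Tx y) = gen_act Tx y"
  by (simp_all add: gen_act_g gen_act_x free_act_Cons free_act_Nil free_act_1 bilin_ext_simps)

global_interpretation free: t2_module_algebra free_mul "[]" free_act
proof
  fix a b :: "gen list"
  show "free_act T1 a = bas a"
    by (rule free_act_1)
  show "free_act Tgx a = lin_ext (free_act Tg) (free_act Tx a)"
  proof (induction a)
    case (Cons y ys)
    then show ?case
      using free_act_gen(1)
      by (simp add: free_act_Cons free_act_g_mult free_act_gen free_act_1)
  qed (simp add: free_act_Nil)
  show gg: "lin_ext (free_act Tg) (free_act Tg a) = bas a" for a
    by (induction a) (simp_all add: free_act_Nil free_act_Cons free_act_g_mult free_act_gen)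
  show xg: "lin_ext (free_act Tx) (free_act Tg a) = - lin_ext (free_act Tg) (free_act Tx a)" for a
    by (induction a) (simp_all add: free_act_Nil free_act_Cons free_act_g_mult free_act_x_mult
        free_act_gen free_act_1 gg bilin_ext_simps)
  show "lin_ext (free_act Tx) (free_act Tx a) = 0"
    by (induction a) (simp_all add: free_act_Nil free_act_Cons free_act_x_mult
        free_act_gen free_act_1 bilin_ext_simps)
  show "lin_ext (free_act Tg) (free_mul a b) = free_act Tg a \<odot> free_act Tg b"
    by (simp only: free_mul_def lin_ext_single scl.vs1.scale_one free_act_g_append)
  show "lin_ext (free_act Tx) (free_mul a b) = free_act Tx a \<odot> bas b + free_act Tg a \<odot> free_act Tx b"
    by (simp only: free_mul_def lin_ext_single scl.vs1.scale_one free_act_x_append)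
  show "free_act Tg [] = bas []" "free_act Tx [] = 0"
    by (simp_all add: free_act_Nil)
qed

context sc_algebra
begin

lemma word_eval_mult:
  "lin_ext (word_eval m e f) (p \<odot> q) = lin_ext (word_eval m e f) p \<star> lin_ext (word_eval m e f) q"
proof -
  have 1: "lin_ext (word_eval m e f) (bas a \<odot> q) =
    lin_ext (word_eval m e f) (bas a) \<star> lin_ext (word_eval m e f) q" for a
    by (rule klin_eqI[where p = q]) (simp_all add: klin_intros word_eval_append)
  show ?thesis
    by (rule klin_eqI[where p = p]) (simp_all only: klin_intros 1)
qed

end

section \<open>Ideals\<close>

locale sc_ideal = sc_algebra m e
  for m :: "'b \<Rightarrow> 'b \<Rightarrow> ('b \<Rightarrow>\<^sub>0 'k::field)" and e :: 'b +
  fixes J :: "('b \<Rightarrow>\<^sub>0 'k) set"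
  assumes ideal_J: "ideal J (alg_of m e)"
begin

lemma J_0 [simp]: "0 \<in> J"
  using additive_subgroup.zero_closed[OF ideal.axioms(1)[OF ideal_J]] by (simp add: alg_of_def)

lemma J_add: "p \<in> J \<Longrightarrow> q \<in> J \<Longrightarrow> p + q \<in> J"
  using additive_subgroup.a_closed[OF ideal.axioms(1)[OF ideal_J]] by (simp add: alg_of_def)

lemma J_left: "p \<in> J \<Longrightarrow> q \<star> p \<in> J"
  using ideal.I_l_closed[OF ideal_J] by (simp add: alg_of_def)

lemma J_right: "p \<in> J \<Longrightarrow> p \<star> q \<in> J"
  using ideal.I_r_closed[OF ideal_J] by (simp add: alg_of_def)

text \<open>Ideals of a ring carry no condition on scalars; closure under them comes from
  multiplying by c times the unit.\<close>

lemma J_scl: "p \<in> J \<Longrightarrow> scl c p \<in> J"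
  using J_left[of p "scl c (bas e)"] by (simp only: bilin_ext_simps unit_left)

lemma J_neg: "p \<in> J \<Longrightarrow> - p \<in> J"
  using J_scl[of p "-1"] by simp

lemma J_diff: "p \<in> J \<Longrightarrow> q \<in> J \<Longrightarrow> p - q \<in> J"
  using J_add[of p "- q"] J_neg[of q] by simp

lemma J_sum: "(\<And>a. a \<in> A \<Longrightarrow> f a \<in> J) \<Longrightarrow> sum f A \<in> J"
  by (induction A rule: infinite_finite_induct) (auto intro: J_add)

lemma klin_in_J:
  assumes "klin f" "\<And>b. f (bas b) \<in> J"
  shows "f p \<in> J"
proof -
  have "f p = lin_ext (\<lambda>b. f (bas b)) p"
    by (rule klin_eqI[where p = p]) (simp_all add: assms klin_intros)
  then show ?thesis
    by (auto simp: lin_ext_def intro!: J_sum J_scl assms)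
qed

definition cong_J (infix "\<approx>" 50) where "p \<approx> q \<longleftrightarrow> p - q \<in> J"

lemma cong_refl [simp, intro]: "p \<approx> p"
  by (simp add: cong_J_def)

lemma cong_trans [trans]: "p \<approx> q \<Longrightarrow> q \<approx> r \<Longrightarrow> p \<approx> r"
  using J_add[of "p - q" "q - r"] by (simp add: cong_J_def)

lemma cong_sym: "p \<approx> q \<Longrightarrow> q \<approx> p"
  using J_neg[of "p - q"] by (simp add: cong_J_def)

lemma cong_add: "p \<approx> p' \<Longrightarrow> q \<approx> q' \<Longrightarrow> p + q \<approx> p' + q'"
  using J_add[of "p - p'" "q - q'"] by (simp add: cong_J_def algebra_simps)

lemma cong_if: "(P \<Longrightarrow> p \<approx> p') \<Longrightarrow> (if P then p else 0) \<approx> (if P then p' else 0)"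
  by simp

lemma cong_scl: "p \<approx> p' \<Longrightarrow> scl c p \<approx> scl c p'"
  using J_scl[of "p - p'" c] by (simp add: cong_J_def scl_simps)

lemma cong_neg: "p \<approx> p' \<Longrightarrow> - p \<approx> - p'"
  using J_neg[of "p - p'"] by (simp add: cong_J_def)

lemma cong_left: "p \<approx> p' \<Longrightarrow> q \<star> p \<approx> q \<star> p'"
  using J_left[of "p - p'" q] by (simp add: cong_J_def bilin_ext_simps)

lemma cong_right: "p \<approx> p' \<Longrightarrow> p \<star> q \<approx> p' \<star> q"
  using J_right[of "p - p'" q] by (simp add: cong_J_def bilin_ext_simps)

end

section \<open>Normal forms\<close>

abbreviation "gu \<equiv> Inl U :: gen"
abbreviation "gv \<equiv> Inl V :: gen"
abbreviation "gu' \<equiv> Inr U :: gen"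
abbreviation "gv' \<equiv> Inr V :: gen"

abbreviation pw :: "gen \<Rightarrow> nat \<Rightarrow> (gen list \<Rightarrow>\<^sub>0 'k::field)" where "pw y n \<equiv> bas (replicate n y)"

text \<open>
  The pair \<open>(k, n)\<close> in the second factor is a monomial for the commutative product of \<open>k[u,v]\<close>, not
  for the braided opposite one, in which \<open>v\<^sup>2\<close> is \<open>\<lambda> u'\<^sup>2 - v'\<^sup>2\<close>.
\<close>

definition sq_elem :: "'k::field \<Rightarrow> (gen list \<Rightarrow>\<^sub>0 'k)" where
  "sq_elem l = scl l (bas [gu', gu']) - bas [gv', gv']"

primrec sq_pow :: "'k::field \<Rightarrow> nat \<Rightarrow> (gen list \<Rightarrow>\<^sub>0 'k)" where
  "sq_pow l 0 = bas []"
| "sq_pow l (Suc n) = sq_elem l \<odot> sq_pow l n"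

text \<open>The last exponent is split into powers of \<open>sq_elem\<close> and at most one v',
  because \<open>sq_elem\<close>, and not v'v', evaluates to the monomial with n = 2. With this
  choice normal words evaluate to single monomials and not merely to combinations with a leading
  monomial.\<close>

definition normal_form :: "'k::field \<Rightarrow> mono \<times> mono \<Rightarrow> (gen list \<Rightarrow>\<^sub>0 'k)" where
  "normal_form l = (\<lambda>((i, j), (k, n)).
     pw gu i \<odot> pw gv j \<odot> pw gu' k \<odot> pw gv' (n mod 2) \<odot> sq_pow l (n div 2))"

definition ev :: "'k::field \<Rightarrow> 'k \<Rightarrow> (gen list \<Rightarrow>\<^sub>0 'k) \<Rightarrow> (mono \<times> mono \<Rightarrow>\<^sub>0 'k)" where
  "ev l \<alpha> = lin_ext (word_eval (deformed_mul l \<alpha>) 0 Ae_gen)"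

lemma klin_ev: "klin (ev l \<alpha>)"
  unfolding ev_def by (rule klin_lin_ext)

lemma eval_mult: "ev l \<alpha> (p \<odot> q) = bilin_ext (deformed_mul l \<alpha>) (ev l \<alpha> p) (ev l \<alpha> q)"
  unfolding ev_def by (rule sc_algebra.word_eval_mult[OF sc_algebra_deformed])

lemma eval_pw:
  "ev l \<alpha> (pw gu n) = bas ((n, 0), (0, 0))"
  "ev l \<alpha> (pw gv n) = bas ((0, n), (0, 0))"
  "ev l \<alpha> (pw gu' n) = bas ((0, 0), (n, 0))"
  by (induction n) (simp_all add: ev_def zero_prod_def deformed_mul_simps bilin_ext_bas)

lemma eval_sq_pow: "ev l \<alpha> (sq_pow l n) = bas ((0, 0), (0, 2 * n))"
proof (induction n)
  case 0
  then show ?case by (simp add: ev_def zero_prod_def)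
next
  case (Suc n)
  \<comment> \<open>The correction \<lambda> u'u' in the product of v' with itself cancels the first
    term of \<open>sq_elem\<close>.\<close>
  have "ev l \<alpha> (sq_elem l) = bas ((0, 0), (0, 2))"
    by (simp add: ev_def zero_prod_def deformed_mul_simps bilin_ext_bas sq_elem_def single_uminus numeral_2_eq_2)
  then show ?case
    by (simp add: Suc eval_mult deformed_mul_simps bilin_ext_bas)
qed

text \<open>In this order of the factors no correction is triggered: the powers of u, v and u'
  contain no v', and the single v' meets only an even exponent.\<close>

lemma eval_normal: "ev l \<alpha> (normal_form l q) = bas q"
proof -
  obtain i j k n where q: "q = ((i, j), (k, n))"
    by (metis surj_pair)
  have v': "ev l \<alpha> (bas [gv']) = bas ((0, 0), (0, 1))"
    by (simp add: ev_def zero_prod_def deformed_mul_simps bilin_ext_bas)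
  have "ev l \<alpha> (pw gv' (n mod 2) \<odot> sq_pow l (n div 2)) = bas ((0, 0), (0, n))"
  proof (cases "even n")
    case True
    then show ?thesis
      by (simp add: eval_sq_pow)
  next
    case False
    then show ?thesis
      by (simp add: odd_iff_mod_2_eq_one[THEN iffD1] eval_mult v' eval_sq_pow deformed_mul_simps bilin_ext_bas)
  qed
  then show ?thesis
    by (simp add: normal_form_def q eval_mult[of l \<alpha> "bas _"] eval_pw deformed_mul_simps bilin_ext_bas)
qed

lemma rel_simps:
  "rel l (Suc 0) = bas [gu, gv] - bas [gv, gu]"
  "rel l 2 = bas [gu', gv'] - bas [gv', gu']"
  "rel l 3 = bas [gu, gv'] - bas [gv', gu]"
  "rel l 4 = bas [gv, gv'] + bas [gv', gv] - scl l (bas [gu, gu'])"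
  "rel l 5 = bas [gu, gu'] - bas [gu', gu]"
  "rel l 6 = bas [gv, gu'] - bas [gu', gv]"
  by (simp_all add: rel_def Let_def)

text \<open>The ideal is only asked to contain the relations. Hence the rewriting applies both to
  the ideal generated by them in the free algebra (with \<alpha> = 0) and to the trace of
  \<open>def_ideal\<close> on the free algebra.\<close>

locale deformed_rels = sc_ideal free_mul "[]" J
  for J :: "(gen list \<Rightarrow>\<^sub>0 'k::field) set" +
  fixes l \<alpha> :: 'k
  assumes rel_mem: "i \<in> {1..6} \<Longrightarrow> i \<noteq> 4 \<Longrightarrow> rel l i \<in> J"
    and rel4_mem: "rel l 4 - scl \<alpha> (bas []) \<in> J"
begin

lemma gen_cong:
  "bas [gv, gu] \<approx> bas [gu, gv]" "bas [gv', gu'] \<approx> bas [gu', gv']" "bas [gv', gu] \<approx> bas [gu, gv']"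
  "bas [gu', gu] \<approx> bas [gu, gu']" "bas [gu', gv] \<approx> bas [gv, gu']"
  unfolding cong_J_def
  using J_neg[OF rel_mem[of 1]] J_neg[OF rel_mem[of 2]] J_neg[OF rel_mem[of 3]]
    J_neg[OF rel_mem[of 5]] J_neg[OF rel_mem[of 6]]
  by (auto simp: rel_simps)

lemma gen_cong_4:
  "bas [gv', gv] \<approx> - bas [gv, gv'] + scl l (bas [gu, gu']) + scl \<alpha> (bas [])"
  using rel4_mem by (simp add: rel_simps cong_J_def algebra_simps)

lemma pw_Suc: "pw y (Suc n) = bas [y] \<odot> pw y n"
  by simp

lemma pw_comm:
  assumes "bas [y, z] \<approx> bas [z, y]"
  shows "bas [y] \<odot> pw z n \<approx> pw z n \<odot> bas [y]"
proof (induction n)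
  case (Suc n)
  have "bas [y] \<odot> pw z (Suc n) = bas [y, z] \<odot> pw z n"
    by simp
  also have "\<dots> \<approx> bas [z, y] \<odot> pw z n"
    using assms by (rule cong_right)
  also have "bas [z, y] \<odot> pw z n = bas [z] \<odot> (bas [y] \<odot> pw z n)"
    by simp
  also have "\<dots> \<approx> bas [z] \<odot> (pw z n \<odot> bas [y])"
    using Suc by (rule cong_left)
  finally show ?case
    by simp
qed simp

text \<open>The trailing factor p allows a swap at the front of a product nested to the right;
  \<open>cong_left\<close> then carries it under further factors.\<close>

lemma pass:
  assumes "bas [y, z] \<approx> bas [z, y]"
  shows "bas [y] \<odot> pw z n \<odot> p \<approx> pw z n \<odot> bas [y] \<odot> p"
  using cong_right[OF pw_comm[OF assms, of n], of p] by (simp only: free.mult_assoc)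

lemma pass':
  assumes "bas [y, z] \<approx> bas [z, y]"
  shows "pw z n \<odot> bas [y] \<odot> p \<approx> bas [y] \<odot> pw z n \<odot> p"
  by (rule cong_sym[OF pass[OF assms]])

abbreviation curv :: "gen list \<Rightarrow>\<^sub>0 'k" where
  "curv \<equiv> scl l (bas [gu, gu']) + scl \<alpha> (bas [])"

text \<open>Every v that is crossed flips the sign and leaves one copy of \<open>curv\<close>. Since
  \<open>curv\<close> commutes with v modulo the ideal, these copies can be collected on the right,
  where they cancel in pairs; one survives exactly for odd n.\<close>

lemma v'_pw_v:
  "bas [gv'] \<odot> pw gv n \<approx> scl ((-1) ^ n) (pw gv n \<odot> bas [gv']) +
     (if odd n then pw gv (n - 1) \<odot> curv else 0)"
proof (induction n)
  case 0
  then show ?case by simp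
next
  case (Suc n)
  have "bas [gu] \<odot> bas [gu'] \<odot> pw gv n \<approx> bas [gu] \<odot> pw gv n \<odot> bas [gu']"
    by (rule cong_left[OF pw_comm[OF gen_cong(5)]])
  also have "\<dots> \<approx> pw gv n \<odot> bas [gu] \<odot> bas [gu']"
    by (rule pass[OF cong_sym[OF gen_cong(1)]])
  finally have uu': "bas [gu, gu'] \<odot> pw gv n \<approx> pw gv n \<odot> bas [gu, gu']"
    by simp
  have curv: "curv \<odot> pw gv n \<approx> pw gv n \<odot> curv"
    using cong_add[OF cong_scl[OF uu', of l] cong_refl[of "scl \<alpha> (pw gv n)"]]
    by (simp add: bilin_ext_simps)
  have "bas [gv'] \<odot> pw gv (Suc n) = bas [gv', gv] \<odot> pw gv n"
    by simp
  also have "\<dots> \<approx> (- bas [gv, gv'] + curv) \<odot> pw gv n"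
    using gen_cong_4 by (intro cong_right) (simp add: algebra_simps)
  also have "\<dots> = - (bas [gv] \<odot> bas [gv'] \<odot> pw gv n) + curv \<odot> pw gv n"
    by (simp add: bilin_ext_simps)
  also have "\<dots> \<approx> - (bas [gv] \<odot> (scl ((-1) ^ n) (pw gv n \<odot> bas [gv']) +
     (if odd n then pw gv (n - 1) \<odot> curv else 0))) + pw gv n \<odot> curv"
    by (intro cong_add cong_neg cong_left Suc curv)
  also have "\<dots> = scl ((-1) ^ Suc n) (pw gv (Suc n) \<odot> bas [gv']) +
     (if odd (Suc n) then pw gv (Suc n - 1) \<odot> curv else 0)"
    by (auto simp: bilin_ext_simps single_uminus elim!: oddE)
  finally show ?case .
qed

definition tail :: "nat \<Rightarrow> nat \<Rightarrow> (gen list \<Rightarrow>\<^sub>0 'k)" where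
  "tail k n = pw gu' k \<odot> pw gv' (n mod 2) \<odot> sq_pow l (n div 2)"

lemma normal_tail: "normal_form l ((i, j), (k, n)) = pw gu i \<odot> pw gv j \<odot> tail k n"
  by (simp add: normal_form_def tail_def)

lemma tail_u': "bas [gu'] \<odot> tail k n = tail (Suc k) n"
  by (simp add: tail_def pw_Suc free.mult_assoc del: replicate_Suc free_prod_single)

text \<open>For even n the new v' fills the free place. For odd n it meets the v' already there, and
  v'v' = \<lambda> u'u' - \<open>sq_elem\<close>.\<close>

lemma tail_v':
  "bas [gv'] \<odot> tail k n \<approx>
    (if even n then tail k (Suc n) else scl l (tail (Suc (Suc k)) (n - 1)) - tail k (Suc n))"
proof -
  have "bas [gv'] \<odot> pw gu' k \<odot> pw gv' (n mod 2) \<odot> sq_pow l (n div 2) \<approx>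
      pw gu' k \<odot> bas [gv'] \<odot> pw gv' (n mod 2) \<odot> sq_pow l (n div 2)"
    by (rule pass[OF gen_cong(2)])
  also have "\<dots> = (if even n then tail k (Suc n) else scl l (tail (Suc (Suc k)) (n - 1)) - tail k (Suc n))"
  proof (cases "even n")
    case True
    then show ?thesis
      by (elim evenE) (simp add: tail_def)
  next
    case False
    then obtain m where n: "n = 2 * m + 1"
      by (elim oddE)
    have "bas [gv'] \<odot> bas [gv'] \<odot> p = scl l (pw gu' 2 \<odot> p) - sq_elem l \<odot> p" for p
      by (simp add: sq_elem_def bilin_ext_simps numeral_2_eq_2 del: scl_single flip: free.mult_assoc)
    moreover have "pw gu' k \<odot> pw gu' 2 \<odot> p = pw gu' (Suc (Suc k)) \<odot> p"
      for p :: "gen list \<Rightarrow>\<^sub>0 'k"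
      by (simp add: numeral_2_eq_2 replicate_app_Cons_same flip: free.mult_assoc)
    ultimately show ?thesis
      by (simp add: n tail_def bilin_ext_simps)
  qed
  finally show ?thesis
    by (simp add: tail_def)
qed

lemma normal_u: "bas [gu] \<odot> normal_form l ((i, j), (k, n)) = normal_form l ((Suc i, j), (k, n))"
  by (simp add: normal_form_def free.mult_assoc[symmetric])

lemma normal_v: "bas [gv] \<odot> normal_form l ((i, j), (k, n)) \<approx> normal_form l ((i, Suc j), (k, n))"
  using pass[OF gen_cong(1), of i]
  by (simp add: normal_tail pw_Suc free.mult_assoc del: replicate_Suc free_prod_single)

lemma normal_u': "bas [gu'] \<odot> normal_form l ((i, j), (k, n)) \<approx> normal_form l ((i, j), (Suc k, n))"
proof -
  have "bas [gu'] \<odot> pw gu i \<odot> pw gv j \<odot> tail k n \<approx> pw gu i \<odot> bas [gu'] \<odot> pw gv j \<odot> tail k n"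
    by (rule pass[OF gen_cong(4)])
  also have "\<dots> \<approx> pw gu i \<odot> pw gv j \<odot> bas [gu'] \<odot> tail k n"
    by (rule cong_left[OF pass[OF gen_cong(5)]])
  finally show ?thesis
    by (simp add: normal_tail tail_u')
qed

text \<open>Only left multiplication by v' creates corrections. Crossing v^j gives the terms of
  \<open>deformed_mul\<close> with guard on n and j', and meeting the tail gives those with guard on
  n and n'.\<close>

lemma normal_v':
  "bas [gv'] \<odot> normal_form l ((i, j), (k, n)) \<approx>
    lin_ext (normal_form l) (deformed_mul l \<alpha> ((0, 0), (0, 1)) ((i, j), (k, n)))"
proof -
  let ?N = "\<lambda>p. pw gu i \<odot> p"
  have "bas [gv'] \<odot> pw gu i \<odot> pw gv j \<odot> tail k n \<approx> ?N (bas [gv'] \<odot> pw gv j \<odot> tail k n)"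
    by (rule pass[OF gen_cong(3)])
  also have "\<dots> = ?N ((bas [gv'] \<odot> pw gv j) \<odot> tail k n)"
    by (simp only: free.mult_assoc)
  also have "\<dots> \<approx> ?N ((scl ((-1) ^ j) (pw gv j \<odot> bas [gv']) +
     (if odd j then pw gv (j - 1) \<odot> curv else 0)) \<odot> tail k n)"
    by (intro cong_left cong_right v'_pw_v)
  also have "\<dots> = scl ((-1) ^ j) (?N (pw gv j \<odot> bas [gv'] \<odot> tail k n)) +
     (if odd j then scl l (?N (pw gv (j - 1) \<odot> bas [gu] \<odot> tail (Suc k) n)) +
        scl \<alpha> (?N (pw gv (j - 1) \<odot> tail k n)) else 0)"
  proof -
    have "bas [gu, gu'] \<odot> tail k n = bas [gu] \<odot> bas [gu'] \<odot> tail k n"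
      by (simp flip: free.mult_assoc)
    then have "bas [gu, gu'] \<odot> tail k n = bas [gu] \<odot> tail (Suc k) n"
      by (simp only: tail_u')
    then show ?thesis
      by (simp add: bilin_ext_simps free.mult_assoc del: free_prod_single scl_single)
  qed
  also have "\<dots> \<approx> scl ((-1) ^ j) (?N (pw gv j \<odot>
      (if even n then tail k (Suc n) else scl l (tail (Suc (Suc k)) (n - 1)) - tail k (Suc n)))) +
     (if odd j then scl l (?N (bas [gu] \<odot> pw gv (j - 1) \<odot> tail (Suc k) n)) +
        scl \<alpha> (?N (pw gv (j - 1) \<odot> tail k n)) else 0)"
    by (intro cong_add cong_scl cong_left tail_v' cong_if cong_refl pass'[OF cong_sym[OF gen_cong(1)]])
  also have "\<dots> = lin_ext (normal_form l) (deformed_mul l \<alpha> ((0, 0), (0, 1)) ((i, j), (k, n)))"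
  proof -
    have "?N (bas [gu] \<odot> p) = pw gu (Suc i) \<odot> p" for p :: "gen list \<Rightarrow>\<^sub>0 'k"
      by (simp add: replicate_app_Cons_same flip: free.mult_assoc)
    then show ?thesis
      by (simp add: deformed_mul_def normal_tail minus_one_power_iff bilin_ext_simps scl_simps)
  qed
  finally show ?thesis
    by (simp only: normal_tail)
qed

text \<open>Words are built by prepending letters, so compatibility with left multiplication by
  generators is all that the induction in \<open>cong_normal_eval\<close> needs.\<close>

lemma gen_normal:
  "bas [y] \<odot> lin_ext (normal_form l) p \<approx> lin_ext (normal_form l) (bilin_ext (deformed_mul l \<alpha>) (Ae_gen y) p)"
proof -
  have basis: "bas [y] \<odot> normal_form l q \<approx>
      lin_ext (normal_form l) (bilin_ext (deformed_mul l \<alpha>) (Ae_gen y) (bas q))" for q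
  proof -
    obtain i j k n where q: "q = ((i, j), (k, n))"
      by (metis surj_pair)
    consider "y = gu" | "y = gv" | "y = gu'" | "y = gv'"
      by (metis sum.exhaust var.exhaust)
    then show ?thesis
    proof cases
      case 4
      then show ?thesis
        using normal_v'[of i j k n] by (simp add: q zero_prod_def bilin_ext_bas)
    qed (simp_all add: q zero_prod_def bilin_ext_bas deformed_mul_simps normal_u normal_v normal_u')
  qed
  show ?thesis
    unfolding cong_J_def
    by (rule klin_in_J[of "\<lambda>p. bas [y] \<odot> lin_ext (normal_form l) p
            - lin_ext (normal_form l) (bilin_ext (deformed_mul l \<alpha>) (Ae_gen y) p)",
          OF klin_diff_fun[OF klin_comp[OF klin_bilin_right klin_lin_ext]
            klin_comp[OF klin_lin_ext klin_bilin_right]]])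
      (use basis in \<open>simp add: cong_J_def\<close>)
qed

text \<open>Together with \<open>eval_normal\<close> this makes evaluation and normal words mutually
  inverse between the free algebra modulo the ideal and the model.\<close>

lemma cong_normal_eval: "p \<approx> lin_ext (normal_form l) (ev l \<alpha> p)"
proof -
  have basis: "bas w \<approx> lin_ext (normal_form l) (ev l \<alpha> (bas w))" for w
  proof (induction w)
    case Nil
    then show ?case
      by (simp add: ev_def normal_form_def zero_prod_def)
  next
    case (Cons y w)
    have "bas (y # w) = bas [y] \<odot> bas w"
      by simp
    also have "\<dots> \<approx> bas [y] \<odot> lin_ext (normal_form l) (ev l \<alpha> (bas w))"
      using Cons by (rule cong_left)
    also have "\<dots> \<approx> lin_ext (normal_form l) (bilin_ext (deformed_mul l \<alpha>) (Ae_gen y) (ev l \<alpha> (bas w)))"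
      by (rule gen_normal)
    also have "\<dots> = lin_ext (normal_form l) (ev l \<alpha> (bas (y # w)))"
      by (simp add: ev_def)
    finally show ?case .
  qed
  show ?thesis
    unfolding cong_J_def
    by (rule klin_in_J[of "\<lambda>p. p - lin_ext (normal_form l) (ev l \<alpha> p)",
          OF klin_diff_fun[OF klin_ident klin_comp[OF klin_lin_ext klin_ev]]])
      (use basis in \<open>simp add: cong_J_def\<close>)
qed

lemma eval_0_imp_mem: "ev l \<alpha> p = 0 \<Longrightarrow> p \<in> J"
  using cong_normal_eval[of p] by (simp add: cong_J_def)

end


section \<open>Generated ideals and the presentation of the braided enveloping algebra\<close>

lemma ideal_Idl: "ideal (Idl\<^bsub>alg_of m e\<^esub> S) (alg_of m e)" if "sc_algebra m e"
  using ring.genideal_ideal[OF sc_algebra.ring_alg_of[OF that]] by (simp add: alg_of_def)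

lemma Idl_minimal:
  assumes "sc_algebra m e" "sc_ideal m e J" "S \<subseteq> J"
  shows "Idl\<^bsub>alg_of m e\<^esub> S \<subseteq> J"
  using ring.genideal_minimal[OF sc_algebra.ring_alg_of[OF assms(1)] sc_ideal.ideal_J[OF assms(2)] assms(3)] .

lemma Idl_mem: "sc_algebra m e \<Longrightarrow> p \<in> S \<Longrightarrow> p \<in> Idl\<^bsub>alg_of m e\<^esub> S"
  using ring.genideal_self[OF sc_algebra.ring_alg_of, of m e S] by (auto simp: alg_of_def)

lemma (in sc_algebra) sc_ideal_kernel:
  assumes "klin f" "\<And>p q. f (p \<star> q) = bilin_ext m' (f p) (f q)"
  shows "sc_ideal m e {p. f p = 0}"
proof (intro sc_ideal.intro sc_ideal_axioms.intro sc_algebra_axioms)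
  have *: "f 0 = 0" "f (p + q) = f p + f q" "f (- p) = - f p" for p q
    using assms(1) by (simp_all add: klin_0 klin_add klin_neg)
  show "ideal {p. f p = 0} (alg_of m e)"
  proof (rule idealI[OF ring_alg_of])
    interpret R: ring "alg_of m e"
      by (rule ring_alg_of)
    show "subgroup {p. f p = 0} (add_monoid (alg_of m e))"
    proof (rule R.add.subgroupI)
      fix p assume p: "p \<in> {p. f p = 0}"
      have "\<ominus>\<^bsub>alg_of m e\<^esub> p = - p"
        by (rule R.add.inv_equality) (simp_all add: alg_of_def)
      then show "\<ominus>\<^bsub>alg_of m e\<^esub> p \<in> {p. f p = 0}"
        using p * by simp
    qed (use * in \<open>auto simp: alg_of_def\<close>)
  qed (use assms in \<open>auto simp: alg_of_def bilin_ext_simps\<close>)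
qed

lemma eval_rel:
  "ev l \<alpha> (rel l (Suc 0)) = 0" "ev l \<alpha> (rel l 2) = 0" "ev l \<alpha> (rel l 3) = 0"
  "ev l \<alpha> (rel l 4) = scl \<alpha> (bas 0)" "ev l \<alpha> (rel l 5) = 0" "ev l \<alpha> (rel l 6) = 0"
  by (simp_all add: rel_simps ev_def zero_prod_def deformed_mul_simps bilin_ext_bas)

lemma Ae_eval_eq:
  assumes "CHAR('k::field) \<noteq> 2"
  shows "Ae_eval (l::'k) = ev l 0"
  by (simp add: Ae_eval_def ev_def Ae_mul_eq[OF assms])

lemma rels_eq: "rels l = {rel l (Suc 0), rel l 2, rel l 3, rel l 4, rel l 5, rel l 6}"
proof -
  have "{1..6} = {Suc 0, 2, 3, 4, 5, 6}"
    by auto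
  then show ?thesis
    by (simp only: rels_def image_insert image_empty)
qed

text \<open>An element that evaluates to 0 is congruent to the normal form of 0, hence lies in the
  ideal. The other inclusion only needs the six relations to evaluate to 0, which holds at \<alpha>
  = 0.\<close>

lemma eval_kernel:
  "{p. ev l 0 p = 0} = Idl\<^bsub>free_alg\<^esub> (rels l)"
proof
  have J: "sc_ideal free_mul [] (Idl\<^bsub>free_alg\<^esub> (rels l))"
    unfolding free_alg_def
    by (intro sc_ideal.intro sc_ideal_axioms.intro ideal_Idl free.sc_algebra_axioms)
  interpret deformed_rels "Idl\<^bsub>free_alg\<^esub> (rels l)" l 0
  proof (intro deformed_rels.intro deformed_rels_axioms.intro J)
    show "rel l i \<in> Idl\<^bsub>free_alg\<^esub> (rels l)" if "i \<in> {1..6}" for i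
      unfolding free_alg_def using that by (intro Idl_mem free.sc_algebra_axioms) (simp add: rels_def)
    from this[of 4] show "rel l 4 - scl 0 (bas []) \<in> Idl\<^bsub>free_alg\<^esub> (rels l)"
      by simp
  qed
  show "{p. ev l 0 p = 0} \<subseteq> Idl\<^bsub>free_alg\<^esub> (rels l)"
    using eval_0_imp_mem by auto
  show "Idl\<^bsub>free_alg\<^esub> (rels l) \<subseteq> {p. ev l 0 p = 0}"
    unfolding free_alg_def
    by (intro Idl_minimal free.sc_algebra_axioms free.sc_ideal_kernel[OF klin_ev eval_mult])
      (auto simp: rels_eq eval_rel)
qed

theorem Ae_presentation:
  fixes l :: "'k::field"
  assumes "CHAR('k) \<noteq> 2"
  shows "Ae_eval l \<in> alg_hom free_alg (Ae l)"
    and "Ae_eval l ` carrier free_alg = carrier (Ae l)"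
    and "a_kernel free_alg (Ae l) (Ae_eval l) = Idl\<^bsub>free_alg\<^esub> (rels l)"
proof -
  note defs = Ae_eval_eq[OF assms] free_alg_def Ae_def alg_of_def Ae_mul_eq[OF assms]
  show "Ae_eval l \<in> alg_hom free_alg (Ae l)"
    by (auto simp: alg_hom_def ring_hom_def defs eval_mult klin_add[OF klin_ev] klin_scale[OF klin_ev])
      (simp add: ev_def)
  show "Ae_eval l ` carrier free_alg = carrier (Ae l)"
  proof -
    have "p = ev l 0 (lin_ext (normal_form l) p)" for p
      by (rule klin_eqI[where p = p])
        (simp_all add: klin_ident klin_comp[OF klin_ev klin_lin_ext] eval_normal)
    then have "surj (ev l 0)"
      by (rule surjI[OF sym])
    then show ?thesis
      by (simp add: defs)
  qed
  show "a_kernel free_alg (Ae l) (Ae_eval l) = Idl\<^bsub>free_alg\<^esub> (rels l)"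
    unfolding eval_kernel[symmetric] by (simp add: a_kernel_def' defs)
qed

section \<open>Associated graded algebras of quotients\<close>

lemma alg_of_simps [simp]:
  "carrier (alg_of m e) = UNIV" "mult (alg_of m e) = bilin_ext m" "one (alg_of m e) = bas e"
  "zero (alg_of m e) = 0" "add (alg_of m e) = (+)" "smult (alg_of m e) = scl"
  by (simp_all add: alg_of_def)

text \<open>The filtration lives on the algebra before the quotient is taken. The quotient, its
  filtration and its graded algebra are then all described through representatives, so that
  computations stay in a space with a basis.\<close>

locale filtered_quotient = sc_ideal m e J
  for m :: "'b \<Rightarrow> 'b \<Rightarrow> ('b \<Rightarrow>\<^sub>0 'k::field)" and e :: 'b and J :: "('b \<Rightarrow>\<^sub>0 'k) set" +
  fixes FF :: "nat \<Rightarrow> ('b \<Rightarrow>\<^sub>0 'k) set"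
  assumes FF_0: "0 \<in> FF n"
    and FF_add: "p \<in> FF n \<Longrightarrow> q \<in> FF n \<Longrightarrow> p + q \<in> FF n"
    and FF_scl: "p \<in> FF n \<Longrightarrow> scl c p \<in> FF n"
    and FF_Suc: "FF n \<subseteq> FF (Suc n)"
    and FF_mult: "p \<in> FF i \<Longrightarrow> q \<in> FF j \<Longrightarrow> p \<star> q \<in> FF (i + j)"
    and FF_unit: "bas e \<in> FF 0"
begin

abbreviation "A \<equiv> alg_of m e"
abbreviation "D \<equiv> alg_quot A J"

definition qq :: "('b \<Rightarrow>\<^sub>0 'k) \<Rightarrow> ('b \<Rightarrow>\<^sub>0 'k) set" where "qq p = {q. q - p \<in> J}"

lemma qq_coset: "J +>\<^bsub>A\<^esub> p = qq p"
  by (auto simp: qq_def a_r_coset_def' intro!: bexI[of _ "x - p" for x])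

lemma qq_eq_iff: "qq p = qq q \<longleftrightarrow> p - q \<in> J"
proof
  assume "qq p = qq q"
  moreover have "p \<in> qq p"
    by (simp add: qq_def)
  ultimately show "p - q \<in> J"
    by (auto simp: qq_def)
next
  assume pq: "p - q \<in> J"
  have "r - q = (r - p) + (p - q)" "r - p = (r - q) - (p - q)" for r
    by simp_all
  then show "qq p = qq q"
    using J_add[OF _ pq] J_diff[OF _ pq] unfolding qq_def by (metis (lifting))
qed

lemma qq_0: "qq 0 = J"
  by (simp add: qq_def)

definition F where "F n = (\<lambda>p. J +>\<^bsub>A\<^esub> p) ` FF n"

lemmas quot_defs = alg_quot_def ring.defs module.defs FactRing_def

lemma quot_carrier: "carrier D = range qq"
  by (auto simp: quot_defs A_RCOSETS_def' qq_coset)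

lemma quot_add: "qq p \<oplus>\<^bsub>D\<^esub> qq q = qq (p + q)"
  using ideal.a_rcos_sum[OF ideal_J, of p q] by (simp add: quot_defs qq_coset)

lemma quot_mult: "qq p \<otimes>\<^bsub>D\<^esub> qq q = qq (p \<star> q)"
  using ideal.rcoset_mult_add[OF ideal_J, of p q] by (simp add: quot_defs qq_coset)

lemma quot_zero: "\<zero>\<^bsub>D\<^esub> = qq 0"
  by (simp add: quot_defs qq_0)

lemma quot_one: "\<one>\<^bsub>D\<^esub> = qq (bas e)"
  by (simp add: quot_defs qq_coset)

lemma quot_smult: "c \<odot>\<^bsub>D\<^esub> qq p = qq (scl c p)"
proof -
  have "qq (scl c q) = qq (scl c p)" if "q \<in> qq p" for q
    using that J_scl[of "q - p" c] by (simp add: qq_eq_iff qq_def[of p] scl_simps)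
  moreover have "p \<in> qq p"
    by (simp add: qq_def)
  moreover have "c \<odot>\<^bsub>D\<^esub> qq p = (\<Union>q\<in>qq p. qq (scl c q))"
    by (simp add: quot_defs qq_coset)
  ultimately show ?thesis
    by blast
qed

lemma quot_abelian_monoid: "abelian_monoid D"
  by (rule abelian_monoidI)
    (auto simp: quot_carrier quot_add quot_zero add_ac)

lemma quot_finsum: "(\<Oplus>\<^bsub>D\<^esub>i\<in>{..n}. qq (f i)) = qq (\<Sum>i\<le>n. f i)" for n :: nat
proof -
  interpret abelian_monoid D
    by (rule quot_abelian_monoid)
  show ?thesis
    by (induction n) (simp_all add: quot_carrier quot_add add.commute)
qed

definition FP :: "nat \<Rightarrow> ('b \<Rightarrow>\<^sub>0 'k) set" where
  "FP n = (case n of 0 \<Rightarrow> {0} | Suc k \<Rightarrow> FF k)"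

lemma filt_prev_eq: "filt_prev D F n = qq ` FP n"
  by (simp add: filt_prev_def FP_def F_def quot_zero qq_coset split: nat.split)

lemma FP_0: "0 \<in> FP n"
  by (simp add: FP_def FF_0 split: nat.split)

lemma FP_add: "p \<in> FP n \<Longrightarrow> q \<in> FP n \<Longrightarrow> p + q \<in> FP n"
  by (simp add: FP_def FF_add split: nat.splits)

lemma FP_scl: "p \<in> FP n \<Longrightarrow> scl c p \<in> FP n"
  by (simp add: FP_def FF_scl split: nat.splits)

lemma FP_subset: "FP n \<subseteq> FF n"
  using FF_Suc by (auto simp: FP_def FF_0 split: nat.splits)

lemma FP_mult_left: "p \<in> FP i \<Longrightarrow> q \<in> FF j \<Longrightarrow> p \<star> q \<in> FP (i + j)"
  by (cases i) (auto simp: FP_def bilin_ext_simps FF_mult FF_0 split: nat.split)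

lemma FP_mult_right: "p \<in> FF i \<Longrightarrow> q \<in> FP j \<Longrightarrow> p \<star> q \<in> FP (i + j)"
  by (cases j) (auto simp: FP_def bilin_ext_simps FF_mult FF_0 split: nat.split)

text \<open>The preimage of \<open>F\<^sub>n\<^sub>-\<^sub>1\<close>, so that the \<open>n\<close>-th graded piece is \<open>FF n\<close> modulo \<open>lower n\<close>.\<close>

definition lower :: "nat \<Rightarrow> ('b \<Rightarrow>\<^sub>0 'k) set" where
  "lower n = {p. \<exists>f\<in>FP n. p - f \<in> J}"

lemma lower_0: "0 \<in> lower n"
  using FP_0 by (force simp: lower_def)

lemma lower_add: "p \<in> lower n \<Longrightarrow> q \<in> lower n \<Longrightarrow> p + q \<in> lower n"
proof -
  assume "p \<in> lower n" "q \<in> lower n"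
  then obtain f g where "f \<in> FP n" "g \<in> FP n" "p - f \<in> J" "q - g \<in> J"
    by (auto simp: lower_def)
  then show ?thesis
    using FP_add[of f n g] J_add[of "p - f" "q - g"] by (auto simp: lower_def algebra_simps)
qed

lemma lower_scl: "p \<in> lower n \<Longrightarrow> scl c p \<in> lower n"
proof -
  assume "p \<in> lower n"
  then obtain f where "f \<in> FP n" "p - f \<in> J"
    by (auto simp: lower_def)
  then show ?thesis
    using FP_scl[of f n c] J_scl[of "p - f" c] by (auto simp: lower_def scl_simps)
qed

lemma lower_neg: "p \<in> lower n \<Longrightarrow> - p \<in> lower n"
  using lower_scl[of p n "-1"] by simp

lemma lower_diff: "p \<in> lower n \<Longrightarrow> q \<in> lower n \<Longrightarrow> p - q \<in> lower n"
  using lower_add[of p n "- q"] lower_neg[of q n] by simp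

lemma lower_sum: "(\<And>i. i \<in> I \<Longrightarrow> f i \<in> lower n) \<Longrightarrow> sum f I \<in> lower n"
  by (induction I rule: infinite_finite_induct) (auto intro: lower_add lower_0)

lemma J_lower: "p \<in> J \<Longrightarrow> p \<in> lower n"
  using FP_0 by (force simp: lower_def)

lemma FP_lower: "p \<in> FP n \<Longrightarrow> p \<in> lower n"
  by (force simp: lower_def)

text \<open>The product in \<open>gr_alg\<close> ranges over all representatives of a coset, so q is
  only known to agree modulo \<open>lower j\<close> with some element of \<open>FF j\<close>; it
  need not lie in \<open>FF j\<close> itself.\<close>

lemma lower_mult_left: "p \<in> lower i \<Longrightarrow> q - g \<in> lower j \<Longrightarrow> g \<in> FF j \<Longrightarrow> p \<star> q \<in> lower (i + j)"
proof -
  assume "p \<in> lower i" "q - g \<in> lower j" and g: "g \<in> FF j"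
  then obtain f f' where f: "f \<in> FP i" "p - f \<in> J" "f' \<in> FP j" "q - g - f' \<in> J"
    by (auto simp: lower_def)
  have "p \<star> q = (p - f) \<star> q + (f \<star> (q - g - f') + f \<star> (g + f'))"
    by (simp add: bilin_ext_simps)
  moreover have "f \<star> (g + f') \<in> FP (i + j)"
    using f g FP_subset by (intro FP_mult_left FF_add) auto
  ultimately show ?thesis
    using f by (simp add: lower_add J_lower J_left J_right FP_lower)
qed

lemma lower_mult_right: "p \<in> FF i \<Longrightarrow> q \<in> lower j \<Longrightarrow> p \<star> q \<in> lower (i + j)"
proof -
  assume p: "p \<in> FF i" and "q \<in> lower j"
  then obtain f where f: "f \<in> FP j" "q - f \<in> J"
    by (auto simp: lower_def)
  have "p \<star> q = p \<star> (q - f) + p \<star> f"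
    by (simp add: bilin_ext_simps)
  then show ?thesis
    using f p by (simp add: lower_add J_lower J_left FP_lower FP_mult_right)
qed

text \<open>A member of the n-th graded piece is a coset in the quotient algebra, that is, a set of
  cosets of J.\<close>

definition cls :: "nat \<Rightarrow> ('b \<Rightarrow>\<^sub>0 'k) \<Rightarrow> ('b \<Rightarrow>\<^sub>0 'k) set set" where
  "cls n p = qq ` {q. q - p \<in> lower n}"

lemma cls_coset: "filt_prev D F n +>\<^bsub>D\<^esub> qq p = cls n p"
proof -
  have "filt_prev D F n +>\<^bsub>D\<^esub> qq p = (\<lambda>f. qq (f + p)) ` FP n"
    by (auto simp: a_r_coset_def' filt_prev_eq quot_add)
  also have "\<dots> = cls n p"
  proof (intro equalityI subsetI)
    fix X assume "X \<in> (\<lambda>f. qq (f + p)) ` FP n"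
    then show "X \<in> cls n p"
      by (auto simp: cls_def FP_lower)
  next
    fix X assume "X \<in> cls n p"
    then obtain q f where "X = qq q" "f \<in> FP n" "q - p - f \<in> J"
      by (auto simp: cls_def lower_def)
    moreover then have "qq q = qq (f + p)"
      by (simp add: qq_eq_iff algebra_simps)
    ultimately show "X \<in> (\<lambda>f. qq (f + p)) ` FP n"
      by auto
  qed
  finally show ?thesis .
qed

lemma qq_mem_cls: "qq q \<in> cls n p \<longleftrightarrow> q - p \<in> lower n"
proof
  assume "qq q \<in> cls n p"
  then obtain r where "q - r \<in> J" "r - p \<in> lower n"
    by (auto simp: cls_def qq_eq_iff)
  then show "q - p \<in> lower n"
    using lower_add[of "q - r" n "r - p"] J_lower[of "q - r" n] by simp
qed (auto simp: cls_def)

lemma cls_eq_iff: "cls n p = cls n q \<longleftrightarrow> p - q \<in> lower n"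
proof
  assume "cls n p = cls n q"
  then show "p - q \<in> lower n"
    using qq_mem_cls[of p n p] qq_mem_cls[of p n q] by (simp add: lower_0)
next
  assume pq: "p - q \<in> lower n"
  have "r - q = (r - p) + (p - q)" "r - p = (r - q) - (p - q)" for r
    by simp_all
  then have "r - p \<in> lower n \<longleftrightarrow> r - q \<in> lower n" for r
    using lower_add[OF _ pq] lower_diff[OF _ pq] by metis
  then show "cls n p = cls n q"
    by (simp add: cls_def)
qed

lemma cls_0: "cls n 0 = filt_prev D F n"
  using cls_coset[of n 0]
  by (auto simp: a_r_coset_def' filt_prev_eq quot_add)

abbreviation "G \<equiv> gr_alg D F"

lemma gr_comp_eq: "gr_comp D F n = cls n ` FF n"
  by (simp add: gr_comp_def F_def qq_coset image_image cls_coset)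

lemma gr_carrier: "carrier G = {c. (\<forall>n. c n \<in> cls n ` FF n) \<and> finite {n. c n \<noteq> cls n 0}}"
  by (simp add: gr_alg_def gr_comp_eq cls_0)

lemma gr_one: "\<one>\<^bsub>G\<^esub> = (\<lambda>n. if n = 0 then cls 0 (bas e) else cls n 0)"
  by (rule ext) (simp add: gr_alg_def cls_0 quot_one cls_coset)

lemma gr_add: "(\<lambda>n. cls n (r n)) \<oplus>\<^bsub>G\<^esub> (\<lambda>n. cls n (s n)) = (\<lambda>n. cls n (r n + s n))"
proof -
  have "cls n p <+>\<^bsub>D\<^esub> cls n q = cls n (p + q)" for n p q
  proof -
    have "cls n p <+>\<^bsub>D\<^esub> cls n q = {qq (a + b) | a b. a - p \<in> lower n \<and> b - q \<in> lower n}"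
      by (auto simp: set_add_def' cls_def quot_add)
    also have "\<dots> = cls n (p + q)"
    proof (intro equalityI subsetI)
      fix X assume "X \<in> {qq (a + b) | a b. a - p \<in> lower n \<and> b - q \<in> lower n}"
      then obtain a b where "X = qq (a + b)" "a - p \<in> lower n" "b - q \<in> lower n"
        by blast
      then show "X \<in> cls n (p + q)"
        using lower_add[of "a - p" n "b - q"] by (auto simp: cls_def algebra_simps)
    next
      fix X assume "X \<in> cls n (p + q)"
      then obtain a where "X = qq a" "a - (p + q) \<in> lower n"
        by (auto simp: cls_def)
      then show "X \<in> {qq (a + b) | a b. a - p \<in> lower n \<and> b - q \<in> lower n}"
        \<comment> \<open>Any splitting of a serves; here the second summand is q itself, and the
          first absorbs the whole error.\<close>
        by (intro CollectI exI[of _ "a - q"] exI[of _ q]) (simp add: lower_0 algebra_simps)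
    qed
    finally show ?thesis .
  qed
  then show ?thesis
    by (simp add: gr_alg_def)
qed

lemma gr_smult: "c \<odot>\<^bsub>G\<^esub> (\<lambda>n. cls n (r n)) = (\<lambda>n. cls n (scl c (r n)))"
proof -
  have "(\<Union>X\<in>cls n p. filt_prev D F n +>\<^bsub>D\<^esub> (c \<odot>\<^bsub>D\<^esub> X)) = cls n (scl c p)" for n p
  proof -
    have "filt_prev D F n +>\<^bsub>D\<^esub> (c \<odot>\<^bsub>D\<^esub> X) = cls n (scl c p)" if X: "X \<in> cls n p" for X
    proof -
      obtain q where "X = qq q" "q - p \<in> lower n"
        using X by (auto simp: cls_def)
      then show ?thesis
        using lower_scl[of "q - p" n c] by (simp add: quot_smult cls_coset cls_eq_iff scl_simps)
    qed
    moreover have "qq p \<in> cls n p"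
      by (simp add: qq_mem_cls lower_0)
    ultimately show ?thesis
      by blast
  qed
  then show ?thesis
    by (simp add: gr_alg_def)
qed

text \<open>Writing ab - rs = (a - r)b + r(b - s) shows that every choice of representatives gives
  the same coset.\<close>

lemma gr_mult:
  assumes r: "\<And>n. r n \<in> FF n" and s: "\<And>n. s n \<in> FF n"
  shows "(\<lambda>n. cls n (r n)) \<otimes>\<^bsub>G\<^esub> (\<lambda>n. cls n (s n)) = (\<lambda>n. cls n (\<Sum>i\<le>n. r i \<star> s (n - i)))"
proof
  fix n
  let ?P = "\<lambda>x y. filt_prev D F n +>\<^bsub>D\<^esub> (\<Oplus>\<^bsub>D\<^esub>i\<in>{..n}. x i \<otimes>\<^bsub>D\<^esub> y (n - i))"
  have "?P x y = cls n (\<Sum>i\<le>n. r i \<star> s (n - i))"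
    if x: "x \<in> Pi UNIV (\<lambda>n. cls n (r n))" and y: "y \<in> Pi UNIV (\<lambda>n. cls n (s n))" for x y
  proof -
    have "x i \<in> cls i (r i)" "y i \<in> cls i (s i)" for i
      using x y by auto
    then have "\<forall>i. \<exists>a. x i = qq a \<and> a - r i \<in> lower i" "\<forall>i. \<exists>a. y i = qq a \<and> a - s i \<in> lower i"
      unfolding cls_def by blast+
    then obtain a b where a: "\<And>i. x i = qq (a i)" "\<And>i. a i - r i \<in> lower i"
      and b: "\<And>i. y i = qq (b i)" "\<And>i. b i - s i \<in> lower i"
      by metis
    have "a i \<star> b (n - i) - r i \<star> s (n - i) \<in> lower n" if "i \<le> n" for i
    proof -
      have "a i \<star> b (n - i) - r i \<star> s (n - i) = (a i - r i) \<star> b (n - i) + r i \<star> (b (n - i) - s (n - i))"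
        by (simp add: bilin_ext_simps)
      also have "\<dots> \<in> lower (i + (n - i))"
        using a b r s by (intro lower_add lower_mult_left lower_mult_right) auto
      finally show ?thesis
        using that by simp
    qed
    then have "(\<Sum>i\<le>n. a i \<star> b (n - i)) - (\<Sum>i\<le>n. r i \<star> s (n - i)) \<in> lower n"
      unfolding sum_subtractf[symmetric] by (intro lower_sum) simp
    then show ?thesis
      by (simp add: a b quot_mult quot_finsum cls_coset cls_eq_iff)
  qed
  \<comment> \<open>Representatives exist, so the union over all choices is not empty and equals the
    common value.\<close>
  moreover have "(\<lambda>n. qq (r n)) \<in> Pi UNIV (\<lambda>n. cls n (r n))" "(\<lambda>n. qq (s n)) \<in> Pi UNIV (\<lambda>n. cls n (s n))"
    by (auto simp: qq_mem_cls lower_0)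
  ultimately show "((\<lambda>n. cls n (r n)) \<otimes>\<^bsub>G\<^esub> (\<lambda>n. cls n (s n))) n = cls n (\<Sum>i\<le>n. r i \<star> s (n - i))"
    unfolding gr_alg_def by (simp; blast)
qed

lemma gr_alg_comp_eq: "gr_alg_comp D F n = (\<lambda>p i. cls i (if i = n then p else 0)) ` FF n"
proof (intro equalityI subsetI)
  fix c assume c: "c \<in> gr_alg_comp D F n"
  then have "c n \<in> cls n ` FF n"
    by (auto simp: gr_alg_comp_def gr_carrier)
  then obtain p where p: "p \<in> FF n" "c n = cls n p"
    by blast
  moreover have "c = (\<lambda>i. cls i (if i = n then p else 0))"
    using c p by (auto simp: gr_alg_comp_def cls_0 fun_eq_iff)
  ultimately show "c \<in> (\<lambda>p i. cls i (if i = n then p else 0)) ` FF n"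
    by auto
next
  fix c assume "c \<in> (\<lambda>p i. cls i (if i = n then p else 0)) ` FF n"
  then obtain p where p: "p \<in> FF n" "c = (\<lambda>i. cls i (if i = n then p else 0))"
    by auto
  have "{i. c i \<noteq> cls i 0} \<subseteq> {n}"
    using p by auto
  then have "finite {i. c i \<noteq> cls i 0}"
    by (rule finite_subset) simp
  then show "c \<in> gr_alg_comp D F n"
    using p by (auto simp: gr_alg_comp_def gr_carrier cls_0 FF_0)
qed

end

section \<open>Graded algebras with a homogeneous basis\<close>

definition homog :: "('b \<Rightarrow> nat) \<Rightarrow> nat \<Rightarrow> ('b \<Rightarrow>\<^sub>0 'k::field) set" where
  "homog dg n = {p. \<forall>b\<in>Poly_Mapping.keys p. dg b = n}"

definition homog_part :: "('b \<Rightarrow> nat) \<Rightarrow> nat \<Rightarrow> ('b \<Rightarrow>\<^sub>0 'k::field) \<Rightarrow> ('b \<Rightarrow>\<^sub>0 'k)" where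
  "homog_part dg n = lin_ext (\<lambda>b. if dg b = n then bas b else 0)"

lemma klin_homog_part: "klin (homog_part dg n)"
  unfolding homog_part_def by (rule klin_lin_ext)

lemma lookup_proj:
  "Poly_Mapping.lookup (homog_part dg n p) b = (if dg b = n then Poly_Mapping.lookup p b else 0)"
proof -
  have "Poly_Mapping.lookup (homog_part dg n p) b =
      (\<Sum>a\<in>Poly_Mapping.keys p. if a = b then (if dg b = n then Poly_Mapping.lookup p b else 0) else 0)"
    unfolding homog_part_def lin_ext_def lookup_sum
    by (intro sum.cong refl) (auto simp: lookup_single when_def)
  then show ?thesis
    by (auto simp: in_keys_iff)
qed

lemma homog_iff: "p \<in> homog dg n \<longleftrightarrow> homog_part dg n p = p"
  by (auto simp: homog_def poly_mapping_eq_iff fun_eq_iff lookup_proj in_keys_iff)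

lemma proj_homog: "homog_part dg n p \<in> homog dg n"
  by (auto simp: homog_def in_keys_iff lookup_proj split: if_splits)

lemma proj_homog_neq: "p \<in> homog dg i \<Longrightarrow> i \<noteq> n \<Longrightarrow> homog_part dg n p = 0"
  by (auto simp: homog_def poly_mapping_eq_iff fun_eq_iff lookup_proj in_keys_iff)

lemma proj_eq_0: "n \<notin> dg ` Poly_Mapping.keys p \<Longrightarrow> homog_part dg n p = 0"
  by (auto simp: poly_mapping_eq_iff fun_eq_iff lookup_proj in_keys_iff)

lemma proj_eqI: "(\<And>n. homog_part dg n p = homog_part dg n q) \<Longrightarrow> p = q"
  by (rule poly_mapping_eqI) (metis lookup_proj)

lemma proj_mult:
  assumes m: "\<And>a b. m a b \<in> homog dg (dg a + dg b)"
  shows "homog_part dg n (bilin_ext m p q) = (\<Sum>i\<le>n. bilin_ext m (homog_part dg i p) (homog_part dg (n - i) q))"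
proof -
  have 1: "homog_part dg n (bilin_ext m (bas a) (bas b)) =
      (\<Sum>i\<le>n. bilin_ext m (homog_part dg i (bas a)) (homog_part dg (n - i) (bas b)))" for a b
  proof -
    have "(\<Sum>i\<le>n. bilin_ext m (homog_part dg i (bas a)) (homog_part dg (n - i) (bas b))) =
        (\<Sum>i\<le>n. if i = dg a then (if dg a + dg b = n then m a b else 0) else 0)"
      by (intro sum.cong refl) (auto simp: homog_part_def bilin_ext_simps bilin_ext_bas)
    also have "\<dots> = (if dg a + dg b = n then m a b else 0)"
      by auto
    also have "\<dots> = homog_part dg n (m a b)"
      using m[of a b] by (auto simp: homog_iff proj_homog_neq)
    finally show ?thesis
      by (simp add: bilin_ext_bas)
  qed
  have klin_sum_fun: "(\<And>i. i \<in> I \<Longrightarrow> klin (f i)) \<Longrightarrow> klin (\<lambda>p. \<Sum>i\<in>I. f i p)"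
    for I :: "nat set" and f :: "nat \<Rightarrow> ('a \<Rightarrow>\<^sub>0 'b) \<Rightarrow> ('a \<Rightarrow>\<^sub>0 'b)"
    by (simp add: klin_iff sum.distrib scl.vs1.scale_sum_right)
  have 2: "homog_part dg n (bilin_ext m (bas a) q) =
      (\<Sum>i\<le>n. bilin_ext m (homog_part dg i (bas a)) (homog_part dg (n - i) q))" for a
    by (rule klin_eqI[where p = q, OF klin_comp[OF klin_homog_part klin_bilin_right]
          klin_sum_fun[OF klin_comp[OF klin_bilin_right klin_homog_part]] 1])
  show ?thesis
    by (rule klin_eqI[where p = p, OF klin_comp[OF klin_homog_part klin_bilin_left]
          klin_sum_fun[OF klin_comp[OF klin_bilin_left klin_homog_part]] 2])
qed

section \<open>Symbol maps\<close>

text \<open>The assumptions say that \<open>symb n\<close> induces a linear isomorphism from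
  \<open>FF n\<close> modulo \<open>lower n\<close> onto the n-th homogeneous component, compatibly
  with products and units. This is a criterion for recognising the associated graded
  algebra.\<close>

locale symbol_maps = filtered_quotient m e J FF
  for m :: "'b \<Rightarrow> 'b \<Rightarrow> ('b \<Rightarrow>\<^sub>0 'k::field)" and e :: 'b and J :: "('b \<Rightarrow>\<^sub>0 'k) set"
    and FF :: "nat \<Rightarrow> ('b \<Rightarrow>\<^sub>0 'k) set" +
  fixes m' :: "'c \<Rightarrow> 'c \<Rightarrow> ('c \<Rightarrow>\<^sub>0 'k)" and e' :: 'c and dg :: "'c \<Rightarrow> nat"
    and symb :: "nat \<Rightarrow> ('b \<Rightarrow>\<^sub>0 'k) \<Rightarrow> ('c \<Rightarrow>\<^sub>0 'k)"
  assumes m'_homog: "m' a b \<in> homog dg (dg a + dg b)"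
    and e'_homog: "dg e' = 0"
    and klin_symb: "klin (symb n)"
    and symb_image: "symb n ` FF n = homog dg n"
    and symb_0_iff: "p \<in> FF n \<Longrightarrow> symb n p = 0 \<longleftrightarrow> p \<in> lower n"
    and symb_mult: "p \<in> FF i \<Longrightarrow> q \<in> FF j \<Longrightarrow> symb (i + j) (p \<star> q) = bilin_ext m' (symb i p) (symb j q)"
    and symb_unit: "symb 0 (bas e) = bas e'"
begin

definition lift :: "('c \<Rightarrow>\<^sub>0 'k) \<Rightarrow> nat \<Rightarrow> ('b \<Rightarrow>\<^sub>0 'k)" where
  "lift t n = (SOME p. p \<in> FF n \<and> symb n p = homog_part dg n t)"

lemma lift: "lift t n \<in> FF n" "symb n (lift t n) = homog_part dg n t"
proof -
  have "\<exists>p. p \<in> FF n \<and> symb n p = homog_part dg n t"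
    using symb_image[of n] proj_homog[of dg n t] by (metis imageE)
  then show "lift t n \<in> FF n" "symb n (lift t n) = homog_part dg n t"
    unfolding lift_def by (metis (mono_tags, lifting) someI_ex)+
qed

lemma FF_diff: "p \<in> FF n \<Longrightarrow> q \<in> FF n \<Longrightarrow> p - q \<in> FF n"
  using FF_add[of p n "scl (-1) q"] FF_scl[of q n "-1"] by simp

lemma cls_symb: "p \<in> FF n \<Longrightarrow> q \<in> FF n \<Longrightarrow> cls n p = cls n q \<longleftrightarrow> symb n p = symb n q"
  using symb_0_iff[OF FF_diff, of p n q] by (simp add: cls_eq_iff klin_diff[OF klin_symb])

text \<open>The isomorphism is built from the target towards the graded algebra, because an element
  of the target is determined by its homogeneous parts; the map required by
  \<open>graded_iso\<close> is the inverse.\<close>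

definition psi :: "('c \<Rightarrow>\<^sub>0 'k) \<Rightarrow> nat \<Rightarrow> ('b \<Rightarrow>\<^sub>0 'k) set set" where
  "psi t = (\<lambda>n. cls n (lift t n))"

text \<open>The arbitrary choice in \<open>lift\<close> is harmless: any representatives with the
  right symbols describe \<open>psi\<close>. Each structure rule below follows by naming suitable
  representatives.\<close>

lemma psi_eqI: "(\<And>n. p n \<in> FF n) \<Longrightarrow> (\<And>n. symb n (p n) = homog_part dg n t) \<Longrightarrow> psi t = (\<lambda>n. cls n (p n))"
  unfolding psi_def by (rule ext) (simp add: cls_symb lift)

lemma inj_psi: "inj psi"
proof (rule injI)
  fix s t assume "psi s = psi t"
  then have "cls n (lift s n) = cls n (lift t n)" for n
    by (metis psi_def)
  then show "s = t"
    by - (rule proj_eqI[of dg], simp add: cls_symb lift)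
qed

lemma psi_carrier: "psi t \<in> carrier G"
proof -
  have "{n. psi t n \<noteq> cls n 0} \<subseteq> dg ` Poly_Mapping.keys t"
    using proj_eq_0[of _ dg t] by (auto simp: psi_def cls_symb lift FF_0 klin_0[OF klin_symb])
  then have "finite {n. psi t n \<noteq> cls n 0}"
    by (rule finite_subset) simp
  then show ?thesis
    by (auto simp: gr_carrier psi_def lift)
qed

lemma psi_surj: "c \<in> carrier G \<Longrightarrow> c \<in> range psi"
proof -
  assume c: "c \<in> carrier G"
  then have "\<forall>n. \<exists>p. p \<in> FF n \<and> c n = cls n p"
    by (auto simp: gr_carrier)
  then obtain r where r: "\<And>n. r n \<in> FF n" "\<And>n. c n = cls n (r n)"
    by metis
  \<comment> \<open>The support is finite, so the symbols of the components can be added up to one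
    element of the target, the preimage of c.\<close>
  define N where "N = {n. c n \<noteq> cls n 0}"
  have fin: "finite N"
    using c by (simp add: gr_carrier N_def)
  have symb: "symb n (r n) \<in> homog dg n" for n
    using symb_image r by blast
  have "homog_part dg n (\<Sum>i\<in>N. symb i (r i)) = symb n (r n)" for n
  proof -
    have "homog_part dg n (\<Sum>i\<in>N. symb i (r i)) = (\<Sum>i\<in>N. if i = n then symb n (r n) else 0)"
      unfolding klin_sum[OF klin_homog_part]
      using symb by (intro sum.cong refl) (metis homog_iff proj_homog_neq)
    also have "\<dots> = (if n \<in> N then symb n (r n) else 0)"
      using fin by simp
    also have "\<dots> = symb n (r n)"
      using r by (auto simp: N_def cls_symb FF_0 klin_0[OF klin_symb])
    finally show ?thesis .
  qed
  then have "psi (\<Sum>i\<in>N. symb i (r i)) = (\<lambda>n. cls n (r n))"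
    using r by (intro psi_eqI) auto
  then show "c \<in> range psi"
    using r(2) by (metis ext rangeI)
qed

lemma psi_range: "range psi = carrier G"
  using psi_carrier psi_surj by auto

lemma psi_add: "psi (s + t) = psi s \<oplus>\<^bsub>G\<^esub> psi t"
  unfolding psi_def[of s] psi_def[of t] gr_add
  by (rule psi_eqI) (simp_all add: FF_add lift klin_add[OF klin_symb] klin_add[OF klin_homog_part])

lemma psi_scl: "psi (scl c t) = c \<odot>\<^bsub>G\<^esub> psi t"
  unfolding psi_def[of t] gr_smult
  by (rule psi_eqI) (simp_all add: FF_scl lift klin_scale[OF klin_symb] klin_scale[OF klin_homog_part])

lemma FF_sum: "(\<And>i. i \<in> I \<Longrightarrow> f i \<in> FF n) \<Longrightarrow> sum f I \<in> FF n"
  by (induction I rule: infinite_finite_induct) (auto intro: FF_add FF_0)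

lemma psi_mult: "psi (bilin_ext m' s t) = psi s \<otimes>\<^bsub>G\<^esub> psi t"
  unfolding psi_def[of s] psi_def[of t] gr_mult[OF lift(1) lift(1)]
proof (rule psi_eqI)
  fix n
  have prod: "lift s i \<star> lift t (n - i) \<in> FF n"
    "symb n (lift s i \<star> lift t (n - i)) = bilin_ext m' (homog_part dg i s) (homog_part dg (n - i) t)"
    if "i \<le> n" for i
    using that FF_mult[OF lift(1)[of s i] lift(1)[of t "n - i"]]
      symb_mult[OF lift(1)[of s i] lift(1)[of t "n - i"]] by (simp_all add: lift)
  show "(\<Sum>i\<le>n. lift s i \<star> lift t (n - i)) \<in> FF n"
    by (intro FF_sum) (simp add: prod)
  show "symb n (\<Sum>i\<le>n. lift s i \<star> lift t (n - i)) = homog_part dg n (bilin_ext m' s t)"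
    by (simp add: klin_sum[OF klin_symb] proj_mult[of m' dg, OF m'_homog] prod)
qed

lemma psi_one: "psi (bas e') = \<one>\<^bsub>G\<^esub>"
proof -
  have "psi (bas e') = (\<lambda>n. cls n (if n = 0 then bas e else 0))"
    by (rule psi_eqI)
      (auto simp: FF_unit FF_0 klin_0[OF klin_symb] symb_unit homog_part_def e'_homog)
  then show ?thesis
    by (auto simp: gr_one fun_eq_iff)
qed

lemma psi_homog: "psi ` homog dg n = gr_alg_comp D F n"
proof (intro equalityI subsetI)
  fix c assume "c \<in> psi ` homog dg n"
  then obtain t where t: "t \<in> homog dg n" "c = psi t"
    by auto
  have "psi t = (\<lambda>i. cls i (if i = n then lift t n else 0))"
    by (rule psi_eqI) (use t in \<open>auto simp: lift FF_0 klin_0[OF klin_symb] proj_homog_neq\<close>)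
  then show "c \<in> gr_alg_comp D F n"
    using t lift by (auto simp: gr_alg_comp_eq)
next
  fix c assume "c \<in> gr_alg_comp D F n"
  then obtain p where p: "p \<in> FF n" "c = (\<lambda>i. cls i (if i = n then p else 0))"
    by (auto simp: gr_alg_comp_eq)
  have *: "symb n p \<in> homog dg n"
    using symb_image p by blast
  have "psi (symb n p) = c"
    unfolding p
    by (rule psi_eqI) (use * p in \<open>auto simp: FF_0 klin_0[OF klin_symb] proj_homog_neq homog_iff\<close>)
  then show "c \<in> psi ` homog dg n"
    using * by auto
qed

theorem graded_iso: "graded_iso G (gr_alg_comp D F) (alg_of m' e') (homog dg)"
proof -
  define phi where "phi = inv_into UNIV psi"
  have psi_phi: "c \<in> carrier G \<Longrightarrow> psi (phi c) = c" for c
    unfolding phi_def psi_range[symmetric] by (rule f_inv_into_f)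
  have phi_psi: "phi (psi t) = t" for t
    unfolding phi_def by (rule inv_f_f[OF inj_psi])
  have "phi \<in> alg_hom G (alg_of m' e')"
    unfolding alg_hom_def
  proof (intro CollectI conjI ballI allI ring_hom_memI)
    fix c d assume "c \<in> carrier G" "d \<in> carrier G"
    then obtain s t where [simp]: "c = psi s" "d = psi t"
      by (metis psi_phi)
    show "phi (c \<otimes>\<^bsub>G\<^esub> d) = phi c \<otimes>\<^bsub>alg_of m' e'\<^esub> phi d"
      by (simp add: phi_psi flip: psi_mult)
    show "phi (c \<oplus>\<^bsub>G\<^esub> d) = phi c \<oplus>\<^bsub>alg_of m' e'\<^esub> phi d"
      by (simp add: phi_psi flip: psi_add)
  next
    fix a c assume "c \<in> carrier G"
    then obtain s where [simp]: "c = psi s"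
      by (metis psi_phi)
    show "phi (a \<odot>\<^bsub>G\<^esub> c) = a \<odot>\<^bsub>alg_of m' e'\<^esub> phi c"
      by (simp add: phi_psi flip: psi_scl)
  qed (simp_all add: phi_psi flip: psi_one)
  moreover have "bij_betw phi (carrier G) (carrier (alg_of m' e'))"
    by (rule bij_betw_byWitness[of _ psi]) (auto simp: psi_phi phi_psi psi_carrier)
  moreover have "phi ` gr_alg_comp D F n = homog dg n" for n
    by (simp add: image_image phi_psi flip: psi_homog)
  ultimately show ?thesis
    unfolding graded_iso_def by blast
qed

end

section \<open>Degree filtrations and leading parts of products\<close>

lemma klin_expand:
  assumes "klin f"
  shows "f p = lin_ext (\<lambda>b. f (bas b)) p"
  by (rule klin_eqI[where p = p]) (simp_all add: assms klin_intros)

definition below :: "('b \<Rightarrow> nat) \<Rightarrow> nat \<Rightarrow> ('b \<Rightarrow>\<^sub>0 'k::field) set" where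
  "below dg n = {p. \<forall>b\<in>Poly_Mapping.keys p. dg b \<le> n}"

lemma below_iff: "p \<in> below dg n \<longleftrightarrow> (\<forall>b. n < dg b \<longrightarrow> Poly_Mapping.lookup p b = 0)"
  by (auto simp: below_def in_keys_iff simp flip: not_less)

lemma below_0 [simp]: "0 \<in> below dg n"
  by (simp add: below_iff)

lemma below_add: "p \<in> below dg n \<Longrightarrow> q \<in> below dg n \<Longrightarrow> p + q \<in> below dg n"
  by (simp add: below_iff lookup_add)

lemma below_scl: "p \<in> below dg n \<Longrightarrow> scl c p \<in> below dg n"
  by (simp add: below_iff)

lemma below_neg: "p \<in> below dg n \<Longrightarrow> - p \<in> below dg n"
  by (simp add: below_iff)

lemma below_diff: "p \<in> below dg n \<Longrightarrow> q \<in> below dg n \<Longrightarrow> p - q \<in> below dg n"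
  by (simp add: below_iff lookup_minus)

lemma below_single: "dg b \<le> n \<Longrightarrow> Poly_Mapping.single b c \<in> below dg n"
  by (auto simp: below_iff lookup_single when_def)

lemma below_mono: "p \<in> below dg i \<Longrightarrow> i \<le> n \<Longrightarrow> p \<in> below dg n"
  by (auto simp: below_iff)

lemma below_sum: "(\<And>i. i \<in> I \<Longrightarrow> f i \<in> below dg n) \<Longrightarrow> sum f I \<in> below dg n"
  by (induction I rule: infinite_finite_induct) (auto intro: below_add)

lemma below_lin_ext: "(\<And>a. a \<in> Poly_Mapping.keys p \<Longrightarrow> f a \<in> below dg n) \<Longrightarrow> lin_ext f p \<in> below dg n"
  unfolding lin_ext_def by (intro below_sum below_scl)

lemma bilin_ext_alt: "bilin_ext m p q = lin_ext (\<lambda>a. lin_ext (m a) q) p"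
proof -
  have "bilin_ext m p q = lin_ext (\<lambda>a. bilin_ext m (bas a) q) p"
    by (rule klin_expand[OF klin_bilin_left])
  moreover have "bilin_ext m (bas a) q = lin_ext (m a) q" for a
    using klin_expand[OF klin_bilin_right, of m "bas a" q] by (simp add: bilin_ext_bas)
  ultimately show ?thesis
    by simp
qed

lemma below_bilin_ext:
  assumes "\<And>a b. m a b \<in> below dg (dg a + dg b)" "p \<in> below dg i" "q \<in> below dg j"
  shows "bilin_ext m p q \<in> below dg (i + j)"
  unfolding bilin_ext_alt
  using assms(2,3) by (intro below_lin_ext below_mono[OF assms(1)]) (auto simp: below_def intro: add_mono)

lemma below_tens: "p \<in> below dg n \<Longrightarrow> tens p q \<in> below (\<lambda>(b, h). dg b) n"
  unfolding tens_def by (intro below_lin_ext below_single) (auto simp: below_def)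

lemma homog_part_lin_ext:
  "homog_part dg n (lin_ext f p) = lin_ext (\<lambda>b. homog_part dg n (f b)) p"
  using klin_expand[OF klin_comp[OF klin_homog_part klin_lin_ext], of dg n f p] by simp

lemma proj_single:
  "homog_part dg n (Poly_Mapping.single b c) = (if dg b = n then Poly_Mapping.single b c else 0)"
  by (simp add: homog_part_def)

lemma proj_below: "p \<in> below dg i \<Longrightarrow> i < n \<Longrightarrow> homog_part dg n p = 0"
  by (rule proj_eq_0) (auto simp: below_def)

lemma proj_tens: "homog_part (\<lambda>(b, h). dg b) n (tens p q) = tens (homog_part dg n p) q"
proof -
  have 1: "homog_part (\<lambda>(b, h). dg b) n (tens (bas a) q) = tens (homog_part dg n (bas a)) q" for a
    by (rule klin_eqI[where p = q, OF klin_comp[OF klin_homog_part klin_tens_right] klin_tens_right])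
      (simp add: tens_bas proj_single tens_simps)
  show ?thesis
    by (rule klin_eqI[where p = p, OF klin_comp[OF klin_homog_part klin_tens_left]
      klin_comp[OF klin_tens_left klin_homog_part] 1])
qed

lemma lin_ext_cong: "(\<And>a. a \<in> Poly_Mapping.keys p \<Longrightarrow> f a = g a) \<Longrightarrow> lin_ext f p = lin_ext g p"
  by (simp add: lin_ext_def)

text \<open>A pair of basis elements reaches degree i + j only if both factors have maximal degree;
  on such pairs the leading part of m is m0.\<close>

lemma proj_bilin_ext:
  assumes m: "\<And>a b. m a b \<in> below dg (dg a + dg b)" "\<And>a b. homog_part dg (dg a + dg b) (m a b) = m0 a b"
    and p: "p \<in> below dg i" and q: "q \<in> below dg j"
  shows "homog_part dg (i + j) (bilin_ext m p q) = bilin_ext m0 (homog_part dg i p) (homog_part dg j q)"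
proof -
  have "bilin_ext m0 (homog_part dg i p) (homog_part dg j q) =
      lin_ext (\<lambda>a. lin_ext (\<lambda>b.
        bilin_ext m0 (homog_part dg i (bas a)) (homog_part dg j (bas b))) q) p"
  proof -
    have 1: "bilin_ext m0 (homog_part dg i p) q' =
        lin_ext (\<lambda>a. bilin_ext m0 (homog_part dg i (bas a)) q') p" for q'
      by (rule klin_expand[OF klin_comp[OF klin_bilin_left klin_homog_part]])
    have 2: "bilin_ext m0 p' (homog_part dg j q) =
        lin_ext (\<lambda>b. bilin_ext m0 p' (homog_part dg j (bas b))) q" for p'
      by (rule klin_expand[OF klin_comp[OF klin_bilin_right klin_homog_part]])
    show ?thesis
      by (subst 1) (simp only: 2)
  qed
  also have "\<dots> = lin_ext (\<lambda>a. lin_ext (\<lambda>b. homog_part dg (i + j) (m a b)) q) p"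
  proof (intro lin_ext_cong)
    fix a b assume "a \<in> Poly_Mapping.keys p" "b \<in> Poly_Mapping.keys q"
    then have ab: "dg a \<le> i" "dg b \<le> j"
      using p q by (auto simp: below_def)
    show "bilin_ext m0 (homog_part dg i (bas a)) (homog_part dg j (bas b)) = homog_part dg (i + j) (m a b)"
    proof (cases "dg a = i \<and> dg b = j")
      case True
      then show ?thesis
        using m(2)[of a b] by (simp add: proj_single bilin_ext_bas)
    next
      case False
      then have "dg a + dg b < i + j"
        using ab by auto
      then show ?thesis
        using False by (auto simp: proj_below[OF m(1)] proj_single bilin_ext_simps)
    qed
  qed
  also have "\<dots> = homog_part dg (i + j) (bilin_ext m p q)"
    by (simp add: bilin_ext_alt homog_part_lin_ext)
  finally show ?thesis ..
qed

section \<open>Degrees\<close>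

abbreviation wdeg :: "gen list \<times> t2 \<Rightarrow> nat" where "wdeg \<equiv> \<lambda>(w, h). length w"

fun mdeg :: "mono \<times> mono \<Rightarrow> nat" where "mdeg ((i, j), (k, n)) = i + j + k + n"

abbreviation sdeg :: "(mono \<times> mono) \<times> t2 \<Rightarrow> nat" where "sdeg \<equiv> \<lambda>(q, h). mdeg q"

lemma free_smash_filt_eq: "free_smash_filt n = below wdeg n"
  by (auto simp: free_smash_filt_def below_def)

lemma Ae_smash_comp_eq: "Ae_smash_comp n = homog sdeg n"
  by (auto simp: Ae_smash_comp_def homog_def)

lemma free_prod_below: "p \<in> below length i \<Longrightarrow> q \<in> below length j \<Longrightarrow> p \<odot> q \<in> below length (i + j)"
  by (rule below_bilin_ext) (auto simp: free_mul_def intro: below_single)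

lemma gen_act_below: "gen_act h y \<in> below length 1"
  by (cases h) (auto simp: gen_act_1 gen_act_g gen_act_x gen_act_gx below_single below_neg)

lemma free_act_below: "free_act h w \<in> (below length (length w) :: (gen list \<Rightarrow>\<^sub>0 'k::field) set)"
proof (induction w arbitrary: h)
  case Nil
  then show ?case
    by (cases h) (auto simp: free_act_Nil intro: below_single)
next
  case (Cons y w)
  have "gen_act h y \<odot> free_act h' w \<in> (below length (1 + length w) :: (gen list \<Rightarrow>\<^sub>0 'k) set)" for h h'
    by (intro free_prod_below gen_act_below Cons)
  moreover have "bas [y] \<odot> free_act h' w \<in> (below length (1 + length w) :: (gen list \<Rightarrow>\<^sub>0 'k) set)" for h'
    by (intro free_prod_below Cons below_single) simp
  ultimately show ?case
    by (cases h) (auto simp: free_act_Cons intro!: below_add)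
qed

lemma smash_below:
  assumes m: "\<And>a b. m a b \<in> below dg (dg a + dg b)" and act: "\<And>h a. act h a \<in> below dg (dg a)"
  shows "smash_mul m act (a, h) (b, h') \<in> below (\<lambda>(b, h). dg b) (dg a + dg b)"
  unfolding smash_mul_def prod.case
  by (intro below_lin_ext)
    (auto intro!: below_tens below_bilin_ext[OF m] act below_single)

lemma free_smash_mult_below:
  "p \<in> below wdeg i \<Longrightarrow> q \<in> below wdeg j \<Longrightarrow> bilin_ext (smash_mul free_mul free_act) p q \<in> below wdeg (i + j)"
  by (rule below_bilin_ext)
    (auto intro!: smash_below free_act_below below_single simp: free_mul_def)

lemma deformed_mul_below: "deformed_mul l \<alpha> a b \<in> below mdeg (mdeg a + mdeg b)"
proof -
  obtain i j k n i' j' k' n' where [simp]: "a = ((i, j), (k, n))" "b = ((i', j'), (k', n'))"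
    by (metis surj_pair)
  show ?thesis
    using even_or_odd[of n] even_or_odd[of n'] even_or_odd[of j']
    by (elim exE disjE) (simp_all add: deformed_mul_simps below_add below_diff below_neg below_single)
qed

text \<open>The terms with \<lambda> keep the degree, and those with \<alpha> lower it by 2. Hence
  the leading part is independent of \<alpha>.\<close>

lemma homog_part_deformed_mul:
  "homog_part mdeg (mdeg a + mdeg b) (deformed_mul l \<alpha> a b) = deformed_mul l 0 a b"
proof -
  obtain i j k n i' j' k' n' where [simp]: "a = ((i, j), (k, n))" "b = ((i', j'), (k', n'))"
    by (metis surj_pair)
  show ?thesis
    using even_or_odd[of n] even_or_odd[of n'] even_or_odd[of j']
    by (elim exE disjE)
      (simp_all add: deformed_mul_simps klin_add[OF klin_homog_part] klin_diff[OF klin_homog_part]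
        klin_neg[OF klin_homog_part] proj_single)
qed

lemma Ae_act_homog: "Ae_act h a \<in> homog mdeg (mdeg a)"
  unfolding homog_iff
  by (cases a rule: mdeg.cases; cases h)
    (auto simp: Ae_act_simps klin_add[OF klin_homog_part] klin_0[OF klin_homog_part] proj_single elim!: oddE)

lemma homog_below: "p \<in> homog dg n \<Longrightarrow> p \<in> below dg n"
  by (auto simp: homog_def below_def)

abbreviation "Esmash l \<alpha> \<equiv> smash_mul (deformed_mul l \<alpha>) Ae_act"

lemma Esmash_below: "Esmash l \<alpha> a b \<in> below sdeg (sdeg a + sdeg b)"
  by (cases a; cases b)
    (auto intro!: smash_below deformed_mul_below homog_below[OF Ae_act_homog])

lemma proj_Esmash: "homog_part sdeg (sdeg a + sdeg b) (Esmash l \<alpha> a b) = Esmash l 0 a b"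
proof -
  obtain q h r h' where ab: "a = (q, h)" "b = (r, h')"
    by (metis surj_pair)
  have "homog_part mdeg (mdeg q + mdeg r) (bilin_ext (deformed_mul l \<alpha>) (bas q) (Ae_act h1 r)) =
      bilin_ext (deformed_mul l 0) (bas q) (Ae_act h1 r)" for h1
    using Ae_act_homog[of h1 r]
    by (subst proj_bilin_ext[OF deformed_mul_below homog_part_deformed_mul])
      (auto intro: below_single homog_below simp: homog_iff proj_single)
  then show ?thesis
    by (auto simp: ab smash_mul_def homog_part_lin_ext proj_tens intro!: lin_ext_cong)
qed

lemma Esmash0_homog: "Esmash l 0 a b \<in> homog sdeg (sdeg a + sdeg b)"
  using proj_homog[of sdeg "sdeg a + sdeg b" "Esmash l 0 a b"] by (simp only: proj_Esmash)

interpretation deformed: t2_module_algebra "deformed_mul l \<alpha>" 0 Ae_act for l \<alpha> :: "'k::field"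
  by (rule t2_module_algebra_deformed)

lemma eval_gen: "ev l \<alpha> (bas [y]) = Ae_gen y"
  by (simp add: ev_def del: single_one)

lemma eval_gen_act:
  "ev l \<alpha> (gen_act Tg y) = lin_ext (Ae_act Tg) (Ae_gen y)"
  "ev l \<alpha> (gen_act Tx y) = lin_ext (Ae_act Tx) (Ae_gen y)"
  "lin_ext (Ae_act Tg) (lin_ext (Ae_act Tx) (Ae_gen y)) = lin_ext (Ae_act Tx) (Ae_gen y)"
proof -
  consider "y = gu" | "y = gv" | "y = gu'" | "y = gv'"
    by (metis sum.exhaust var.exhaust)
  then show "ev l \<alpha> (gen_act Tg y) = lin_ext (Ae_act Tg) (Ae_gen y)"
    "ev l \<alpha> (gen_act Tx y) = lin_ext (Ae_act Tx) (Ae_gen y)"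
    "lin_ext (Ae_act Tg) (lin_ext (Ae_act Tx) (Ae_gen y)) = lin_ext (Ae_act Tx) (Ae_gen y)"
    by (cases; simp add: gen_act_g gen_act_x klin_0[OF klin_ev] klin_neg[OF klin_ev] eval_gen
        zero_prod_def Ae_act_simps single_uminus)+
qed

lemma eval_act_bas: "ev l \<alpha> (free_act h w) = lin_ext (Ae_act h) (ev l \<alpha> (bas w))"
proof (induction w arbitrary: h)
  case Nil
  then show ?case
    by (cases h)
      (simp_all add: free_act_Nil klin_0[OF klin_ev],
       simp_all add: ev_def deformed.act_g_unit deformed.act_x_unit deformed.act_1_bas del: single_one)
next
  case (Cons y w)
  have "ev l \<alpha> (bas (y # w)) = bilin_ext (deformed_mul l \<alpha>) (Ae_gen y) (ev l \<alpha> (bas w))"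
    by (simp add: ev_def)
  then show ?case
    by (cases h)
      (simp_all add: free_act_Cons eval_mult klin_add[OF klin_ev] eval_gen_act eval_gen Cons)
qed

lemma eval_act: "ev l \<alpha> (lin_ext (free_act h) p) = lin_ext (Ae_act h) (ev l \<alpha> p)"
  by (rule klin_eqI[where p = p, OF klin_comp[OF klin_ev klin_lin_ext] klin_comp[OF klin_lin_ext klin_ev]])
    (simp add: eval_act_bas)

abbreviation fs_prod (infixr "\<oslash>" 70) where "p \<oslash> q \<equiv> bilin_ext (smash_mul free_mul free_act) p q"

section \<open>The quotient as a deformed smash product\<close>

text \<open>This is \<open>ev\<close> tensored with the identity of T(2).\<close>

definition Psi :: "'k::field \<Rightarrow> 'k \<Rightarrow> (gen list \<times> t2 \<Rightarrow>\<^sub>0 'k) \<Rightarrow> ((mono \<times> mono) \<times> t2 \<Rightarrow>\<^sub>0 'k)" where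
  "Psi l \<alpha> = lin_ext (\<lambda>(w, h). tens (ev l \<alpha> (bas w)) (bas h))"

lemma klin_Psi: "klin (Psi l \<alpha>)"
  unfolding Psi_def by (rule klin_lin_ext)

lemma klin_tens_eqI:
  assumes "klin f" "klin g" "\<And>b h. f (tens (bas b) (bas h)) = g (tens (bas b) (bas h))"
  shows "f p = g p"
  by (rule klin_eqI[where p = p, OF assms(1,2)]) (use assms(3) in \<open>auto simp: tens_bas\<close>)

lemma Psi_tens: "Psi l \<alpha> (tens p q) = tens (ev l \<alpha> p) q"
proof -
  have 1: "Psi l \<alpha> (tens (bas w) q) = tens (ev l \<alpha> (bas w)) q" for w
    by (rule klin_eqI[where p = q, OF klin_comp[OF klin_Psi klin_tens_right] klin_tens_right])
      (simp add: Psi_def tens_bas)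
  show ?thesis
    by (rule klin_eqI[where p = p, OF klin_comp[OF klin_Psi klin_tens_left]
          klin_comp[OF klin_tens_left klin_ev] 1])
qed

text \<open>The smash product uses the product and the action of the first factor, and
  \<open>ev\<close> respects both by \<open>eval_mult\<close> and \<open>eval_act\<close>.\<close>

lemma Psi_mult: "Psi l \<alpha> (p \<oslash> q) = bilin_ext (Esmash l \<alpha>) (Psi l \<alpha> p) (Psi l \<alpha> q)"
proof -
  have 1: "Psi l \<alpha> (tens p (bas h) \<oslash> tens q (bas h')) =
    bilin_ext (Esmash l \<alpha>) (Psi l \<alpha> (tens p (bas h))) (Psi l \<alpha> (tens q (bas h')))" for p q h h'
  proof -
    have "Psi l \<alpha> (lin_ext f r) = lin_ext (\<lambda>x. Psi l \<alpha> (f x)) r" for r :: "t2 \<times> t2 \<Rightarrow>\<^sub>0 'a" and f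
      using klin_expand[OF klin_comp[OF klin_Psi klin_lin_ext], of l \<alpha> f r] by simp
    then show ?thesis
      by (auto simp: free.smash_tens deformed.smash_tens Psi_tens eval_mult eval_act intro!: lin_ext_cong)
  qed
  have 2: "Psi l \<alpha> (tens (bas w) (bas h) \<oslash> q) =
    bilin_ext (Esmash l \<alpha>) (Psi l \<alpha> (tens (bas w) (bas h))) (Psi l \<alpha> q)" for w h
    by (rule klin_tens_eqI[where p = q, OF klin_comp[OF klin_Psi klin_bilin_right]
          klin_comp[OF klin_bilin_right klin_Psi] 1])
  show ?thesis
    by (rule klin_tens_eqI[where p = p, OF klin_comp[OF klin_Psi klin_bilin_left]
          klin_comp[OF klin_bilin_left klin_Psi] 2])
qed

definition normal_smash :: "'k::field \<Rightarrow> ((mono \<times> mono) \<times> t2 \<Rightarrow>\<^sub>0 'k) \<Rightarrow> (gen list \<times> t2 \<Rightarrow>\<^sub>0 'k)" where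
  "normal_smash l = lin_ext (\<lambda>(q, h). tens (normal_form l q) (bas h))"

lemma klin_normal_smash: "klin (normal_smash l)"
  unfolding normal_smash_def by (rule klin_lin_ext)

lemma normal_smash_tens: "normal_smash l (tens p (bas h)) = tens (lin_ext (normal_form l) p) (bas h)"
  by (rule klin_eqI[where p = p, OF klin_comp[OF klin_normal_smash klin_tens_left]
        klin_comp[OF klin_tens_left klin_lin_ext]])
    (simp add: normal_smash_def tens_bas)

lemma Psi_normal_smash: "Psi l \<alpha> (normal_smash l p) = p"
  by (rule klin_eqI[where p = p, OF klin_comp[OF klin_Psi klin_normal_smash] klin_ident])
    (auto simp: normal_smash_def Psi_tens eval_normal tens_bas)

lemma sq_pow_below: "sq_pow l n \<in> below length (2 * n)"
proof (induction n)
  case (Suc n)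
  have "sq_elem l \<in> below length 2"
    by (simp add: sq_elem_def below_diff below_single)
  then show ?case
    using free_prod_below[OF _ Suc, of "sq_elem l" 2] by simp
qed (simp add: below_single)

lemma normal_below: "normal_form l q \<in> below length (mdeg q)"
proof -
  obtain i j k n where q: "q = ((i, j), (k, n))"
    by (metis surj_pair)
  have pw: "pw y i \<in> below length i" for y i
    by (simp add: below_single)
  have "normal_form l q \<in> below length (i + (j + (k + (n mod 2 + 2 * (n div 2)))))"
    unfolding q normal_form_def prod.case by (intro free_prod_below pw sq_pow_below)
  then show ?thesis
    by (simp add: q add.assoc)
qed

lemma normal_smash_below: "p \<in> below sdeg n \<Longrightarrow> normal_smash l p \<in> below wdeg n"
  unfolding normal_smash_def
  by (rule below_lin_ext) (auto simp: below_def[of sdeg] intro!: below_tens below_mono[OF normal_below])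

lemma eval_bas_below: "ev l \<alpha> (bas w) \<in> below mdeg (length w)"
proof (induction w)
  case Nil
  show ?case
    by (simp add: ev_def below_single zero_prod_def del: single_one)
next
  case (Cons y w)
  have "Ae_gen y \<in> below mdeg 1"
    by (cases y rule: Ae_gen.cases; cases "projl y"; cases "projr y")
      (auto simp: zero_prod_def intro!: below_single)
  then have "bilin_ext (deformed_mul l \<alpha>) (Ae_gen y) (ev l \<alpha> (bas w)) \<in> below mdeg (1 + length w)"
    by (intro below_bilin_ext deformed_mul_below Cons)
  then show ?case
    by (simp add: ev_def)
qed

lemma Psi_below: "p \<in> below wdeg n \<Longrightarrow> Psi l \<alpha> p \<in> below sdeg n"
  unfolding Psi_def
  by (rule below_lin_ext) (auto simp: below_def[of wdeg] intro!: below_tens below_mono[OF eval_bas_below])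

lemma free_smash_alg: "free_smash = alg_of (smash_mul free_mul free_act) ([], T1)"
  by (simp add: free_smash_def)

lemma filtered_quotient_def_ideal:
  "filtered_quotient (smash_mul free_mul free_act) ([], T1) (def_ideal l \<kappa>) free_smash_filt"
proof (intro filtered_quotient.intro sc_ideal.intro sc_ideal_axioms.intro filtered_quotient_axioms.intro)
  show "sc_algebra (smash_mul free_mul free_act) ([], T1)"
    by (rule free.smash.sc_algebra_axioms)
  then show "ideal (def_ideal l \<kappa>) (alg_of (smash_mul free_mul free_act) ([], T1))"
    unfolding def_ideal_def free_smash_alg by (rule ideal_Idl)
qed (auto simp: free_smash_filt_eq below_add below_scl below_single
      intro: below_mono free_smash_mult_below)

lemma def_ideal_mem: "r \<in> rels l \<Longrightarrow> tens r (bas T1) - tens (bas []) (\<kappa> r) \<in> def_ideal l \<kappa>"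
  unfolding def_ideal_def free_smash_alg by (rule Idl_mem[OF free.smash.sc_algebra_axioms]) auto

lemma filt_eq:
  "def_filt l \<kappa> n = filtered_quotient.F (smash_mul free_mul free_act) ([], T1) (def_ideal l \<kappa>) free_smash_filt n"
  by (simp add: def_filt_def filtered_quotient.F_def[OF filtered_quotient_def_ideal] free_smash_alg)

context
  fixes l \<alpha> :: "'k::field" and \<kappa>
  assumes \<kappa>: "scalar_at_4 l \<alpha> \<kappa>"
begin

interpretation filtered_quotient "smash_mul free_mul free_act" "([], T1)" "def_ideal l \<kappa>" free_smash_filt
  by (rule filtered_quotient_def_ideal)

lemma kappa_rel:
  "\<kappa> (rel l (Suc 0)) = 0" "\<kappa> (rel l 2) = 0" "\<kappa> (rel l 3) = 0" "\<kappa> (rel l 4) = scl \<alpha> (bas T1)"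
  "\<kappa> (rel l 5) = 0" "\<kappa> (rel l 6) = 0"
  using \<kappa> by (auto simp: scalar_at_4_def)

lemma def_ideal_subset_kernel: "def_ideal l \<kappa> \<subseteq> {p. Psi l \<alpha> p = 0}"
  unfolding def_ideal_def free_smash_alg
proof (rule Idl_minimal[OF free.smash.sc_algebra_axioms free.smash.sc_ideal_kernel[OF klin_Psi Psi_mult]])
  have "ev l \<alpha> (bas []) = bas 0"
    by (simp add: ev_def del: single_one)
  then show "(\<lambda>r. tens r (bas T1) - tens (bas []) (\<kappa> r)) ` rels l \<subseteq> {p. Psi l \<alpha> p = 0}"
    by (auto simp: rels_eq klin_diff[OF klin_Psi] klin_scale[OF klin_Psi] Psi_tens eval_rel kappa_rel
        tens_simps simp del: single_one scl_single)
qed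

text \<open>The map sending p to p \<otimes> 1 is multiplicative from the free algebra to its smash
  product, so the ideal pulls back to an ideal. The values of \<kappa> are scalars by assumption, so
  the relations themselves pull back as well and rewriting can be done without T(2).\<close>

lemma deformed_rels_preimage: "deformed_rels {p. tens p (bas T1) \<in> def_ideal l \<kappa>} l \<alpha>"
proof (intro deformed_rels.intro deformed_rels_axioms.intro sc_ideal.intro sc_ideal_axioms.intro)
  show "sc_algebra free_mul []"
    by (rule free.sc_algebra_axioms)
  let ?J = "{p. tens p (bas T1) \<in> def_ideal l \<kappa>}"
  have mult: "tens (p \<odot> q) (bas T1) = tens p (bas T1) \<oslash> tens q (bas T1)" for p q :: "gen list \<Rightarrow>\<^sub>0 'k"
    by (simp add: free.smash_tens)
  show "ideal ?J (alg_of free_mul [])"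
  proof (rule idealI[OF free.ring_alg_of])
    interpret R: ring "alg_of free_mul []"
      by (rule free.ring_alg_of)
    show "subgroup ?J (add_monoid (alg_of free_mul []))"
    proof (rule R.add.subgroupI)
      fix p assume p: "p \<in> ?J"
      have "\<ominus>\<^bsub>alg_of free_mul []\<^esub> p = - p"
        by (rule R.add.inv_equality) simp_all
      then show "\<ominus>\<^bsub>alg_of free_mul []\<^esub> p \<in> ?J"
        using p J_neg by (simp add: tens_simps)
    next
      show "?J \<noteq> {}"
        using J_0 by (auto simp: tens_simps intro!: exI[of _ 0])
    qed (auto simp: tens_simps intro: J_add)
  qed (auto simp: mult intro: J_left J_right)
  show "rel l i \<in> ?J" if "i \<in> {1..6}" "i \<noteq> 4" for i
  proof -
    have "rel l i \<in> rels l" "\<kappa> (rel l i) = 0"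
      using that \<kappa> by (auto simp: rels_def scalar_at_4_def)
    then show ?thesis
      using def_ideal_mem[of "rel l i" l \<kappa>] by (simp add: tens_simps)
  qed
  show "rel l 4 - scl \<alpha> (bas []) \<in> ?J"
    using def_ideal_mem[of "rel l 4" l \<kappa>]
    by (simp add: rels_eq kappa_rel tens_simps tens_bas del: scl_single)
qed

lemma cong_normal_smash: "p - normal_smash l (Psi l \<alpha> p) \<in> def_ideal l \<kappa>"
proof -
  interpret R: deformed_rels "{p. tens p (bas T1) \<in> def_ideal l \<kappa>}" l \<alpha>
    by (rule deformed_rels_preimage)
  have "tens p (bas h) - normal_smash l (Psi l \<alpha> (tens p (bas h))) \<in> def_ideal l \<kappa>" for p h
  proof -
    \<comment> \<open>Right multiplication by 1 \<otimes> h restores the T(2) factor.\<close>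
    have mem: "tens (p - lin_ext (normal_form l) (ev l \<alpha> p)) (bas T1) \<oslash> tens (bas []) (bas h) \<in> def_ideal l \<kappa>"
      using R.cong_normal_eval[of p] by (intro J_right) (simp add: R.cong_J_def)
    have unit: "tens q (bas T1) \<oslash> tens (bas []) (bas h) = tens q (bas h)" for q :: "gen list \<Rightarrow>\<^sub>0 'k"
      by (simp add: free.smash_tens free_act_Nil)
    from mem show ?thesis
      unfolding unit by (simp only: Psi_tens normal_smash_tens tens_simps)
  qed
  then have basis: "bas b - normal_smash l (Psi l \<alpha> (bas b)) \<in> def_ideal l \<kappa>" for b
    by (cases b) (metis mult_1 tens_bas)
  show ?thesis
    by (rule klin_in_J[of "\<lambda>p. p - normal_smash l (Psi l \<alpha> p)",
          OF klin_diff_fun[OF klin_ident klin_comp[OF klin_normal_smash klin_Psi]] basis])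
qed

text \<open>If the part of degree n vanishes, the image under \<open>Psi\<close> has smaller degree,
  and its normal form is a representative of p in the previous filtration step. For n = 0 that step
  is {0}, and the image itself is 0.\<close>

lemma proj_Psi_eq_0_iff:
  assumes "p \<in> free_smash_filt n"
  shows "homog_part sdeg n (Psi l \<alpha> p) = 0 \<longleftrightarrow> p \<in> lower n"
proof
  assume proj: "homog_part sdeg n (Psi l \<alpha> p) = 0"
  have below: "Psi l \<alpha> p \<in> below sdeg n"
    using assms by (simp add: free_smash_filt_eq Psi_below)
  have neq: "sdeg b \<noteq> n" if "b \<in> Poly_Mapping.keys (Psi l \<alpha> p)" for b
    using that lookup_proj[of sdeg n "Psi l \<alpha> p" b] proj by (auto simp: in_keys_iff)
  have "normal_smash l (Psi l \<alpha> p) \<in> FP n"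
  proof (cases n)
    case 0
    then have "Poly_Mapping.keys (Psi l \<alpha> p) = {}"
      using below neq by (simp only: below_def le_zero_eq mem_Collect_eq) blast
    then show ?thesis
      by (simp add: 0 FP_def klin_0[OF klin_normal_smash])
  next
    case (Suc k)
    then have "Psi l \<alpha> p \<in> below sdeg k"
      using below neq by (force simp: below_def le_Suc_eq)
    then show ?thesis
      by (simp add: Suc FP_def free_smash_filt_eq normal_smash_below)
  qed
  then show "p \<in> lower n"
    using cong_normal_smash[of p] by (auto simp: lower_def)
next
  assume "p \<in> lower n"
  then obtain f where f: "f \<in> FP n" "p - f \<in> def_ideal l \<kappa>"
    by (auto simp: lower_def)
  then have "Psi l \<alpha> p = Psi l \<alpha> f"
    using def_ideal_subset_kernel by (auto simp: klin_diff[OF klin_Psi])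
  moreover have "homog_part sdeg n (Psi l \<alpha> f) = 0"
    using f(1) by (cases n)
      (auto simp: FP_def klin_0[OF klin_Psi] klin_0[OF klin_homog_part] free_smash_filt_eq
        intro: proj_below[OF Psi_below])
  ultimately show "homog_part sdeg n (Psi l \<alpha> p) = 0"
    by simp
qed

lemma PBW_if_scalar:
  assumes "CHAR('k) \<noteq> 2"
  shows "PBW_deformation l \<kappa>"
proof -
  \<comment> \<open>The symbol of p in degree n is the part of degree n of its image in the deformed
    smash product, where leading parts multiply as for \<alpha> = 0.\<close>
  have "symbol_maps (smash_mul free_mul free_act) ([], T1) (def_ideal l \<kappa>) free_smash_filt
    (Esmash l 0) (0, T1) sdeg (\<lambda>n p. homog_part sdeg n (Psi l \<alpha> p))"
  proof (intro symbol_maps.intro symbol_maps_axioms.intro filtered_quotient_def_ideal)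
    show "Esmash l 0 a b \<in> homog sdeg (sdeg a + sdeg b)" for a b
      by (rule Esmash0_homog)
    show "sdeg (0, T1) = 0"
      by (simp add: zero_prod_def)
    show "klin (\<lambda>p. homog_part sdeg n (Psi l \<alpha> p))" for n
      by (rule klin_comp[OF klin_homog_part klin_Psi])
    show "(\<lambda>p. homog_part sdeg n (Psi l \<alpha> p)) ` free_smash_filt n = homog sdeg n" for n
    proof (intro equalityI subsetI)
      fix t :: "(mono \<times> mono) \<times> t2 \<Rightarrow>\<^sub>0 'k" assume t: "t \<in> homog sdeg n"
      then have "normal_smash l t \<in> free_smash_filt n"
        by (simp add: free_smash_filt_eq normal_smash_below homog_below)
      moreover have "homog_part sdeg n (Psi l \<alpha> (normal_smash l t)) = t"
        using t by (simp add: Psi_normal_smash homog_iff)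
      ultimately show "t \<in> (\<lambda>p. homog_part sdeg n (Psi l \<alpha> p)) ` free_smash_filt n"
        by force
    qed (auto simp: proj_homog)
    show "homog_part sdeg (i + j) (Psi l \<alpha> (p \<oslash> q)) =
        bilin_ext (Esmash l 0) (homog_part sdeg i (Psi l \<alpha> p)) (homog_part sdeg j (Psi l \<alpha> q))"
      if "p \<in> free_smash_filt i" "q \<in> free_smash_filt j" for p q i j
      unfolding Psi_mult
      using that by (intro proj_bilin_ext Esmash_below proj_Esmash Psi_below) (simp_all add: free_smash_filt_eq)
    show "homog_part sdeg 0 (Psi l \<alpha> (bas ([], T1))) = bas (0, T1)"
      by (simp add: Psi_def ev_def tens_bas proj_single zero_prod_def del: single_one)
  qed (rule proj_Psi_eq_0_iff)
  from symbol_maps.graded_iso[OF this] show ?thesis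
    by (simp add: PBW_deformation_def def_alg_def free_smash_alg filt_eq[abs_def] Ae_smash_def
        Ae_mul_eq[OF assms] Ae_smash_comp_eq[abs_def])
qed

end

section \<open>Dimension count in degrees 0 and 1\<close>

lemma independent_bas: "finite T \<Longrightarrow> scl.vs1.independent (bas ` T)"
proof -
  assume T: "finite T"
  have "u (bas b) = 0" if "(\<Sum>v\<in>bas ` T. scl (u v) v) = 0" "b \<in> T" for u :: "('a \<Rightarrow>\<^sub>0 'b) \<Rightarrow> 'b" and b
  proof -
    have "inj_on (bas :: 'a \<Rightarrow> ('a \<Rightarrow>\<^sub>0 'b)) T"
      by (rule inj_onI) (metis lookup_single_eq lookup_single_not_eq zero_neq_one)
    then have "(\<Sum>v\<in>bas ` T. scl (u v) v) = (\<Sum>c\<in>T. scl (u (bas c)) (bas c))"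
      by (simp add: sum.reindex)
    then have "Poly_Mapping.lookup (\<Sum>c\<in>T. scl (u (bas c)) (bas c)) b = 0"
      using that(1) by simp
    then show ?thesis
      using that(2) T by (simp add: lookup_sum lookup_single when_def)
  qed
  then show ?thesis
    using T by (subst scl.vs1.dependent_finite) auto
qed

text \<open>A nonzero kernel element makes one of the vectors g b redundant. The independent vectors
  indexed by T would then lie in the span of fewer than \<open>card T\<close> vectors.\<close>

lemma lin_ext_eq_0_imp_0:
  fixes g :: "'a \<Rightarrow> ('b \<Rightarrow>\<^sub>0 'k::field)"
  assumes fin: "finite S" "finite T" "card S \<le> card T"
    and surj: "bas ` T \<subseteq> lin_ext g ` {p. Poly_Mapping.keys p \<subseteq> S}"
    and p: "Poly_Mapping.keys p \<subseteq> S" "lin_ext g p = 0"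
  shows "p = 0"
proof (rule ccontr)
  assume "p \<noteq> 0"
  then obtain b where b: "Poly_Mapping.lookup p b \<noteq> 0"
    by (metis lookup_zero poly_mapping_eqI)
  then have bS: "b \<in> S"
    using p by (auto simp: in_keys_iff)
  let ?V = "scl.vs1.span (g ` (S - {b}))"
  have "lin_ext g p = scl (Poly_Mapping.lookup p b) (g b) + (\<Sum>a\<in>S - {b}. scl (Poly_Mapping.lookup p a) (g a))"
    using lin_ext_superset[OF fin(1) p(1), of g] fin bS by (simp add: sum.remove)
  then have "scl (Poly_Mapping.lookup p b) (g b) = - (\<Sum>a\<in>S - {b}. scl (Poly_Mapping.lookup p a) (g a))"
    using p by (simp add: eq_neg_iff_add_eq_0)
  also have "\<dots> \<in> ?V"
    by (intro scl.vs1.span_neg scl.vs1.span_sum scl.vs1.span_scale scl.vs1.span_base imageI)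
  finally have "scl (inverse (Poly_Mapping.lookup p b)) (scl (Poly_Mapping.lookup p b) (g b)) \<in> ?V"
    by (rule scl.vs1.span_scale)
  then have gb: "g b \<in> ?V"
    using b by simp
  have gS: "g a \<in> ?V" if "a \<in> S" for a
    using that gb by (cases "a = b") (auto intro: scl.vs1.span_base)
  have "bas ` T \<subseteq> ?V"
  proof
    fix t :: "'b \<Rightarrow>\<^sub>0 'k" assume "t \<in> bas ` T"
    then obtain q where q: "t = lin_ext g q" "Poly_Mapping.keys q \<subseteq> S"
      using surj by auto
    then show "t \<in> ?V"
      unfolding q lin_ext_def by (intro scl.vs1.span_sum scl.vs1.span_scale gS) auto
  qed
  moreover have "finite (g ` (S - {b}))"
    using fin by simp
  ultimately have "card (bas ` T :: ('b \<Rightarrow>\<^sub>0 'k) set) \<le> card (g ` (S - {b}))"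
    using scl.vs1.independent_span_bound[OF _ independent_bas[OF fin(2)]] by blast
  also have "\<dots> \<le> card (S - {b})"
    using fin by (simp add: card_image_le)
  also have "\<dots> < card S"
    using fin bS by (intro card_Diff1_less)
  also have "\<dots> \<le> card T"
    by (rule fin)
  also have "\<dots> = card (bas ` T :: ('b \<Rightarrow>\<^sub>0 'k) set)"
    by (rule card_image[symmetric], rule inj_onI) (metis lookup_single_eq lookup_single_not_eq zero_neq_one)
  finally show False
    by simp
qed

context filtered_quotient
begin

text \<open>\<tau> sends p to the image of its class placed in degree n. It is linear only on
  \<open>FF n\<close>, where the class belongs to the graded algebra.\<close>

lemma graded_iso_imp_symbols:
  fixes m' :: "'c \<Rightarrow> 'c \<Rightarrow> ('c \<Rightarrow>\<^sub>0 'k)"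
  assumes "graded_iso G (gr_alg_comp D F) (alg_of m' e') T"
  obtains \<tau> where "\<And>p q. p \<in> FF n \<Longrightarrow> q \<in> FF n \<Longrightarrow> \<tau> (p + q) = \<tau> p + \<tau> q"
    and "\<And>p c. p \<in> FF n \<Longrightarrow> \<tau> (scl c p) = scl c (\<tau> p)"
    and "\<tau> ` FF n = T n" and "\<And>p. p \<in> FF n \<Longrightarrow> p \<in> lower n \<Longrightarrow> \<tau> p = 0"
proof -
  obtain \<phi> where hom: "\<phi> \<in> alg_hom G (alg_of m' e')" and img: "\<phi> ` gr_alg_comp D F n = T n"
    using assms by (auto simp: graded_iso_def)
  define s where "s p = (\<lambda>i. cls i (if i = n then p else 0))" for p
  have carrier: "s p \<in> carrier G" if "p \<in> FF n" for p
    using that unfolding s_def using gr_alg_comp_eq[of n] by (auto simp: gr_alg_comp_def)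
  have add: "\<phi> (c \<oplus>\<^bsub>G\<^esub> d) = \<phi> c + \<phi> d" if "c \<in> carrier G" "d \<in> carrier G" for c d
    using hom that by (auto simp: alg_hom_def ring_hom_def)
  have scl: "\<phi> (a \<odot>\<^bsub>G\<^esub> c) = scl a (\<phi> c)" if "c \<in> carrier G" for a c
    using hom that by (auto simp: alg_hom_def)
  have s_add: "s (p + q) = s p \<oplus>\<^bsub>G\<^esub> s q" for p q
    unfolding s_def gr_add by (rule ext) simp
  have s_scl: "s (scl c p) = c \<odot>\<^bsub>G\<^esub> s p" for c p
    unfolding s_def gr_smult by (rule ext) simp
  have add': "\<phi> (s (p + q)) = \<phi> (s p) + \<phi> (s q)" if "p \<in> FF n" "q \<in> FF n" for p q
    using that by (simp add: s_add add carrier)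
  have scl': "\<phi> (s (scl c p)) = scl c (\<phi> (s p))" if "p \<in> FF n" for p c
    using that by (simp add: s_scl scl carrier)
  have "\<phi> (s p) = 0" if "p \<in> lower n" for p
  proof -
    have "cls n p = cls n 0"
      using that by (simp add: cls_eq_iff)
    \<comment> \<open>The zero element is written as a scalar multiple so that homogeneity of \<phi>
      yields the value 0.\<close>
    then have "s p = s (scl 0 0)"
      by (auto simp: s_def fun_eq_iff)
    then show ?thesis
      using scl'[of 0 0] by (simp add: FF_0)
  qed
  moreover have "(\<lambda>p. \<phi> (s p)) ` FF n = T n"
    using img unfolding gr_alg_comp_eq s_def by (simp add: image_image)
  ultimately show ?thesis
    using add' scl' by (intro that[of "\<lambda>p. \<phi> (s p)"]) auto
qed

text \<open>S spans \<open>FF n\<close> modulo \<open>FP n\<close>, and the target contains at least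
  as many independent elements of degree n. So S stays independent in the graded piece, and an
  element of J, whose symbol is 0, has no component along S.\<close>

lemma J_trivial_of_dim:
  fixes m' :: "'c \<Rightarrow> 'c \<Rightarrow> ('c \<Rightarrow>\<^sub>0 'k)"
  assumes iso: "graded_iso G (gr_alg_comp D F) (alg_of m' e') T"
    and fin: "finite S" "finite S'" "card S \<le> card S'"
    and S: "\<And>b. b \<in> S \<Longrightarrow> bas b \<in> FF n" and T: "\<And>b. b \<in> S' \<Longrightarrow> bas b \<in> T n"
    and decomp: "\<And>p. p \<in> FF n \<Longrightarrow> \<exists>q\<in>FP n. Poly_Mapping.keys (p - q) \<subseteq> S"
    and p: "p \<in> J" "p \<in> FF n"
  shows "p \<in> FP n"
proof -
  obtain \<tau> where add: "\<And>p q. p \<in> FF n \<Longrightarrow> q \<in> FF n \<Longrightarrow> \<tau> (p + q) = \<tau> p + \<tau> q"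
    and scl: "\<And>p c. p \<in> FF n \<Longrightarrow> \<tau> (scl c p) = scl c (\<tau> p)"
    and img: "\<tau> ` FF n = T n" and low: "\<And>p. p \<in> FF n \<Longrightarrow> p \<in> lower n \<Longrightarrow> \<tau> p = 0"
    using graded_iso_imp_symbols[OF iso, of n] by metis
  \<comment> \<open>f is linear everywhere and agrees with \<tau> on the span of S.\<close>
  define f where "f = lin_ext (\<lambda>b. \<tau> (bas b))"
  have sum_FF: "sum h A \<in> FF n \<and> \<tau> (sum h A) = (\<Sum>a\<in>A. \<tau> (h a))"
    if "\<And>a. a \<in> A \<Longrightarrow> h a \<in> FF n" for A and h :: "'b \<Rightarrow> _"
    using that by (induction A rule: infinite_finite_induct) (auto simp: FF_0 FF_add add low lower_0)
  have f: "\<tau> q = f q" "q \<in> FF n" if "Poly_Mapping.keys q \<subseteq> S" for q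
  proof -
    have "q = (\<Sum>b\<in>Poly_Mapping.keys q. scl (Poly_Mapping.lookup q b) (bas b))"
      using lin_ext_bas[of q] by (simp only: lin_ext_def)
    moreover have "scl (Poly_Mapping.lookup q b) (bas b) \<in> FF n" if "b \<in> Poly_Mapping.keys q" for b
      using that \<open>Poly_Mapping.keys q \<subseteq> S\<close> by (intro FF_scl S) auto
    ultimately have "q \<in> FF n \<and> \<tau> q = (\<Sum>b\<in>Poly_Mapping.keys q. \<tau> (scl (Poly_Mapping.lookup q b) (bas b)))"
      using sum_FF[of "Poly_Mapping.keys q" "\<lambda>b. scl (Poly_Mapping.lookup q b) (bas b)"] by simp
    moreover have "\<tau> (scl (Poly_Mapping.lookup q b) (bas b)) = scl (Poly_Mapping.lookup q b) (\<tau> (bas b))"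
      if "b \<in> Poly_Mapping.keys q" for b
      using that \<open>Poly_Mapping.keys q \<subseteq> S\<close> by (intro scl S) auto
    ultimately show "\<tau> q = f q" "q \<in> FF n"
      by (simp_all add: f_def lin_ext_def)
  qed
  have split: "\<exists>r\<in>FP n. Poly_Mapping.keys (q - r) \<subseteq> S \<and> \<tau> q = f (q - r)" if q: "q \<in> FF n" for q
  proof -
    obtain r where r: "r \<in> FP n" "Poly_Mapping.keys (q - r) \<subseteq> S"
      using decomp[OF q] by auto
    have "\<tau> ((q - r) + r) = \<tau> (q - r) + \<tau> r"
      using r FP_subset f by (intro add) auto
    moreover have "\<tau> r = 0"
      using r FP_subset[of n] by (intro low FP_lower) auto
    ultimately show ?thesis
      using r f[OF r(2)] by auto
  qed
  have surj: "bas ` S' \<subseteq> f ` {p. Poly_Mapping.keys p \<subseteq> S}"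
  proof
    fix t :: "'c \<Rightarrow>\<^sub>0 'k" assume "t \<in> bas ` S'"
    then have "t \<in> \<tau> ` FF n"
      using T img by auto
    then show "t \<in> f ` {p. Poly_Mapping.keys p \<subseteq> S}"
      using split by force
  qed
  obtain r where r: "r \<in> FP n" "Poly_Mapping.keys (p - r) \<subseteq> S" "\<tau> p = f (p - r)"
    using split[OF p(2)] by auto
  have "p - r = 0"
    using r low[OF p(2) J_lower[OF p(1)]]
    by (intro lin_ext_eq_0_imp_0[OF fin surj[unfolded f_def] r(2)]) (simp add: f_def)
  then show ?thesis
    using r by simp
qed

end

lemma keys_diff_restrict:
  fixes p :: "'b \<Rightarrow>\<^sub>0 'k::field"
  shows "\<exists>q. Poly_Mapping.keys q \<subseteq> Poly_Mapping.keys p - S \<and> Poly_Mapping.keys (p - q) \<subseteq> S"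
proof (intro exI conjI)
  let ?q = "lin_ext (\<lambda>b. if b \<in> S then 0 else bas b) p"
  have *: "Poly_Mapping.lookup ?q b = (if b \<in> S then 0 else Poly_Mapping.lookup p b)" for b
  proof -
    have "Poly_Mapping.lookup ?q b = (\<Sum>a\<in>Poly_Mapping.keys p.
        if a = b then (if b \<in> S then 0 else Poly_Mapping.lookup p b) else 0)"
      unfolding lin_ext_def lookup_sum by (intro sum.cong refl) (auto simp: lookup_single when_def)
    then show ?thesis
      by (auto simp: in_keys_iff)
  qed
  show "Poly_Mapping.keys ?q \<subseteq> Poly_Mapping.keys p - S" "Poly_Mapping.keys (p - ?q) \<subseteq> S"
    by (auto simp: in_keys_iff * lookup_minus split: if_splits)
qed

lemma t2_UNIV: "(UNIV :: t2 set) = {T1, Tg, Tx, Tgx}"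
  using t2.exhaust by auto

text \<open>The count is made twice: 4 generators times dim T(2) in degree 1 puts p into degree 0,
  and dim T(2) in degree 0 then gives p = 0.\<close>

lemma def_ideal_trivial_below_1:
  fixes l :: "'k::field"
  assumes char: "CHAR('k) \<noteq> 2" and pbw: "PBW_deformation l \<kappa>"
    and p: "p \<in> def_ideal l \<kappa>" "p \<in> below wdeg 1"
  shows "p = 0"
proof -
  interpret filtered_quotient "smash_mul free_mul free_act" "([], T1)" "def_ideal l \<kappa>" free_smash_filt
    by (rule filtered_quotient_def_ideal)
  have iso: "graded_iso G (gr_alg_comp D F) (alg_of (Esmash l 0) (0, T1)) (homog sdeg)"
    using pbw by (simp add: PBW_deformation_def def_alg_def free_smash_alg filt_eq[abs_def] Ae_smash_def
        Ae_mul_eq[OF char] Ae_smash_comp_eq[abs_def])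
  let ?H = "UNIV :: t2 set"
  let ?W = "{[gu], [gv], [gu'], [gv']}"
  let ?Q = "{((1, 0), (0, 0)), ((0, 1), (0, 0)), ((0, 0), (1, 0)), ((0, 0), (0, 1))} :: (mono \<times> mono) set"
  have finH: "finite ?H"
    by (simp add: t2_UNIV)
  have "p \<in> FP 1"
  proof (rule J_trivial_of_dim[OF iso, of "?W \<times> ?H" "?Q \<times> ?H"])
    show "finite (?W \<times> ?H)" "finite (?Q \<times> ?H)"
      using finH by auto
    show "card (?W \<times> ?H) \<le> card (?Q \<times> ?H)"
      by (simp add: card_cartesian_product)
    show "bas b \<in> free_smash_filt 1" if "b \<in> ?W \<times> ?H" for b
      using that by (auto simp: free_smash_filt_eq intro: below_single)
    show "bas b \<in> homog sdeg 1" if "b \<in> ?Q \<times> ?H" for b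
      using that by (auto simp: homog_def)
    show "\<exists>q\<in>FP 1. Poly_Mapping.keys (p - q) \<subseteq> ?W \<times> ?H" if "p \<in> free_smash_filt 1"
      for p :: "gen list \<times> t2 \<Rightarrow>\<^sub>0 'k"
    proof -
      obtain q where q: "Poly_Mapping.keys q \<subseteq> Poly_Mapping.keys p - ?W \<times> ?H"
        "Poly_Mapping.keys (p - q) \<subseteq> ?W \<times> ?H"
        using keys_diff_restrict[of p "?W \<times> ?H"] by blast
      \<comment> \<open>The four one-letter words exhaust length 1, so what remains outside them has
        degree 0.\<close>
      have "length w = 0" if "(w, h) \<in> Poly_Mapping.keys q" for w h
      proof -
        have "length w \<le> 1" "w \<notin> ?W"
          using that q(1) \<open>p \<in> free_smash_filt 1\<close> by (auto simp: free_smash_filt_def)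
        moreover have "[y] \<in> ?W" for y :: gen
          by (cases y; cases "projl y"; cases "projr y") auto
        ultimately show ?thesis
          by (cases w) auto
      qed
      then have "q \<in> FP 1"
        by (auto simp: FP_def free_smash_filt_def)
      then show ?thesis
        using q by blast
    qed
  qed (use p in \<open>auto simp: free_smash_filt_eq\<close>)
  then have p0: "p \<in> free_smash_filt 0"
    by (simp add: FP_def)
  have "p \<in> FP 0"
  proof (rule J_trivial_of_dim[OF iso, of "{[]} \<times> ?H" "{0} \<times> ?H"])
    show "finite ({[]} \<times> ?H)" "finite ({0} \<times> ?H)"
      using finH by auto
    show "card ({[]} \<times> ?H) \<le> card ({0} \<times> ?H)"
      by (simp add: card_cartesian_product)
    show "bas b \<in> free_smash_filt 0" if "b \<in> {[]} \<times> ?H" for b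
      using that by (auto simp: free_smash_filt_eq intro: below_single)
    show "bas b \<in> homog sdeg 0" if "b \<in> {0} \<times> ?H" for b
      using that by (auto simp: homog_def zero_prod_def)
    show "\<exists>q\<in>FP 0. Poly_Mapping.keys (p - q) \<subseteq> {[]} \<times> ?H" if "p \<in> free_smash_filt 0"
      for p :: "gen list \<times> t2 \<Rightarrow>\<^sub>0 'k"
      using that by (auto simp: FP_def free_smash_filt_def)
  qed (use p p0 in auto)
  then show ?thesis
    by (simp add: FP_def)
qed

section \<open>Constraints on \<open>\<kappa>\<close>\<close>

lemma t2_coeffs: "\<exists>a b c d. (p :: t2 \<Rightarrow>\<^sub>0 'k::field) =
    Poly_Mapping.single T1 a + Poly_Mapping.single Tg b + Poly_Mapping.single Tx c + Poly_Mapping.single Tgx d"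
proof -
  let ?c = "Poly_Mapping.lookup p"
  have "?c h = Poly_Mapping.lookup (Poly_Mapping.single T1 (?c T1) + Poly_Mapping.single Tg (?c Tg) +
      Poly_Mapping.single Tx (?c Tx) + Poly_Mapping.single Tgx (?c Tgx)) h" for h
    by (cases h) (simp_all add: lookup_add lookup_single)
  then show ?thesis
    by (metis poly_mapping_eqI)
qed

abbreviation g_e :: "gen \<Rightarrow> (gen list \<times> t2 \<Rightarrow>\<^sub>0 'k::field)" where "g_e y \<equiv> bas ([y], T1)"
abbreviation h_e :: "t2 \<Rightarrow> (gen list \<times> t2 \<Rightarrow>\<^sub>0 'k::field)" where "h_e h \<equiv> bas ([], h)"

abbreviation mon :: "gen list \<Rightarrow> t2 \<Rightarrow> 'k::field \<Rightarrow> (gen list \<times> t2 \<Rightarrow>\<^sub>0 'k)" where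
  "mon w h c \<equiv> Poly_Mapping.single (w, h) c"

lemma fs_prod_single:
  "Poly_Mapping.single (w, h) c \<oslash> Poly_Mapping.single (w', h') d =
    scl (c * d) (lin_ext (\<lambda>(h1, h2). tens (bas w \<odot> free_act h1 w') (t2_mul h2 h')) (t2_comul h))"
  by (simp add: bilin_ext_bas smash_mul_def)

text \<open>Each step combines the generators of the ideal so that all words of length at least 2
  cancel. What is left comes from \<kappa>, has degree at most 1 and lies in the ideal, so its
  coefficients vanish.\<close>

lemma scalar_if_PBW:
  fixes l :: "'k::field"
  assumes char: "CHAR('k) \<noteq> 2" and pbw: "PBW_deformation l \<kappa>"
  shows "\<exists>\<alpha>. scalar_at_4 l \<alpha> \<kappa>"
proof -
  interpret filtered_quotient "smash_mul free_mul free_act" "([], T1)" "def_ideal l \<kappa>" free_smash_filt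
    by (rule filtered_quotient_def_ideal)
  define \<rho> where "\<rho> i = tens (rel l i) (bas T1) - tens (bas []) (\<kappa> (rel l i))" for i
  have \<rho>: "\<rho> i \<in> def_ideal l \<kappa>" if "i \<in> {Suc 0, 2, 3, 4, 5, 6}" for i
    unfolding \<rho>_def by (rule def_ideal_mem) (use that in \<open>auto simp: rels_eq\<close>)
  have \<rho>1: "\<rho> (Suc 0) \<in> def_ideal l \<kappa>" and \<rho>2: "\<rho> 2 \<in> def_ideal l \<kappa>" and \<rho>3: "\<rho> 3 \<in> def_ideal l \<kappa>"
    and \<rho>4: "\<rho> 4 \<in> def_ideal l \<kappa>" and \<rho>5: "\<rho> 5 \<in> def_ideal l \<kappa>" and \<rho>6: "\<rho> 6 \<in> def_ideal l \<kappa>"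
    by (auto intro: \<rho>)
  note intros = J_add J_diff J_left J_right J_scl \<rho>1 \<rho>2 \<rho>3 \<rho>4 \<rho>5 \<rho>6
  note trivial = def_ideal_trivial_below_1[OF char pbw]
  note calc = scl_simps rel_simps tens_simps tens_bas bilin_ext_simps fs_prod_single free_act_1
    free_act_Nil free_act_Cons gen_act_1 gen_act_g gen_act_x single_uminus
  have two: "(2 :: 'k) \<noteq> 0"
    by (rule two_neq_0[OF char])

  \<comment> \<open>A relation that changes sign under g anticommutes with g in the smash product,
    as do x and gx. So g\<rho> + \<rho>g is -2g times the part of \<kappa> in the span of 1 and
    g.\<close>
  have odd: "\<exists>c d. \<kappa> (rel l i) = Poly_Mapping.single Tx c + Poly_Mapping.single Tgx d"
    if i: "\<rho> i \<in> def_ideal l \<kappa>" and g: "lin_ext (free_act Tg) (rel l i) = - rel l i" for i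
  proof -
    obtain a b c d where k: "\<kappa> (rel l i) = Poly_Mapping.single T1 a + Poly_Mapping.single Tg b +
        Poly_Mapping.single Tx c + Poly_Mapping.single Tgx d"
      using t2_coeffs by blast
    have 1: "h_e Tg \<oslash> tens (rel l i) (bas T1) = tens (- rel l i) (bas Tg)"
      using free.smash_tens[of "bas []" Tg "rel l i" T1] by (simp add: tens_bas g)
    have 2: "tens (rel l i) (bas T1) \<oslash> h_e Tg = tens (rel l i) (bas Tg)"
      using free.smash_tens[of "rel l i" T1 "bas []" Tg] by (simp add: tens_bas free_act_Nil)
    have "h_e Tg \<oslash> \<rho> i + \<rho> i \<oslash> h_e Tg \<in> def_ideal l \<kappa>"
      by (intro J_add J_left J_right i)
    moreover have "h_e Tg \<oslash> \<rho> i + \<rho> i \<oslash> h_e Tg =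
        - mon [] T1 b - mon [] T1 b
        - mon [] Tg a - mon [] Tg a" (is "_ = ?z")
      unfolding \<rho>_def k by (simp add: 1 2 tens_simps tens_bas bilin_ext_simps fs_prod_single
          free_act_Nil single_uminus)
    ultimately have "?z = 0"
      by (intro trivial) (simp_all add: below_neg below_diff below_single)
    then have "Poly_Mapping.lookup ?z ([], T1) = 0" "Poly_Mapping.lookup ?z ([], Tg) = 0"
      by (simp_all only: lookup_zero)
    then have "a = 0" "b = 0"
      using two by (simp_all add: lookup_minus lookup_single)
    then show ?thesis
      using k by auto
  qed
  obtain c1 d1 where k1: "\<kappa> (rel l (Suc 0)) = Poly_Mapping.single Tx c1 + Poly_Mapping.single Tgx d1"
    using odd[OF \<rho>1] by (auto simp: rel_simps free_act_Cons free_act_Nil gen_act_g bilin_ext_simps)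
  obtain c2 d2 where k2: "\<kappa> (rel l 2) = Poly_Mapping.single Tx c2 + Poly_Mapping.single Tgx d2"
    using odd[OF \<rho>2] by (auto simp: rel_simps free_act_Cons free_act_Nil gen_act_g bilin_ext_simps)
  obtain c3 d3 where k3: "\<kappa> (rel l 3) = Poly_Mapping.single Tx c3 + Poly_Mapping.single Tgx d3"
    using odd[OF \<rho>3] by (auto simp: rel_simps free_act_Cons free_act_Nil gen_act_g bilin_ext_simps)
  obtain c6 d6 where k6: "\<kappa> (rel l 6) = Poly_Mapping.single Tx c6 + Poly_Mapping.single Tgx d6"
    using odd[OF \<rho>6] by (auto simp: rel_simps free_act_Cons free_act_Nil gen_act_g bilin_ext_simps)
  obtain a5 b5 c5 d5 where k5: "\<kappa> (rel l 5) = Poly_Mapping.single T1 a5 + Poly_Mapping.single Tg b5 +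
      Poly_Mapping.single Tx c5 + Poly_Mapping.single Tgx d5"
    using t2_coeffs by blast
  obtain a4 b4 c4 d4 where k4: "\<kappa> (rel l 4) = Poly_Mapping.single T1 a4 + Poly_Mapping.single Tg b4 +
      Poly_Mapping.single Tx c4 + Poly_Mapping.single Tgx d4"
    using t2_coeffs by blast
  have r5: "\<rho> 5 = bas ([gu, gu'], T1) - bas ([gu', gu], T1)
      - (mon [] T1 a5 + mon [] Tg b5 +
      mon [] Tx c5 + mon [] Tgx d5)"
    unfolding \<rho>_def k5 by (simp add: rel_simps tens_simps tens_bas)
  have r4: "\<rho> 4 = bas ([gv, gv'], T1) + bas ([gv', gv], T1) - mon [gu, gu'] T1 l
      - (mon [] T1 a4 + mon [] Tg b4 +
      mon [] Tx c4 + mon [] Tgx d4)"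
    unfolding \<rho>_def k4 by (simp add: rel_simps tens_simps tens_bas)

  have r1: "\<rho> (Suc 0) = bas ([gu, gv], T1) - bas ([gv, gu], T1)
      - (mon [] Tx c1 + mon [] Tgx d1)"
    unfolding \<rho>_def k1 by (simp add: rel_simps tens_simps tens_bas)
  have r2: "\<rho> 2 = bas ([gu', gv'], T1) - bas ([gv', gu'], T1)
      - (mon [] Tx c2 + mon [] Tgx d2)"
    unfolding \<rho>_def k2 by (simp add: rel_simps tens_simps tens_bas)
  have r3: "\<rho> 3 = bas ([gu, gv'], T1) - bas ([gv', gu], T1)
      - (mon [] Tx c3 + mon [] Tgx d3)"
    unfolding \<rho>_def k3 by (simp add: rel_simps tens_simps tens_bas)
  have r6: "\<rho> 6 = bas ([gv, gu'], T1) - bas ([gu', gv], T1)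
      - (mon [] Tx c6 + mon [] Tgx d6)"
    unfolding \<rho>_def k6 by (simp add: rel_simps tens_simps tens_bas)

  \<comment> \<open>g fixes r5, so the commutator with g isolates the part of \<kappa> in the span
    of x and gx. The same is done for r4 below.\<close>
  have "h_e Tg \<oslash> \<rho> 5 - \<rho> 5 \<oslash> h_e Tg \<in> def_ideal l \<kappa>"
    by (intro intros)
  moreover have "h_e Tg \<oslash> \<rho> 5 - \<rho> 5 \<oslash> h_e Tg =
     - mon [] Tx d5 - mon [] Tx d5
     - mon [] Tgx c5 - mon [] Tgx c5" (is "_ = ?z")
    unfolding r5 by (simp add: calc)
  ultimately have "?z = 0"
    by (intro trivial) (simp_all add: below_neg below_diff below_single)
  then have "Poly_Mapping.lookup ?z ([], Tx) = 0" "Poly_Mapping.lookup ?z ([], Tgx) = 0"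
    by (simp_all only: lookup_zero)
  then have cd5: "c5 = 0" "d5 = 0"
    using two by (simp_all add: lookup_minus lookup_single)

  have "h_e Tg \<oslash> \<rho> 4 - \<rho> 4 \<oslash> h_e Tg \<in> def_ideal l \<kappa>"
    by (intro intros)
  moreover have "h_e Tg \<oslash> \<rho> 4 - \<rho> 4 \<oslash> h_e Tg =
      - mon [] Tx d4 - mon [] Tx d4
     - mon [] Tgx c4 - mon [] Tgx c4" (is "_ = ?z")
    unfolding r4 by (simp add: calc)
  ultimately have "?z = 0"
    by (intro trivial) (simp_all add: below_neg below_add below_diff below_single)
  then have "Poly_Mapping.lookup ?z ([], Tx) = 0" "Poly_Mapping.lookup ?z ([], Tgx) = 0"
    by (simp_all only: lookup_zero)
  then have cd4: "c4 = 0" "d4 = 0"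
    using two by (simp_all add: lookup_add lookup_minus lookup_single)

  \<comment> \<open>x kills r5 and g fixes it, so r5 commutes with x; only b5 times gx - xg = 2gx
    survives.\<close>
  have "h_e Tx \<oslash> \<rho> 5 - \<rho> 5 \<oslash> h_e Tx \<in> def_ideal l \<kappa>"
    by (intro intros)
  moreover have "h_e Tx \<oslash> \<rho> 5 - \<rho> 5 \<oslash> h_e Tx =
      mon [] Tgx b5 + mon [] Tgx b5" (is "_ = ?z")
    unfolding r5 cd5 by (simp add: calc)
  ultimately have "?z = 0"
    by (intro trivial) (simp_all add: below_neg below_add below_diff below_single)
  then have "Poly_Mapping.lookup ?z ([], Tgx) = 0"
    by (simp_all only: lookup_zero)
  then have b5: "b5 = 0"
    using two by (simp_all add: lookup_add lookup_minus lookup_single)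

  \<comment> \<open>x.r3 = r5 and g.r3 = -r3, hence x r3 + r3 x = r5. The value of \<kappa> at r3
    lies in the span of x and gx, which x kills on both sides, so the value at r5 is all that
    remains.\<close>
  have "h_e Tx \<oslash> \<rho> 3 + \<rho> 3 \<oslash> h_e Tx - \<rho> 5 \<in> def_ideal l \<kappa>"
    by (intro intros)
  moreover have "h_e Tx \<oslash> \<rho> 3 + \<rho> 3 \<oslash> h_e Tx - \<rho> 5 =
      mon [] T1 a5" (is "_ = ?z")
    unfolding r3 r5 cd5 b5 by (simp add: calc)
  ultimately have "?z = 0"
    by (intro trivial) (simp_all add: below_neg below_add below_diff below_single)
  then have "Poly_Mapping.lookup ?z ([], T1) = 0"
    by (simp_all only: lookup_zero)
  then have a5: "a5 = 0"
    using two by (simp_all add: lookup_add lookup_minus lookup_single)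

  text \<open>The overlap \<open>[u, {v, v'}] = {[u, v], v'} + {v, [u, v']}\<close>.\<close>
  have "g_e gu \<oslash> \<rho> 4 - \<rho> 4 \<oslash> g_e gu - (\<rho> (Suc 0) \<oslash> g_e gv' + g_e gv' \<oslash> \<rho> (Suc 0))
      - (g_e gv \<oslash> \<rho> 3 + \<rho> 3 \<oslash> g_e gv) + scl l (g_e gu \<oslash> \<rho> 5) \<in> def_ideal l \<kappa>"
    by (intro intros)
  \<comment> \<open>The term \<lambda> u \<rho>5 compensates the commutator of u with \<lambda> u u'
    in r4. As u commutes with 1 and g, a4 and b4 drop out. The remaining terms come from x v' = u' -
    v'x and (gx)v' = u'g + v'gx, and likewise for v.\<close>
  moreover have "g_e gu \<oslash> \<rho> 4 - \<rho> 4 \<oslash> g_e gu - (\<rho> (Suc 0) \<oslash> g_e gv' + g_e gv' \<oslash> \<rho> (Suc 0))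
      - (g_e gv \<oslash> \<rho> 3 + \<rho> 3 \<oslash> g_e gv) + scl l (g_e gu \<oslash> \<rho> 5) =
      mon [gu'] T1 c1 + mon [gu'] Tg d1 + mon [gv'] Tgx d1 + mon [gv'] Tgx d1 +
      mon [gu] T1 c3 + mon [gu] Tg d3 + mon [gv] Tgx d3 + mon [gv] Tgx d3" (is "_ = ?z")
    unfolding r4 r1 r3 r5 cd4 cd5 b5 a5 by (simp add: calc)
  ultimately have "?z = 0"
    by (intro trivial) (simp_all add: below_neg below_add below_diff below_single)
  then have "Poly_Mapping.lookup ?z ([gu'], T1) = 0" "Poly_Mapping.lookup ?z ([gu'], Tg) = 0"
    "Poly_Mapping.lookup ?z ([gu], T1) = 0" "Poly_Mapping.lookup ?z ([gu], Tg) = 0"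
    by (simp_all only: lookup_zero)
  then have cd13: "c1 = 0" "d1 = 0" "c3 = 0" "d3 = 0"
    using two by (simp_all add: lookup_add lookup_minus lookup_single)

  text \<open>The overlap \<open>[u', {v, v'}] = {[u', v], v'} + {v, [u', v']}\<close>.\<close>
  have "g_e gu' \<oslash> \<rho> 4 - \<rho> 4 \<oslash> g_e gu' + (\<rho> 6 \<oslash> g_e gv' + g_e gv' \<oslash> \<rho> 6)
      - (g_e gv \<oslash> \<rho> 2 + \<rho> 2 \<oslash> g_e gv) - scl l (\<rho> 5 \<oslash> g_e gu') \<in> def_ideal l \<kappa>"
    by (intro intros)
  moreover have "g_e gu' \<oslash> \<rho> 4 - \<rho> 4 \<oslash> g_e gu' + (\<rho> 6 \<oslash> g_e gv' + g_e gv' \<oslash> \<rho> 6)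
      - (g_e gv \<oslash> \<rho> 2 + \<rho> 2 \<oslash> g_e gv) - scl l (\<rho> 5 \<oslash> g_e gu') =
      - mon [gu'] T1 c6 - mon [gu'] Tg d6 - mon [gv'] Tgx d6 - mon [gv'] Tgx d6
     + mon [gu] T1 c2 + mon [gu] Tg d2 + mon [gv] Tgx d2 + mon [gv] Tgx d2" (is "_ = ?z")
    unfolding r4 r6 r2 r5 cd4 cd5 b5 a5 by (simp add: calc)
  ultimately have "?z = 0"
    by (intro trivial) (simp_all add: below_neg below_add below_diff below_single)
  then have "Poly_Mapping.lookup ?z ([gu'], T1) = 0" "Poly_Mapping.lookup ?z ([gu'], Tg) = 0"
    "Poly_Mapping.lookup ?z ([gu], T1) = 0" "Poly_Mapping.lookup ?z ([gu], Tg) = 0"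
    by (simp_all only: lookup_zero)
  then have cd26: "c6 = 0" "d6 = 0" "c2 = 0" "d2 = 0"
    using two by (simp_all add: lookup_add lookup_minus lookup_single)

  \<comment> \<open>Since x.r4 = r3 - r6 and g.r4 = r4, this combination has no words. It determines
    b4 only now that the values of \<kappa> at r3 and r6 are known to be 0.\<close>
  have "h_e Tx \<oslash> \<rho> 4 - \<rho> 4 \<oslash> h_e Tx - \<rho> 3 + \<rho> 6 \<in> def_ideal l \<kappa>"
    by (intro intros)
  moreover have "h_e Tx \<oslash> \<rho> 4 - \<rho> 4 \<oslash> h_e Tx - \<rho> 3 + \<rho> 6 =
      mon [] Tgx b4 + mon [] Tgx b4" (is "_ = ?z")
    unfolding r4 r3 r6 cd4 cd13 cd26 by (simp add: calc)
  ultimately have "?z = 0"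
    by (intro trivial) (simp_all add: below_neg below_add below_diff below_single)
  then have "Poly_Mapping.lookup ?z ([], Tgx) = 0"
    by (simp_all only: lookup_zero)
  then have b4: "b4 = 0"
    using two by (simp_all add: lookup_add lookup_minus lookup_single)

  have "\<kappa> (rel l i) = 0" if "i \<in> {1..6}" "i \<noteq> 4" for i
  proof -
    have "i \<in> {Suc 0, 2, 3, 5, 6}"
      using that by auto
    then show ?thesis
      using k1 k2 k3 k5 k6 cd13 cd26 cd5 b5 a5 by auto
  qed
  moreover have "\<kappa> (rel l 4) = scl a4 (bas T1)"
    using k4 cd4 b4 by simp
  ultimately show ?thesis
    unfolding scalar_at_4_def by blast
qed

section \<open>Existence of the maps \<kappa> and the final statement\<close>

lemma ex_scalar_at_4: "\<exists>\<kappa>\<in>rel_maps l. scalar_at_4 l \<alpha> \<kappa>"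
proof (rule bexI)
  \<comment> \<open>The word v'v occurs in r4 only, and there with coefficient 1, so reading off its
    coefficient is a linear form separating r4 from the other relations.\<close>
  let ?\<kappa> = "\<lambda>p. scl (\<alpha> * Poly_Mapping.lookup p [gv', gv]) (bas T1)"
  have "?\<kappa> (rel l i) = 0" if "i \<in> {1..6}" "i \<noteq> 4" for i
  proof -
    have "i \<in> {Suc 0, 2, 3, 5, 6}"
      using that by auto
    then show ?thesis
      by (auto simp: rel_simps lookup_minus lookup_single)
  qed
  moreover have "?\<kappa> (rel l 4) = scl \<alpha> (bas T1)"
    by (simp add: rel_simps lookup_add lookup_minus lookup_single)
  ultimately show "scalar_at_4 l \<alpha> ?\<kappa>"
    unfolding scalar_at_4_def by blast
  show "?\<kappa> \<in> rel_maps l"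
    by (simp add: rel_maps_def Let_def lookup_add distrib_left single_add mult.left_commute)
qed

theorem proposition4p2:
  fixes l :: "'k::field"
  assumes "CHAR('k) \<noteq> 2"
  shows "Ae_eval l \<in> alg_hom free_alg (Ae l) \<and>
         Ae_eval l ` carrier free_alg = carrier (Ae l) \<and>
         a_kernel free_alg (Ae l) (Ae_eval l) = Idl\<^bsub>free_alg\<^esub> (rels l) \<and>
         (\<forall>\<alpha>. \<exists>\<kappa>\<in>rel_maps l. scalar_at_4 l \<alpha> \<kappa>) \<and>
         (\<forall>\<alpha>. \<forall>\<kappa>\<in>rel_maps l. scalar_at_4 l \<alpha> \<kappa> \<longrightarrow> PBW_deformation l \<kappa>) \<and>
         (\<forall>\<kappa>\<in>rel_maps l. PBW_deformation l \<kappa> \<longrightarrow> (\<exists>\<alpha>. scalar_at_4 l \<alpha> \<kappa>))"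
  by (intro conjI allI ballI impI Ae_presentation[OF assms] ex_scalar_at_4)
    (erule PBW_if_scalar[OF _ assms] scalar_if_PBW[OF assms])+

end
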